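(* Fix $\epsilon>0$. There exists $\delta>0$ such that the integrality gap of $n^{\delta}$ rounds of the Sherali–Adams hierarchy for Graph Pricing is at most $\frac14+\epsilon$; i.e., (for arbitrarily large $n$) there are Graph Pricing instances on $n$ vertices whose integral optimum is at most $\frac14+\epsilon$ times the value of some feasible solution of the $n^\delta$-round Sherali–Adams relaxation.
   Context: Graph Pricing: an instance consists of an undirected graph $G=(V,E)$ (parallel edges allowed), budgets $b:E\to\mathbb{R}^+$ and weights $w:E\to\mathbb{R}^+$; a pricing $p:V\to\mathbb{R}^+\cup\{0\}$ has value $\mathsf{Val}(p)=\sum_{e=(u,v)} w(e)(p(u)+p(v))\mathbb{I}[p(u)+p(v)\le b(e)]$, and $\mathsf{Opt}=\max_p\mathsf{Val}(p)$. The $r$-round Sherali–Adams relaxation with (finite) price domain $Q$ (e.g. $Q=\{0,1,\dots,B\}$ with $B$ the maximum budget) has variables $x_S(\alpha)$ for every vertex set $S$ with $|S|\le r$ and $\alpha\in Q^S$, subject to $x_S(\alpha)\ge0$, $\sum_{\alpha\in Q^S}x_S(\alpha)=1$, and $\sum_{\alpha\in Q^{S'\setminus S}}x_{S'}(\alpha\circ\beta)=x_S(\beta)$ for all $S\subseteq S'$, $\beta\in Q^S$; its objective is $\sum_{e=(u,v)}w(e)\sum_{(i,j)\in Q^2,\, i+j\le b(u,v)}(i+j)\,x_{\{u,v\}}(i,j)$. The integrality gap of an instance is the integral optimum divided by the optimum of the relaxation. *)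

theory Defs
  imports Complex_Main "HOL-Library.FuncSet"
begin

section \<open>Instances and the integral optimum\<close>

text \<open>Edges carry their own identities, so parallel edges are allowed. The order of the two
  endpoints of an edge is irrelevant: everything below is symmetric in them.\<close>

record ('v, 'e) pricing_instance =
  verts :: "'v set"
  edges :: "'e set"
  end1 :: "'e \<Rightarrow> 'v"
  end2 :: "'e \<Rightarrow> 'v"
  budget :: "'e \<Rightarrow> real"
  weight :: "'e \<Rightarrow> real"

text \<open>Instances without edges are excluded: they have no maximum budget, and their integrality gap
  would be 0/0.\<close>

definition graph_pricing_instance :: "('v, 'e) pricing_instance \<Rightarrow> bool" where
  "graph_pricing_instance I \<longleftrightarrow>
     finite (verts I) \<and> finite (edges I) \<and> edges I \<noteq> {} \<and>
     (\<forall>e\<in>edges I. end1 I e \<in> verts I \<and> end2 I e \<in> verts I \<and> end1 I e \<noteq> end2 I e \<and>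
        0 < budget I e \<and> 0 < weight I e)"

definition pricings :: "('v, 'e) pricing_instance \<Rightarrow> ('v \<Rightarrow> real) set" where
  "pricings I = {p. \<forall>v\<in>verts I. 0 \<le> p v}"

definition pricing_val :: "('v, 'e) pricing_instance \<Rightarrow> ('v \<Rightarrow> real) \<Rightarrow> real" where
  "pricing_val I p =
     (\<Sum>e\<in>edges I. weight I e * (p (end1 I e) + p (end2 I e)) *
        of_bool (p (end1 I e) + p (end2 I e) \<le> budget I e))"

definition pricing_opt :: "('v, 'e) pricing_instance \<Rightarrow> real" where
  "pricing_opt I = (SUP p\<in>pricings I. pricing_val I p)"

lemma bdd_above_pricing_val:
  assumes "graph_pricing_instance I"
  shows "bdd_above (pricing_val I ` pricings I)"
proof (rule bdd_aboveI2)
  fix p assume "p \<in> pricings I"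
  show "pricing_val I p \<le> (\<Sum>e\<in>edges I. weight I e * budget I e)"
    unfolding pricing_val_def
  proof (rule sum_mono)
    fix e assume "e \<in> edges I"
    then have "0 < budget I e" "0 < weight I e"
      using assms by (auto simp: graph_pricing_instance_def)
    then show "weight I e * (p (end1 I e) + p (end2 I e)) *
        of_bool (p (end1 I e) + p (end2 I e) \<le> budget I e) \<le> weight I e * budget I e"
      by (auto simp: of_bool_def)
  qed
qed

section \<open>The Sherali--Adams relaxation\<close>

text \<open>A local assignment on \<open>S\<close> is an element of \<open>S \<rightarrow>\<^sub>E Q\<close>, hence \<open>undefined\<close> outside \<open>S\<close>.
  For \<open>S \<subseteq> S'\<close>, \<open>override_on \<beta> \<alpha> (S' - S)\<close> glues \<open>\<beta>\<close> on \<open>S\<close> and \<open>\<alpha>\<close> on \<open>S' - S\<close>.\<close>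

definition sa_feasible ::
  "('v, 'e) pricing_instance \<Rightarrow> real set \<Rightarrow> nat \<Rightarrow> ('v set \<Rightarrow> ('v \<Rightarrow> real) \<Rightarrow> real) \<Rightarrow> bool" where
  "sa_feasible I Q r x \<longleftrightarrow>
     (\<forall>S. S \<subseteq> verts I \<and> card S \<le> r \<longrightarrow>
        (\<forall>\<alpha>\<in>S \<rightarrow>\<^sub>E Q. 0 \<le> x S \<alpha>) \<and> (\<Sum>\<alpha>\<in>S \<rightarrow>\<^sub>E Q. x S \<alpha>) = 1) \<and>
     (\<forall>S S'. S \<subseteq> S' \<and> S' \<subseteq> verts I \<and> card S' \<le> r \<longrightarrow>
        (\<forall>\<beta>\<in>S \<rightarrow>\<^sub>E Q. (\<Sum>\<alpha>\<in>(S' - S) \<rightarrow>\<^sub>E Q. x S' (override_on \<beta> \<alpha> (S' - S))) = x S \<beta>))"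

definition pair_assignment :: "'v \<Rightarrow> 'v \<Rightarrow> real \<Rightarrow> real \<Rightarrow> 'v \<Rightarrow> real" where
  "pair_assignment u v i j = (\<lambda>_. undefined)(u := i, v := j)"

definition sa_value ::
  "('v, 'e) pricing_instance \<Rightarrow> real set \<Rightarrow> ('v set \<Rightarrow> ('v \<Rightarrow> real) \<Rightarrow> real) \<Rightarrow> real" where
  "sa_value I Q x =
     (\<Sum>e\<in>edges I. weight I e *
        (\<Sum>(i, j) \<in> {(i, j). i \<in> Q \<and> j \<in> Q \<and> i + j \<le> budget I e}.
           (i + j) * x {end1 I e, end2 I e} (pair_assignment (end1 I e) (end2 I e) i j)))"

definition sa_opt :: "('v, 'e) pricing_instance \<Rightarrow> real set \<Rightarrow> nat \<Rightarrow> real" where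
  "sa_opt I Q r = (SUP x\<in>{x. sa_feasible I Q r x}. sa_value I Q x)"

definition integrality_gap :: "('v, 'e) pricing_instance \<Rightarrow> real set \<Rightarrow> nat \<Rightarrow> real" where
  "integrality_gap I Q r = pricing_opt I / sa_opt I Q r"

text \<open>With fewer than two rounds the pair variables of the objective are unconstrained; from two
  rounds on the relaxation is bounded.\<close>

lemma bdd_above_sa_value:
  assumes I: "graph_pricing_instance I" and Q: "finite Q" and r: "2 \<le> r"
  shows "bdd_above (sa_value I Q ` {x. sa_feasible I Q r x})"
proof (rule bdd_aboveI2)
  fix x assume "x \<in> {x. sa_feasible I Q r x}"
  then have x: "sa_feasible I Q r x" by simp
  show "sa_value I Q x \<le> (\<Sum>e\<in>edges I. weight I e *
      (\<Sum>(i, j) \<in> {(i, j). i \<in> Q \<and> j \<in> Q \<and> i + j \<le> budget I e}. \<bar>i + j\<bar>))"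
    unfolding sa_value_def
  proof (intro sum_mono mult_left_mono)
    fix e assume e: "e \<in> edges I"
    define u v where "u = end1 I e" and "v = end2 I e"
    have uv: "u \<in> verts I" "v \<in> verts I" "u \<noteq> v" and "0 < weight I e"
      using I e by (auto simp: graph_pricing_instance_def u_def v_def)
    then show "0 \<le> weight I e" by simp
    have S: "{u, v} \<subseteq> verts I" "card {u, v} \<le> r" using uv r by auto
    have nonneg: "0 \<le> x {u, v} \<alpha>" if "\<alpha> \<in> {u, v} \<rightarrow>\<^sub>E Q" for \<alpha>
      using x S that unfolding sa_feasible_def by blast
    have one: "(\<Sum>\<alpha>\<in>{u, v} \<rightarrow>\<^sub>E Q. x {u, v} \<alpha>) = 1"
      using x S unfolding sa_feasible_def by blast
    have fin: "finite ({u, v} \<rightarrow>\<^sub>E Q)" using Q by (intro finite_PiE) auto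
    fix ij assume "ij \<in> {(i, j). i \<in> Q \<and> j \<in> Q \<and> i + j \<le> budget I e}"
    then obtain i j where ij: "ij = (i, j)" "i \<in> Q" "j \<in> Q" by auto
    have mem: "pair_assignment u v i j \<in> {u, v} \<rightarrow>\<^sub>E Q"
      using ij by (auto simp: pair_assignment_def PiE_def extensional_def)
    have le: "x {u, v} (pair_assignment u v i j) \<le> 1"
      using member_le_sum[OF mem _ fin, of "x {u, v}"] nonneg one by auto
    have "(i + j) * x {u, v} (pair_assignment u v i j) \<le>
        \<bar>i + j\<bar> * x {u, v} (pair_assignment u v i j)"
      by (intro mult_right_mono nonneg[OF mem]) simp
    also have "\<dots> \<le> \<bar>i + j\<bar>"
      by (rule mult_left_le[OF le]) simp
    finally show "(case ij of (i, j) \<Rightarrow>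
        (i + j) * x {end1 I e, end2 I e} (pair_assignment (end1 I e) (end2 I e) i j))
        \<le> (case ij of (i, j) \<Rightarrow> \<bar>i + j\<bar>)"
      by (simp add: ij u_def v_def)
  qed
qed

text \<open>For integral budgets this is the price domain \<open>{0, 1, \<dots>, B}\<close> with \<open>B\<close> the maximum budget.\<close>

definition price_grid :: "('v, 'e) pricing_instance \<Rightarrow> real set" where
  "price_grid I = {q. q \<in> \<nat> \<and> q \<le> Max (budget I ` edges I)}"

lemma finite_price_grid: "finite (price_grid I)"
proof (rule finite_subset)
  show "price_grid I \<subseteq> real ` {..nat \<lfloor>Max (budget I ` edges I)\<rfloor>}"
    by (auto simp: price_grid_def le_nat_floor elim!: Nats_cases)
qed simp

end

theory Submission
  imports Defs "HOL-Real_Asymp.Real_Asymp" "HOL-Analysis.Convex"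
begin

text \<open>The vertices of the instance have linearly ordered types, and a vertex of type \<open>t\<close> has \<open>m - 1\<close> price
  scales of its own, all far below those of the higher types. Every edge joins a vertex \<open>u\<close> of a higher
  type to a vertex \<open>v\<close> of a lower type; its budget \<open>b\<close> is a random scale of \<open>v\<close> and its weight is \<open>1 / b\<close>. A pricing
  gains from it essentially only if \<open>u\<close> is nearly free and \<open>v\<close> sits exactly at \<open>b\<close>. The types of the two
  endpoints are drawn from a binary tree such that no set of types cuts more than about a quarter of the edges in the
  right direction, and hence no pricing of a random instance earns more than about \<open>1 / (4 m)\<close> per edge.

  In the relaxation the labels of the vertices are bit strings of length \<open>k\<close>, \<open>m = 2\<^sup>k\<close>, coupled along each edge by
  adding (xor) the label of its budget, so that an edge earns almost \<open>1 / m\<close>. Each bit is a rounded Gaussian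
  variable whose covariance decays like \<open>\<rho>\<^sup>d\<close> with the distance \<open>d\<close> and is cut off at distance \<open>L\<close>. Gaussian laws
  are determined by their covariances, hence the local distributions are consistent as soon as the kernel is positive
  semidefinite on all small vertex sets. With trigonometric rounding functions only finitely many values of the
  characteristic function occur, and no measure theory is needed. Small subgraphs of the random graph are so sparse that
  their Gaussian Markov field has a positive semidefinite precision matrix, which inverts the kernel up to errors of
  order \<open>\<rho>\<^sup>L\<close>; these are absorbed by a small multiple of the identity if \<open>L\<close> is a multiple of \<open>ln n\<close>.\<close>

section \<open>Gaussian expectations of trigonometric polynomials\<close>

text \<open>The constant 1/4 is the maximum of \<open>x * (1 - x)\<close>: if a fraction
  \<open>x\<close> of every type is priced on its own scales, an edge pays essentially when its
  lower endpoint is on its own scales and its higher endpoint is not. With pairs of types drawn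
  uniformly along the order, separating the low half from the high half would cut far more; in a
  tree, the two halves below a node can differ noticeably on few levels only. On the relaxation side
  the obstacle is consistency on overlapping vertex sets of a graph that still has long cycles. One
  global covariance settles it, but truncating that covariance destroys exact positivity, hence the
  slack \<mu>. The rounding function is periodic: a large variance \<sigma> makes its phase nearly
  uniform, so that a variable rarely lies near a zero of the wave, and the correlation 1 - \<mu>
  must then be so close to 1 that two endpoints still share a phase. This dictates the order of
  choice: \<open>m\<close> and the tree, the precision \<beta>, the wave, \<sigma>, \<mu>, the edge
  density \<open>D\<close>, and last \<delta>.\<close>

definition qf :: "'j set \<Rightarrow> ('j \<Rightarrow> 'j \<Rightarrow> real) \<Rightarrow> ('j \<Rightarrow> real) \<Rightarrow> real" where
  "qf J B t = (\<Sum>i\<in>J. \<Sum>j\<in>J. t i * t j * B i j)"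

lemma qf_insert:
  assumes "finite J" "j0 \<notin> J" "\<And>i j. B i j = B j i"
  shows "qf (insert j0 J) B t = (t j0)\<^sup>2 * B j0 j0 + 2 * t j0 * (\<Sum>j\<in>J. B j0 j * t j) + qf J B t"
proof -
  have "qf (insert j0 J) B t = t j0 * t j0 * B j0 j0 + (\<Sum>j\<in>J. t j0 * t j * B j0 j)
      + (\<Sum>i\<in>J. t i * t j0 * B i j0 + (\<Sum>j\<in>J. t i * t j * B i j))"
    unfolding qf_def using assms(1,2) by simp
  also have "(\<Sum>i\<in>J. t i * t j0 * B i j0 + (\<Sum>j\<in>J. t i * t j * B i j)) =
      (\<Sum>j\<in>J. t j0 * t j * B j0 j) + qf J B t"
    unfolding qf_def sum.distrib by (intro arg_cong2[of _ _ _ _ "(+)"] sum.cong) (auto simp: assms(3)[of j0])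
  finally show ?thesis by (simp add: sum_distrib_left power2_eq_square mult_ac)
qed

lemma qf_cong: "(\<And>i. i \<in> J \<Longrightarrow> t i = t' i) \<Longrightarrow> (\<And>i j. i \<in> J \<Longrightarrow> j \<in> J \<Longrightarrow> B i j = B' i j) \<Longrightarrow> qf J B t = qf J B' t'"
  unfolding qf_def by (intro sum.cong) auto

text \<open>Gaussian elimination, one index at a time: completing the square at a positive pivot
  splits off one square and leaves the Schur complement, which is again positive semidefinite. At a
  zero pivot, positivity forces the whole row to vanish.\<close>

lemma psd_sum_of_squares:
  fixes B :: "'j \<Rightarrow> 'j \<Rightarrow> real"
  assumes "finite J" "\<And>i j. B i j = B j i" "\<And>t. 0 \<le> qf J B t"
  shows "\<exists>ws. \<forall>t. qf J B t = (\<Sum>w\<leftarrow>ws. (\<Sum>j\<in>J. w j * t j)\<^sup>2)"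
  using assms
proof (induction J arbitrary: B rule: finite_induct)
  case empty
  show ?case by (rule exI[of _ "[]"]) (simp add: qf_def)
next
  case (insert j0 J B)
  note sym = insert.prems(1) and psd = insert.prems(2)
  note ins = qf_insert[OF insert.hyps(1,2) sym]
  define b where "b = (\<lambda>t. \<Sum>j\<in>J. B j0 j * t j)"
  have ins': "qf (insert j0 J) B t = (t j0)\<^sup>2 * B j0 j0 + 2 * t j0 * b t + qf J B t" for t
    unfolding ins b_def by simp
  have upd: "qf J B (t(j0 := x)) = qf J B t" "b (t(j0 := x)) = b t" for t x
    using insert.hyps(2) by (auto simp: b_def intro!: qf_cong sum.cong)
  have val: "0 \<le> x\<^sup>2 * B j0 j0 + 2 * x * b t + qf J B t" for x t
    using psd[of "t(j0 := x)"] upd[of t x] unfolding ins b_def by simp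
  have qJ: "0 \<le> qf J B t" for t using val[of 0 t] by simp
  have b00: "0 \<le> B j0 j0"
    using psd[of "(\<lambda>_. 0)(j0 := 1)"] upd[of "\<lambda>_. 0" 1] unfolding ins b_def by (simp add: qf_def)
  show ?case
  proof (cases "B j0 j0 = 0")
    case True
    have bz: "b t = 0" for t
    proof (rule ccontr)
      \<comment> \<open>With a zero pivot the form is affine in the coordinate \<open>j0\<close>;
        the value inserted below makes it equal to -1.\<close>
      assume "b t \<noteq> 0"
      then have "0 \<le> 2 * (- (qf J B t + 1) / (2 * b t)) * b t + qf J B t"
        using val[of "- (qf J B t + 1) / (2 * b t)" t] True by simp
      then show False using \<open>b t \<noteq> 0\<close> by (simp add: field_simps)
    qed
    obtain ws where ws: "\<forall>t. qf J B t = (\<Sum>w\<leftarrow>ws. (\<Sum>j\<in>J. w j * t j)\<^sup>2)"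
      using insert.IH[OF sym qJ] by blast
    define ws' where "ws' = map (\<lambda>w. w(j0 := 0)) ws"
    have "(\<Sum>w\<leftarrow>ws'. (\<Sum>j\<in>insert j0 J. w j * t j)\<^sup>2) = (\<Sum>w\<leftarrow>ws. (\<Sum>j\<in>J. w j * t j)\<^sup>2)" for t
      unfolding ws'_def map_map using insert.hyps
      by (intro arg_cong[of _ _ sum_list] map_cong refl)
         (auto intro!: arg_cong[of _ _ "\<lambda>x. x\<^sup>2"] sum.cong)
    then have "\<forall>t. qf (insert j0 J) B t = (\<Sum>w\<leftarrow>ws'. (\<Sum>j\<in>insert j0 J. w j * t j)\<^sup>2)"
      unfolding ins' using ws True bz by simp
    then show ?thesis by blast
  next
    case False
    then have pos: "0 < B j0 j0" using b00 by simp
    \<comment> \<open>The Schur complement of the pivot. It is positive semidefinite because its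
      value at \<open>t\<close> is the value of the full form at the minimising coordinate
      \<open>- b t / B j0 j0\<close>.\<close>
    define B' where "B' = (\<lambda>i j. B i j - B j0 i * B j0 j / B j0 j0)"
    have bb: "b t * b t = (\<Sum>i\<in>J. \<Sum>j\<in>J. t i * t j * (B j0 i * B j0 j))" for t
      unfolding b_def sum_product by (intro sum.cong) (auto simp: mult_ac)
    have q': "qf J B' t = qf J B t - (b t)\<^sup>2 / B j0 j0" for t
      unfolding qf_def B'_def power2_eq_square bb
      by (simp add: sum_subtractf right_diff_distrib sum_divide_distrib)
    have sym': "B' i j = B' j i" for i j unfolding B'_def using sym[of i j] by simp
    have "0 \<le> qf J B' t" for t
    proof -
      have "(- b t / B j0 j0)\<^sup>2 * B j0 j0 + 2 * (- b t / B j0 j0) * b t = - (b t)\<^sup>2 / B j0 j0"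
        using pos by (simp add: power2_eq_square field_simps)
      then show ?thesis using val[of "- b t / B j0 j0" t] unfolding q' by simp
    qed
    then obtain ws where ws: "\<forall>t. qf J B' t = (\<Sum>w\<leftarrow>ws. (\<Sum>j\<in>J. w j * t j)\<^sup>2)"
      using insert.IH[of B', OF sym'] by blast
    define ws' where "ws' = (\<lambda>j. B j0 j / sqrt (B j0 j0)) # map (\<lambda>w. w(j0 := 0)) ws"
    have m: "(\<Sum>w\<leftarrow>map (\<lambda>w. w(j0 := 0)) ws. (\<Sum>j\<in>insert j0 J. w j * t j)\<^sup>2) = (\<Sum>w\<leftarrow>ws. (\<Sum>j\<in>J. w j * t j)\<^sup>2)" for t
      unfolding map_map using insert.hyps
      by (intro arg_cong[of _ _ sum_list] map_cong refl)
         (auto intro!: arg_cong[of _ _ "\<lambda>x. x\<^sup>2"] sum.cong)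
    have *: "(\<Sum>j\<in>insert j0 J. B j0 j / sqrt (B j0 j0) * t j)\<^sup>2 = (t j0 * B j0 j0 + b t)\<^sup>2 / B j0 j0" for t
    proof -
      have "(\<Sum>j\<in>insert j0 J. B j0 j / sqrt (B j0 j0) * t j) = (t j0 * B j0 j0 + b t) / sqrt (B j0 j0)"
        using insert.hyps by (simp add: b_def sum_divide_distrib add_divide_distrib mult.commute)
      then show ?thesis using pos by (simp add: power_divide)
    qed
    have "qf (insert j0 J) B t = (\<Sum>w\<leftarrow>ws'. (\<Sum>j\<in>insert j0 J. w j * t j)\<^sup>2)" for t
    proof -
      have "(\<Sum>w\<leftarrow>ws'. (\<Sum>j\<in>insert j0 J. w j * t j)\<^sup>2) =
          (t j0 * B j0 j0 + b t)\<^sup>2 / B j0 j0 + (qf J B t - (b t)\<^sup>2 / B j0 j0)"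
        unfolding ws'_def list.map sum_list.Cons * m using ws[rule_format, of t] q'[of t] by simp
      also have "\<dots> = qf (insert j0 J) B t"
        using pos unfolding ins' by (simp add: power2_eq_square field_simps)
      finally show ?thesis by simp
    qed
    then show ?thesis by blast
  qed
qed

text \<open>The central limit theorem for coin flips, on the level of characteristic functions:
  \<open>cos (x / sqrt n) ^ n\<close> belongs to a sum of \<open>n\<close> random signs scaled by
  \<open>1 / sqrt n\<close>.\<close>

lemma cos_power_limit:
  fixes x :: real
  shows "(\<lambda>n. cos (x / sqrt (real (Suc n))) ^ Suc n) \<longlonglongrightarrow> exp (- x\<^sup>2 / 2)"
proof (cases "x = 0")
  case False
  have "(\<lambda>n. cos (x / sqrt (real n)) ^ n) \<longlonglongrightarrow> exp (- (x * x / 2))"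
    using False by real_asymp
  then show ?thesis unfolding power2_eq_square by (intro LIMSEQ_Suc) simp
qed simp

text \<open>Averaging a nonnegative function over the two shifts by \<open>w\<close> and
  \<open>-w\<close> keeps it nonnegative and multiplies each exponential by a cosine. The power
  \<open>n\<close> stands for \<open>n\<close> independent random shifts.\<close>

lemma char_average:
  fixes a :: "'i \<Rightarrow> complex" and \<tau> :: "'i \<Rightarrow> 'j \<Rightarrow> real"
  assumes nn: "\<And>y. 0 \<le> Re (\<Sum>i\<in>I. a i * cis (\<Sum>j\<in>J. \<tau> i j * y j))"
  shows "0 \<le> Re (\<Sum>i\<in>I. a i * of_real (cos (\<Sum>j\<in>J. w j * \<tau> i j) ^ n) * cis (\<Sum>j\<in>J. \<tau> i j * y j))"
proof (induction n arbitrary: y)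
  case 0
  then show ?case using nn by simp
next
  case (Suc n)
  let ?F = "\<lambda>y. \<Sum>i\<in>I. a i * of_real (cos (\<Sum>j\<in>J. w j * \<tau> i j) ^ n) * cis (\<Sum>j\<in>J. \<tau> i j * y j)"
  have cisav: "cis (A + D) + cis (A - D) = 2 * of_real (cos D) * cis A" for A D
    by (rule complex_eqI) (simp_all add: cos_add cos_diff sin_add sin_diff)
  have "?F (\<lambda>j. y j + w j) + ?F (\<lambda>j. y j - w j) =
      2 * (\<Sum>i\<in>I. a i * of_real (cos (\<Sum>j\<in>J. w j * \<tau> i j) ^ Suc n) * cis (\<Sum>j\<in>J. \<tau> i j * y j))"
    unfolding sum.distrib[symmetric] sum_distrib_left
  proof (rule sum.cong[OF refl])
    fix i assume "i \<in> I"
    have "(\<Sum>j\<in>J. \<tau> i j * (y j + w j)) = (\<Sum>j\<in>J. \<tau> i j * y j) + (\<Sum>j\<in>J. w j * \<tau> i j)"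
         "(\<Sum>j\<in>J. \<tau> i j * (y j - w j)) = (\<Sum>j\<in>J. \<tau> i j * y j) - (\<Sum>j\<in>J. w j * \<tau> i j)"
      by (simp_all add: algebra_simps sum.distrib sum_subtractf)
    then show "a i * of_real (cos (\<Sum>j\<in>J. w j * \<tau> i j) ^ n) * cis (\<Sum>j\<in>J. \<tau> i j * (y j + w j)) +
        a i * of_real (cos (\<Sum>j\<in>J. w j * \<tau> i j) ^ n) * cis (\<Sum>j\<in>J. \<tau> i j * (y j - w j)) =
        2 * (a i * of_real (cos (\<Sum>j\<in>J. w j * \<tau> i j) ^ Suc n) * cis (\<Sum>j\<in>J. \<tau> i j * y j))"
      using cisav[of "\<Sum>j\<in>J. \<tau> i j * y j" "\<Sum>j\<in>J. w j * \<tau> i j"]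
      by (simp add: distrib_left[symmetric] mult_ac)
  qed
  moreover have "0 \<le> Re (?F (\<lambda>j. y j + w j) + ?F (\<lambda>j. y j - w j))"
    using Suc by simp
  ultimately show ?case by simp
qed

lemma gauss_smoothing_step:
  fixes a :: "'i \<Rightarrow> complex" and \<tau> :: "'i \<Rightarrow> 'j \<Rightarrow> real"
  assumes nn: "\<And>y. 0 \<le> Re (\<Sum>i\<in>I. a i * cis (\<Sum>j\<in>J. \<tau> i j * y j))"
  shows "0 \<le> Re (\<Sum>i\<in>I. a i * of_real (exp (- (\<Sum>j\<in>J. w j * \<tau> i j)\<^sup>2 / 2)) * cis (\<Sum>j\<in>J. \<tau> i j * y j))"
proof -
  let ?F = "\<lambda>n. \<Sum>i\<in>I. a i * of_real (cos ((\<Sum>j\<in>J. w j * \<tau> i j) / sqrt (real (Suc n))) ^ Suc n) * cis (\<Sum>j\<in>J. \<tau> i j * y j)"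
  have "?F \<longlonglongrightarrow> (\<Sum>i\<in>I. a i * of_real (exp (- (\<Sum>j\<in>J. w j * \<tau> i j)\<^sup>2 / 2)) * cis (\<Sum>j\<in>J. \<tau> i j * y j))"
    by (intro tendsto_sum tendsto_mult tendsto_const tendsto_of_real cos_power_limit)
  then have lim: "(\<lambda>n. Re (?F n)) \<longlonglongrightarrow> Re (\<Sum>i\<in>I. a i * of_real (exp (- (\<Sum>j\<in>J. w j * \<tau> i j)\<^sup>2 / 2)) * cis (\<Sum>j\<in>J. \<tau> i j * y j))"
    by (rule tendsto_Re)
  have "0 \<le> Re (?F n)" for n
    using char_average[OF nn, where w = "\<lambda>j. w j / sqrt (real (Suc n))" and n = "Suc n" and y = y]
    by (simp add: sum_divide_distrib[symmetric] del: power_Suc)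
  then show ?thesis by (intro LIMSEQ_le_const[OF lim]) blast
qed

text \<open>The Gaussian mean of a nonnegative trigonometric polynomial is nonnegative. Each square
  in the decomposition of \<open>B\<close> is one smoothing step; evaluation at 0 after all steps
  gives the mean.\<close>

lemma gauss_functional_nonneg:
  fixes a :: "'i \<Rightarrow> complex" and \<tau> :: "'i \<Rightarrow> 'j \<Rightarrow> real"
  assumes nn: "\<And>y. 0 \<le> Re (\<Sum>i\<in>I. a i * cis (\<Sum>j\<in>J. \<tau> i j * y j))"
    and J: "finite J" and sym: "\<And>i j. B i j = B j i" and psd: "\<And>t. 0 \<le> qf J B t"
  shows "0 \<le> Re (\<Sum>i\<in>I. a i * of_real (exp (- qf J B (\<tau> i) / 2)))"
proof -
  obtain ws where ws: "\<And>t. qf J B t = (\<Sum>w\<leftarrow>ws. (\<Sum>j\<in>J. w j * t j)\<^sup>2)"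
    using psd_sum_of_squares[OF J sym psd] by blast
  have "0 \<le> Re (\<Sum>i\<in>I. a i * of_real (exp (- (\<Sum>w\<leftarrow>ws. (\<Sum>j\<in>J. w j * \<tau> i j)\<^sup>2) / 2)) * cis (\<Sum>j\<in>J. \<tau> i j * y j))" for y
  proof (induction ws arbitrary: y)
    case Nil
    then show ?case using nn by simp
  next
    case (Cons w ws)
    have "exp (- (\<Sum>w\<leftarrow>w # ws. (\<Sum>j\<in>J. w j * \<tau> i j)\<^sup>2) / 2) =
        exp (- (\<Sum>w\<leftarrow>ws. (\<Sum>j\<in>J. w j * \<tau> i j)\<^sup>2) / 2) * exp (- (\<Sum>j\<in>J. w j * \<tau> i j)\<^sup>2 / 2)" for i
      by (simp add: exp_add[symmetric] add_divide_distrib diff_divide_distrib)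
    then show ?case
      using gauss_smoothing_step[OF Cons.IH, where w = w and y = y] by (simp add: mult.assoc)
  qed
  from this[of "\<lambda>_. 0"] show ?thesis by (simp add: ws)
qed

text \<open>\<open>gauss_mean J B F v\<close>: \<open>F\<close> is a trigonometric polynomial in the variables \<open>J\<close>, and \<open>v\<close> its expectation
  under the centred Gaussian law with covariance \<open>B\<close>, obtained term by term from the characteristic function.\<close>

inductive gauss_mean :: "'j set \<Rightarrow> ('j \<Rightarrow> 'j \<Rightarrow> real) \<Rightarrow> (('j \<Rightarrow> real) \<Rightarrow> complex) \<Rightarrow> complex \<Rightarrow> bool"
  for J :: "'j set" and B where
  gauss_mean_exp: "gauss_mean J B (\<lambda>y. a * cis (\<Sum>j\<in>J. t j * y j)) (a * of_real (exp (- qf J B t / 2)))"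
| gauss_mean_add: "gauss_mean J B F v \<Longrightarrow> gauss_mean J B G w \<Longrightarrow> gauss_mean J B (\<lambda>y. F y + G y) (v + w)"

lemma gauss_mean_zero: "gauss_mean J B (\<lambda>y. 0) 0"
  using gauss_mean_exp[of J B 0 "\<lambda>_. 0"] by simp

lemma gauss_mean_const: "gauss_mean J B (\<lambda>y. a) a"
  using gauss_mean_exp[of J B a "\<lambda>_. 0"] by (simp add: qf_def)

lemma gauss_mean_scale: "gauss_mean J B F v \<Longrightarrow> gauss_mean J B (\<lambda>y. c * F y) (c * v)"
proof (induction rule: gauss_mean.induct)
  case (gauss_mean_exp a t)
  then show ?case using gauss_mean.gauss_mean_exp[of J B "c * a" t] by (simp add: mult.assoc)
next
  case (gauss_mean_add F v G w)
  from gauss_mean.gauss_mean_add[OF gauss_mean_add.IH] show ?case by (simp add: distrib_left)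
qed

lemma gauss_mean_diff: "gauss_mean J B F v \<Longrightarrow> gauss_mean J B G w \<Longrightarrow> gauss_mean J B (\<lambda>y. F y - G y) (v - w)"
  using gauss_mean_add[OF _ gauss_mean_scale[of J B G w "-1"], of F v] by simp

lemma gauss_mean_sum:
  assumes "\<And>i. i \<in> I \<Longrightarrow> gauss_mean J B (F i) (v i)"
  shows "gauss_mean J B (\<lambda>y. \<Sum>i\<in>I. F i y) (\<Sum>i\<in>I. v i)"
proof (cases "finite I")
  case True
  then show ?thesis using assms by (induction I rule: finite_induct) (auto intro: gauss_mean_zero gauss_mean_add)
qed (simp add: gauss_mean_zero)

text \<open>A derivation of \<open>gauss_mean\<close> flattens to one finite exponential sum, to
  which \<open>gauss_functional_nonneg\<close> applies. Nothing in the relation itself says that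
  \<open>v\<close> is determined by \<open>F\<close>; values become comparable only through this
  positivity.\<close>

lemma gauss_mean_nonneg:
  assumes "gauss_mean J B F v" "\<And>y. 0 \<le> Re (F y)" "finite J" "\<And>i j. B i j = B j i" "\<And>t. 0 \<le> qf J B t"
  shows "0 \<le> Re v"
proof -
  have "\<exists>(n::nat) a \<tau>. (\<forall>y. F y = (\<Sum>i<n. a i * cis (\<Sum>j\<in>J. \<tau> i j * y j))) \<and>
      v = (\<Sum>i<n. a i * of_real (exp (- qf J B (\<tau> i) / 2)))"
    using assms(1)
  proof (induction rule: gauss_mean.induct)
    case (gauss_mean_exp a t)
    show ?case by (rule exI[of _ 1], rule exI[of _ "\<lambda>_. a"], rule exI[of _ "\<lambda>_. t"]) simp
  next
    case (gauss_mean_add F v G w)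
    then obtain n a \<tau> n' a' \<tau>' where
      1: "\<And>y. F y = (\<Sum>i<n::nat. a i * cis (\<Sum>j\<in>J. \<tau> i j * y j))"
         "v = (\<Sum>i<n. a i * of_real (exp (- qf J B (\<tau> i) / 2)))" and
      2: "\<And>y. G y = (\<Sum>i<n'::nat. a' i * cis (\<Sum>j\<in>J. \<tau>' i j * y j))"
         "w = (\<Sum>i<n'. a' i * of_real (exp (- qf J B (\<tau>' i) / 2)))" by blast
    define a'' where "a'' = (\<lambda>i. if i < n then a i else a' (i - n))"
    define \<tau>'' where "\<tau>'' = (\<lambda>i. if i < n then \<tau> i else \<tau>' (i - n))"
    have split: "(\<Sum>i<n+n'. H i) = (\<Sum>i<n. H i) + (\<Sum>i<n'. H (n + i))" for H :: "nat \<Rightarrow> complex"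
      by (induction n') (simp_all add: add.assoc)
    show ?case
      by (rule exI[of _ "n + n'"], rule exI[of _ a''], rule exI[of _ \<tau>''])
         (simp add: 1 2 split, simp add: a''_def \<tau>''_def)
  qed
  then obtain n :: nat and a \<tau> where r: "\<And>y. F y = (\<Sum>i<n. a i * cis (\<Sum>j\<in>J. \<tau> i j * y j))"
      "v = (\<Sum>i<n. a i * of_real (exp (- qf J B (\<tau> i) / 2)))" by blast
  show ?thesis unfolding r(2)
    by (rule gauss_functional_nonneg[OF _ assms(3-5)]) (use assms(2) r(1) in simp)
qed

lemma gauss_mean_mono:
  assumes "gauss_mean J B F v" "gauss_mean J B G w" "\<And>y. Re (F y) \<le> Re (G y)" "finite J" "\<And>i j. B i j = B j i" "\<And>t. 0 \<le> qf J B t"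
  shows "Re v \<le> Re w"
  using gauss_mean_nonneg[OF gauss_mean_diff[OF assms(2,1)] _ assms(4-6)] assms(3) by simp

section \<open>Sherali--Adams solutions from a covariance kernel\<close>

text \<open>Consistency in Fourier form. \<open>T\<close> assigns a frequency to each vertex,
  \<phi>0 being the trivial one. Summing over the price of a vertex kills every frequency but
  \<phi>0, and weights with trivial frequencies outside \<open>S\<close> are those of
  \<open>S\<close>. Hence marginals agree automatically, and only nonnegativity has to be
  supplied.\<close>

lemma sa_feasible_of_weights:
  fixes C :: "'v \<Rightarrow> real \<Rightarrow> 'f \<Rightarrow> complex" and W :: "'v set \<Rightarrow> ('v \<Rightarrow> 'f) \<Rightarrow> complex"
  assumes V: "finite (verts I)" and Q: "finite Q" and Phi: "finite \<Phi>" "\<phi>0 \<in> \<Phi>"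
    and C: "\<And>u \<phi>. u \<in> verts I \<Longrightarrow> \<phi> \<in> \<Phi> \<Longrightarrow> (\<Sum>q\<in>Q. C u q \<phi>) = of_bool (\<phi> = \<phi>0)"
    and W0: "\<And>T. W {} T = 1"
    and W: "\<And>S S' T T'. S \<subseteq> S' \<Longrightarrow> S' \<subseteq> verts I \<Longrightarrow> (\<And>u. u \<in> S \<Longrightarrow> T' u = T u) \<Longrightarrow>
        (\<And>u. u \<in> S' - S \<Longrightarrow> T' u = \<phi>0) \<Longrightarrow> W S' T' = W S T"
    and x: "\<And>S \<alpha>. x S \<alpha> = Re (\<Sum>T\<in>S \<rightarrow>\<^sub>E \<Phi>. (\<Prod>u\<in>S. C u (\<alpha> u) (T u)) * W S T)"
    and nn: "\<And>S \<alpha>. S \<subseteq> verts I \<Longrightarrow> card S \<le> r \<Longrightarrow> \<alpha> \<in> S \<rightarrow>\<^sub>E Q \<Longrightarrow> 0 \<le> x S \<alpha>"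
  shows "sa_feasible I Q r x"
proof -
  have marg: "(\<Sum>\<alpha>\<in>(S' - S) \<rightarrow>\<^sub>E Q. x S' (override_on \<beta> \<alpha> (S' - S))) = x S \<beta>"
    if S: "S \<subseteq> S'" "S' \<subseteq> verts I" for S S' and \<beta> :: "'v \<Rightarrow> real"
  proof -
    have fin: "finite S'" "finite S" "finite (S' - S)"
      using S V by (auto intro: finite_subset)
    have pb: "(\<Prod>u\<in>A. of_bool (P u)) = (of_bool (\<forall>u\<in>A. P u) :: complex)" if "finite A" for A :: "'v set" and P
      using that by (induction A rule: finite_induct) auto
    let ?P = "\<lambda>T. \<Prod>u\<in>S. C u (\<beta> u) (T u)"
    let ?D = "{T \<in> S' \<rightarrow>\<^sub>E \<Phi>. \<forall>u\<in>S' - S. T u = \<phi>0}"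
    have split: "(\<Prod>u\<in>S'. C u (override_on \<beta> \<alpha> (S' - S) u) (T u)) =
        ?P T * (\<Prod>u\<in>S' - S. C u (\<alpha> u) (T u))" for \<alpha> and T
    proof -
      have "(\<Prod>u\<in>S'. C u (override_on \<beta> \<alpha> (S' - S) u) (T u)) =
          (\<Prod>u\<in>S' - S. C u (override_on \<beta> \<alpha> (S' - S) u) (T u)) *
          (\<Prod>u\<in>S. C u (override_on \<beta> \<alpha> (S' - S) u) (T u))"
        by (rule prod.subset_diff[OF S(1) fin(1)])
      then show ?thesis by (simp add: mult.commute override_on_def)
    qed
    \<comment> \<open>Here the prices of the vertices in \<open>S' - S\<close> are summed out: the
      sum of products is a product of sums, and each factor is an indicator of the trivial
      frequency.\<close>
    have one: "(\<Sum>\<alpha>\<in>(S' - S) \<rightarrow>\<^sub>E Q. \<Prod>u\<in>S' - S. C u (\<alpha> u) (T u)) = of_bool (\<forall>u\<in>S' - S. T u = \<phi>0)"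
      if T: "T \<in> S' \<rightarrow>\<^sub>E \<Phi>" for T
    proof -
      have "(\<Sum>\<alpha>\<in>(S' - S) \<rightarrow>\<^sub>E Q. \<Prod>u\<in>S' - S. C u (\<alpha> u) (T u)) = (\<Prod>u\<in>S' - S. \<Sum>q\<in>Q. C u q (T u))"
        using fin Q by (subst prod_sum_PiE) auto
      also have "\<dots> = (\<Prod>u\<in>S' - S. of_bool (T u = \<phi>0))"
        by (intro prod.cong refl C) (use T S in auto)
      also have "\<dots> = of_bool (\<forall>u\<in>S' - S. T u = \<phi>0)"
        by (rule pb[OF fin(3)])
      finally show ?thesis .
    qed
    have "(\<Sum>\<alpha>\<in>(S' - S) \<rightarrow>\<^sub>E Q. x S' (override_on \<beta> \<alpha> (S' - S))) =
        Re (\<Sum>\<alpha>\<in>(S' - S) \<rightarrow>\<^sub>E Q. \<Sum>T\<in>S' \<rightarrow>\<^sub>E \<Phi>. ?P T * W S' T * (\<Prod>u\<in>S' - S. C u (\<alpha> u) (T u)))"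
      unfolding x split by (simp add: mult_ac)
    also have "(\<Sum>\<alpha>\<in>(S' - S) \<rightarrow>\<^sub>E Q. \<Sum>T\<in>S' \<rightarrow>\<^sub>E \<Phi>. ?P T * W S' T * (\<Prod>u\<in>S' - S. C u (\<alpha> u) (T u))) =
        (\<Sum>T\<in>S' \<rightarrow>\<^sub>E \<Phi>. ?P T * W S' T * of_bool (\<forall>u\<in>S' - S. T u = \<phi>0))"
      by (subst sum.swap) (simp add: sum_distrib_left[symmetric] one)
    also have "\<dots> = (\<Sum>T\<in>?D. ?P T * W S' T)"
      using finite_PiE[OF fin(1), of "\<lambda>_. \<Phi>"] Phi by (simp add: sum.If_cases of_bool_def if_distrib Int_def cong: if_cong)
    also have "\<dots> = (\<Sum>T\<in>S \<rightarrow>\<^sub>E \<Phi>. ?P T * W S T)"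
    proof (rule sum.reindex_bij_witness[where i = "\<lambda>T u. if u \<in> S then T u else if u \<in> S' then \<phi>0 else undefined"
          and j = "\<lambda>T. restrict T S"])
      fix T assume T: "T \<in> ?D"
      show "(\<lambda>u. if u \<in> S then restrict T S u else if u \<in> S' then \<phi>0 else undefined) = T"
        using T S(1) by (auto simp: fun_eq_iff PiE_def extensional_def)
      show "restrict T S \<in> S \<rightarrow>\<^sub>E \<Phi>" using T S(1) by auto
      have "W S' T = W S (restrict T S)" using T by (intro W S) auto
      then show "?P (restrict T S) * W S (restrict T S) = ?P T * W S' T" by simp
    next
      fix T assume T: "T \<in> S \<rightarrow>\<^sub>E \<Phi>"
      show "restrict (\<lambda>u. if u \<in> S then T u else if u \<in> S' then \<phi>0 else undefined) S = T"
        using T by (auto simp: fun_eq_iff PiE_def extensional_def)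
      show "(\<lambda>u. if u \<in> S then T u else if u \<in> S' then \<phi>0 else undefined) \<in> ?D"
        using T S(1) Phi(2) by (auto simp: PiE_def extensional_def Pi_def)
    qed
    finally show ?thesis unfolding x .
  qed
  \<comment> \<open>Normalisation is consistency with the empty set, whose single variable is
    \<open>W {} T = 1\<close>.\<close>
  have "(\<Sum>\<alpha>\<in>S \<rightarrow>\<^sub>E Q. x S \<alpha>) = 1" if S: "S \<subseteq> verts I" for S
  proof -
    have "(\<Sum>\<alpha>\<in>S \<rightarrow>\<^sub>E Q. x S \<alpha>) = (\<Sum>\<alpha>\<in>(S - {}) \<rightarrow>\<^sub>E Q. x S (override_on (\<lambda>_. undefined) \<alpha> (S - {})))"
    proof (rule sum.cong)
      fix \<alpha> assume "\<alpha> \<in> (S - {}) \<rightarrow>\<^sub>E Q"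
      then have "override_on (\<lambda>_. undefined) \<alpha> (S - {}) = \<alpha>"
        by (auto simp: override_on_def fun_eq_iff PiE_def extensional_def)
      then show "x S \<alpha> = x S (override_on (\<lambda>_. undefined) \<alpha> (S - {}))" by simp
    qed simp
    also have "\<dots> = x {} (\<lambda>_. undefined)" by (rule marg) (use S in auto)
    also have "\<dots> = 1" by (simp add: x W0)
    finally show ?thesis .
  qed
  then show ?thesis unfolding sa_feasible_def using nn marg by blast
qed

lemma qf_neutral:
  assumes "finite J'" "J \<subseteq> J'" "\<And>j. j \<in> J' - J \<Longrightarrow> t j = 0"
  shows "qf J' B t = qf J B t"
proof -
  have "qf J' B t = (\<Sum>i\<in>J'. \<Sum>j\<in>J. t i * t j * B i j)"
    unfolding qf_def using assms by (intro sum.cong refl sum.mono_neutral_right) auto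
  also have "\<dots> = qf J B t"
    unfolding qf_def using assms by (intro sum.mono_neutral_right) auto
  finally show ?thesis .
qed

section \<open>Random labels whose bits are rounded Gaussian variables\<close>

lemma sum_bits_prod:
  fixes f :: "nat \<Rightarrow> bool \<Rightarrow> 'a::comm_ring_1"
  shows "(\<Sum>a<2^k. \<Prod>t<k. f t (bit (a::nat) t)) = (\<Prod>t<k. f t False + f t True)"
proof (induction k arbitrary: f)
  case (Suc k)
  have split: "(\<Sum>a<2*n. g a) = (\<Sum>a<n. g (2*a) + g (2*a+1))" for n and g :: "nat \<Rightarrow> 'a"
    by (induction n) (simp_all add: algebra_simps)
  have b: "bit (2*a) (Suc t) = bit a t" "bit (Suc (2*a)) (Suc t) = bit a t" for a t :: nat
    by (simp_all add: bit_Suc)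
  have "(\<Sum>a<2^Suc k. \<Prod>t<Suc k. f t (bit (a::nat) t)) =
      (\<Sum>a<2^k. (f 0 False + f 0 True) * (\<Prod>t<k. f (Suc t) (bit (a::nat) t)))"
    by (simp add: split prod.lessThan_Suc_shift b bit_0 distrib_right del: prod.lessThan_Suc)
  also have "\<dots> = (f 0 False + f 0 True) * (\<Prod>t<k. f (Suc t) False + f (Suc t) True)"
    by (simp add: sum_distrib_left[symmetric] Suc.IH[of "\<lambda>t. f (Suc t)"])
  finally show ?case by (simp add: prod.lessThan_Suc_shift del: prod.lessThan_Suc)
qed simp

definition bit_sign :: "bool \<Rightarrow> 'a::ring_1" where "bit_sign b = (if b then -1 else 1)"

text \<open>A vertex carries \<open>k\<close> real variables. The \<open>t\<close>-th bit of its label is set with probability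
  \<open>(1 - h y) / 2\<close>, where \<open>y\<close> is the \<open>t\<close>-th variable; index \<open>0\<close> stands for the constant term.\<close>

locale rounding =
  fixes k N :: nat and c :: "nat \<Rightarrow> complex" and \<nu> :: "nat \<Rightarrow> real" and h :: "real \<Rightarrow> real"
  assumes h_eq: "of_real (h y) = (\<Sum>i=1..N. c i * cis (\<nu> i * y))"
    and \<nu>0: "\<nu> 0 = 0" and h_le: "\<bar>h y\<bar> \<le> 1" and h_odd: "h (- y) = - h y"
begin

definition bit_coeff :: "bool \<Rightarrow> nat \<Rightarrow> complex" where
  "bit_coeff b i = (if i = 0 then 1 / 2 else bit_sign b * c i / 2)"

definition Phi :: "(nat \<Rightarrow> nat) set" where "Phi = {..<k} \<rightarrow>\<^sub>E {..N}"

definition phi0 :: "nat \<Rightarrow> nat" where "phi0 = (\<lambda>t\<in>{..<k}. 0)"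

definition label_coeff :: "nat \<Rightarrow> (nat \<Rightarrow> nat) \<Rightarrow> complex" where
  "label_coeff a \<phi> = (\<Prod>t<k. bit_coeff (bit a t) (\<phi> t))"

definition label_prob :: "nat \<Rightarrow> (nat \<Rightarrow> real) \<Rightarrow> real" where
  "label_prob a y = (\<Prod>t<k. (1 + bit_sign (bit a t) * h (y t)) / 2)"

lemma finite_Phi: "finite Phi" unfolding Phi_def by (intro finite_PiE) auto

lemma phi0_in: "phi0 \<in> Phi" unfolding Phi_def phi0_def by auto

lemma sum_bit_coeff: "(\<Sum>i\<le>N. bit_coeff b i * cis (\<nu> i * y)) = of_real ((1 + bit_sign b * h y) / 2)"
proof -
  have "(\<Sum>i\<le>N. bit_coeff b i * cis (\<nu> i * y)) = 1/2 + (\<Sum>i=1..N. bit_sign b / 2 * (c i * cis (\<nu> i * y)))"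
    by (simp add: atMost_atLeast0 sum.atLeast_Suc_atMost bit_coeff_def \<nu>0 mult.assoc)
  also have "\<dots> = 1/2 + bit_sign b / 2 * of_real (h y)"
    by (simp add: sum_distrib_left h_eq)
  also have "\<dots> = of_real ((1 + bit_sign b * h y) / 2)" by (simp add: bit_sign_def add_divide_distrib)
  finally show ?thesis .
qed

lemma sum_label_coeff_cis: "(\<Sum>\<phi>\<in>Phi. label_coeff a \<phi> * cis (\<Sum>t<k. \<nu> (\<phi> t) * y t)) = of_real (label_prob a y)"
proof -
  have cisum: "cis (\<Sum>t<k. g t) = (\<Prod>t<k. cis (g t))" for g
    by (induction k) (simp_all add: cis_mult[symmetric])
  have "of_real (label_prob a y) = (\<Prod>t<k. \<Sum>i\<le>N. bit_coeff (bit a t) i * cis (\<nu> i * y t))"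
    unfolding label_prob_def sum_bit_coeff by simp
  also have "\<dots> = (\<Sum>\<phi>\<in>Phi. \<Prod>t<k. bit_coeff (bit a t) (\<phi> t) * cis (\<nu> (\<phi> t) * y t))"
    unfolding Phi_def by (subst prod_sum_PiE) auto
  finally show ?thesis by (simp add: label_coeff_def cisum prod.distrib)
qed

text \<open>The two values of a bit have probabilities adding up to 1, so their coefficients cancel
  at every nontrivial frequency and add up to 1 at the trivial one.\<close>

lemma sum_label_coeff: "\<phi> \<in> Phi \<Longrightarrow> (\<Sum>a<2^k. label_coeff a \<phi>) = of_bool (\<phi> = phi0)"
proof -
  assume "\<phi> \<in> Phi"
  then have eq: "\<phi> = phi0 \<longleftrightarrow> (\<forall>t<k. \<phi> t = 0)"
    unfolding Phi_def phi0_def by (auto simp: fun_eq_iff PiE_def extensional_def)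
  have "(\<Sum>a<2^k. label_coeff a \<phi>) = (\<Prod>t<k. bit_coeff False (\<phi> t) + bit_coeff True (\<phi> t))"
    unfolding label_coeff_def using sum_bits_prod[where k = k and f = "\<lambda>t b. bit_coeff b (\<phi> t)"] .
  also have "\<dots> = (\<Prod>t<k. of_bool (\<phi> t = 0))"
    by (intro prod.cong) (auto simp: bit_coeff_def bit_sign_def)
  also have "\<dots> = of_bool (\<forall>t<k. \<phi> t = 0)"
    by (induction k) (auto simp: less_Suc_eq)
  finally show ?thesis by (simp add: eq)
qed

lemma label_prob_nonneg: "0 \<le> label_prob a y"
proof -
  have "0 \<le> 1 + bit_sign b * h (y t)" for b t using h_le[of "y t"] by (auto simp: bit_sign_def abs_le_iff)
  then show ?thesis unfolding label_prob_def by (intro prod_nonneg) auto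
qed

definition price_coeff :: "('v \<Rightarrow> nat \<Rightarrow> real) \<Rightarrow> 'v \<Rightarrow> real \<Rightarrow> (nat \<Rightarrow> nat) \<Rightarrow> complex" where
  "price_coeff price u q \<phi> = (\<Sum>a | a < 2^k \<and> price u a = q. label_coeff a \<phi>)"

definition price_prob :: "('v \<Rightarrow> nat \<Rightarrow> real) \<Rightarrow> 'v \<Rightarrow> real \<Rightarrow> (nat \<Rightarrow> real) \<Rightarrow> real" where
  "price_prob price u q y = (\<Sum>a | a < 2^k \<and> price u a = q. label_prob a y)"

definition freq :: "('v \<Rightarrow> nat \<Rightarrow> nat) \<Rightarrow> 'v \<times> nat \<Rightarrow> real" where
  "freq T = (\<lambda>(u, t). \<nu> (T u t))"

text \<open>The Gaussian expectation of the probability that each \<open>u\<close> in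
  \<open>S\<close> receives price \<open>\<alpha> u\<close>, the vertices being rounded
  independently given the field; \<open>gauss_mean_sol\<close> states this. It is written out in
  frequencies to fit \<open>sa_feasible_of_weights\<close>.\<close>

definition sa_sol :: "('v \<Rightarrow> nat \<Rightarrow> real) \<Rightarrow> ('v \<times> nat \<Rightarrow> 'v \<times> nat \<Rightarrow> real) \<Rightarrow> 'v set \<Rightarrow> ('v \<Rightarrow> real) \<Rightarrow> complex" where
  "sa_sol price B S \<alpha> = (\<Sum>T\<in>S \<rightarrow>\<^sub>E Phi. (\<Prod>u\<in>S. price_coeff price u (\<alpha> u) (T u)) *
     of_real (exp (- qf (S \<times> {..<k}) B (freq T) / 2)))"

lemma sum_price_coeff_cis: "(\<Sum>\<phi>\<in>Phi. price_coeff price u q \<phi> * cis (\<Sum>t<k. \<nu> (\<phi> t) * y t)) = of_real (price_prob price u q y)"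
  unfolding price_coeff_def price_prob_def of_real_sum sum_label_coeff_cis[symmetric] sum_distrib_right by (rule sum.swap)

lemma gauss_mean_sol:
  fixes S :: "'v set"
  assumes "finite S"
  shows "gauss_mean (S \<times> {..<k}) B (\<lambda>y. of_real (\<Prod>u\<in>S. price_prob price u (\<alpha> u) (\<lambda>t. y (u, t)))) (sa_sol price B S \<alpha>)"
proof -
  have cisum: "cis (\<Sum>u\<in>S. g u) = (\<Prod>u\<in>S. cis (g u))" for g :: "'v \<Rightarrow> real"
    using assms by (induction S rule: finite_induct) (simp_all add: cis_mult[symmetric])
  have "(\<lambda>y. of_real (\<Prod>u\<in>S. price_prob price u (\<alpha> u) (\<lambda>t. y (u, t))) :: complex) =
      (\<lambda>y. \<Sum>T\<in>S \<rightarrow>\<^sub>E Phi. (\<Prod>u\<in>S. price_coeff price u (\<alpha> u) (T u)) * cis (\<Sum>j\<in>S \<times> {..<k}. freq T j * y j))"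
  proof
    fix y :: "'v \<times> nat \<Rightarrow> real"
    have "of_real (\<Prod>u\<in>S. price_prob price u (\<alpha> u) (\<lambda>t. y (u, t))) =
        (\<Prod>u\<in>S. \<Sum>\<phi>\<in>Phi. price_coeff price u (\<alpha> u) \<phi> * cis (\<Sum>t<k. \<nu> (\<phi> t) * y (u, t)))"
      by (simp add: sum_price_coeff_cis)
    also have "\<dots> = (\<Sum>T\<in>S \<rightarrow>\<^sub>E Phi. \<Prod>u\<in>S. price_coeff price u (\<alpha> u) (T u) * cis (\<Sum>t<k. \<nu> (T u t) * y (u, t)))"
      using assms finite_Phi by (subst prod_sum_PiE) auto
    also have "\<dots> = (\<Sum>T\<in>S \<rightarrow>\<^sub>E Phi. (\<Prod>u\<in>S. price_coeff price u (\<alpha> u) (T u)) * cis (\<Sum>j\<in>S \<times> {..<k}. freq T j * y j))"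
      by (simp add: prod.distrib cisum[symmetric] sum.cartesian_product freq_def case_prod_unfold)
    finally show "of_real (\<Prod>u\<in>S. price_prob price u (\<alpha> u) (\<lambda>t. y (u, t))) = \<dots>" .
  qed
  then show ?thesis unfolding sa_sol_def by (simp only:) (intro gauss_mean_sum gauss_mean_exp)
qed

lemma price_prob_nonneg: "0 \<le> price_prob price u q y"
  unfolding price_prob_def by (intro sum_nonneg label_prob_nonneg)

lemma label_prob_le_price_prob: "a < 2^k \<Longrightarrow> label_prob a y \<le> price_prob price u (price u a) y"
  unfolding price_prob_def by (rule member_le_sum) (auto simp: label_prob_nonneg)

lemma sa_sol_nonneg:
  assumes "finite S" "\<And>i j. B i j = B j i" "\<And>t. 0 \<le> qf (S \<times> {..<k}) B t"
  shows "0 \<le> Re (sa_sol price B S \<alpha>)"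
  by (rule gauss_mean_nonneg[OF gauss_mean_sol]) (use assms in \<open>auto simp del: of_real_prod intro!: prod_nonneg price_prob_nonneg\<close>)

text \<open>The weights are values of the characteristic function. The trivial frequency has \<nu> =
  0 and contributes nothing to \<open>qf\<close>, so the weight of \<open>S'\<close> reduces to that
  of \<open>S\<close>; positivity of the kernel is used only for nonnegativity, hence only on sets
  of size at most \<open>r\<close>.\<close>

lemma sa_sol_feasible:
  assumes V: "finite (verts I)" and Q: "finite Q"
    and price: "\<And>u a. u \<in> verts I \<Longrightarrow> a < 2^k \<Longrightarrow> price u a \<in> Q"
    and sym: "\<And>i j. B i j = B j i"
    and psd: "\<And>S t. S \<subseteq> verts I \<Longrightarrow> card S \<le> r \<Longrightarrow> 0 \<le> qf (S \<times> {..<k}) B t"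
  shows "sa_feasible I Q r (\<lambda>S \<alpha>. Re (sa_sol price B S \<alpha>))"
proof (rule sa_feasible_of_weights[OF V Q finite_Phi phi0_in])
  fix u \<phi> assume u: "u \<in> verts I" and \<phi>: "\<phi> \<in> Phi"
  have "(\<Sum>q\<in>Q. price_coeff price u q \<phi>) = (\<Sum>a<2^k. label_coeff a \<phi>)"
    unfolding price_coeff_def using sum.group[of "{..<2^k}" Q "price u" "\<lambda>a. label_coeff a \<phi>"] Q price[OF u] by (simp add: image_subset_iff)
  then show "(\<Sum>q\<in>Q. price_coeff price u q \<phi>) = of_bool (\<phi> = phi0)" using sum_label_coeff[OF \<phi>] by simp
next
  fix S S' and T T' :: "'a \<Rightarrow> nat \<Rightarrow> nat"
  assume S: "S \<subseteq> S'" "S' \<subseteq> verts I" and T: "\<And>u. u \<in> S \<Longrightarrow> T' u = T u"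
    and T0: "\<And>u. u \<in> S' - S \<Longrightarrow> T' u = phi0"
  have "finite S'" using S V finite_subset by blast
  then have "qf (S' \<times> {..<k}) B (freq T') = qf (S \<times> {..<k}) B (freq T')"
    using S by (intro qf_neutral) (auto simp: freq_def \<nu>0 phi0_def dest!: T0[OF DiffI])
  also have "\<dots> = qf (S \<times> {..<k}) B (freq T)"
    by (intro qf_cong) (auto simp: freq_def T)
  finally show "complex_of_real (exp (- qf (S' \<times> {..<k}) B (freq T') / 2)) =
      of_real (exp (- qf (S \<times> {..<k}) B (freq T) / 2))" by simp
next
  fix S \<alpha> assume "S \<subseteq> verts I" "card S \<le> r"
  then show "0 \<le> Re (sa_sol price B S \<alpha>)"
    using V psd sym by (intro sa_sol_nonneg) (auto intro: finite_subset)
qed (auto simp: sa_sol_def qf_def)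

end

section \<open>Rounding by an approximate square wave\<close>

definition trig_poly :: "(real \<Rightarrow> real) \<Rightarrow> bool" where
  "trig_poly f \<longleftrightarrow> (\<exists>xs. \<forall>y. complex_of_real (f y) = (\<Sum>(a, w)\<leftarrow>xs. a * cis (w * y)))"

lemma trig_poly_sin: "trig_poly sin"
  unfolding trig_poly_def
  by (rule exI[of _ "[(1 / (2 * \<i>), 1), (- 1 / (2 * \<i>), -1)]"]) (auto simp: complex_eq_iff Complex_divide Re_divide Im_divide power2_eq_square)

lemma trig_poly_add:
  assumes "trig_poly f" "trig_poly g" shows "trig_poly (\<lambda>y. f y + g y)"
proof -
  obtain xs ys where "\<forall>y. complex_of_real (f y) = (\<Sum>(a, w)\<leftarrow>xs. a * cis (w * y))"
    "\<forall>y. complex_of_real (g y) = (\<Sum>(a, w)\<leftarrow>ys. a * cis (w * y))"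
    using assms unfolding trig_poly_def by blast
  then show ?thesis unfolding trig_poly_def by (intro exI[of _ "xs @ ys"]) simp
qed

lemma trig_poly_mult:
  assumes "trig_poly f" "trig_poly g" shows "trig_poly (\<lambda>y. f y * g y)"
proof -
  obtain xs ys where xy: "\<forall>y. complex_of_real (f y) = (\<Sum>(a, w)\<leftarrow>xs. a * cis (w * y))"
    "\<forall>y. complex_of_real (g y) = (\<Sum>(a, w)\<leftarrow>ys. a * cis (w * y))"
    using assms unfolding trig_poly_def by blast
  define zs where "zs = concat (map (\<lambda>(a, w). map (\<lambda>(b, v). (a * b, w + v)) ys) xs)"
  have "(\<Sum>(a, w)\<leftarrow>map (\<lambda>(b, v). (a * b, w + v)) ys. a * cis (w * y)) =
      a * cis (w * y) * (\<Sum>(a, w)\<leftarrow>ys. a * cis (w * y))" for a w y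
    by (induction ys) (auto simp: algebra_simps cis_mult[symmetric])
  then have "(\<Sum>(a, w)\<leftarrow>zs. a * cis (w * y)) =
      (\<Sum>(a, w)\<leftarrow>xs. a * cis (w * y)) * (\<Sum>(a, w)\<leftarrow>ys. a * cis (w * y))" for y
    unfolding zs_def by (induction xs) (auto simp: distrib_right)
  then show ?thesis unfolding trig_poly_def using xy by (intro exI[of _ zs]) simp
qed

lemma trig_poly_const: "trig_poly (\<lambda>y. r)"
  unfolding trig_poly_def by (rule exI[of _ "[(of_real r, 0)]"]) simp

lemma trig_poly_sum:
  assumes "trig_poly f"
  shows "\<exists>(N::nat) c \<nu>. \<nu> 0 = 0 \<and> (\<forall>y. complex_of_real (f y) = (\<Sum>i=1..N. c i * cis (\<nu> i * y)))"
proof -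
  obtain xs where xs: "\<forall>y. complex_of_real (f y) = (\<Sum>(a, w)\<leftarrow>xs. a * cis (w * y))"
    using assms unfolding trig_poly_def by blast
  let ?c = "\<lambda>i. fst (xs ! (i - 1))" and ?v = "\<lambda>i. if i = 0 then 0 else snd (xs ! (i - 1))"
  have "(\<Sum>(a, w)\<leftarrow>xs. a * cis (w * y)) = (\<Sum>i=1..length xs. ?c i * cis (?v i * y))" for y
  proof -
    have "(\<Sum>(a, w)\<leftarrow>xs. a * cis (w * y)) = (\<Sum>i<length xs. fst (xs ! i) * cis (snd (xs ! i) * y))"
      by (simp add: sum_list_sum_nth case_prod_unfold atLeast0LessThan)
    also have "\<dots> = (\<Sum>i=1..length xs. ?c i * cis (?v i * y))"
      by (rule sum.reindex_bij_witness[of _ "\<lambda>i. i - 1" Suc]) auto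
    finally show ?thesis .
  qed
  then show ?thesis using xs by (intro exI[of _ "length xs"] exI[of _ ?c] exI[of _ ?v]) simp
qed

text \<open>The iterates of the majority polynomial \<open>(3x - x\<^sup>3) / 2\<close>, started at the sine, approximate a square wave.\<close>

definition maj3 :: "real \<Rightarrow> real" where "maj3 x = (3 * x - x ^ 3) / 2"

definition swave :: "nat \<Rightarrow> real \<Rightarrow> real" where "swave n y = (maj3 ^^ n) (sin y)"

text \<open>The source of quadratic convergence to the values 1 and -1: on [-1, 1] the last factor
  divided by 4 is at most 1, so one iteration at least squares the defect
  \<open>1 - x\<^sup>2\<close>.\<close>

lemma one_minus_maj3: "1 - (maj3 x)\<^sup>2 = (1 - x\<^sup>2)\<^sup>2 * (4 - x\<^sup>2) / 4"
  unfolding maj3_def by (simp add: power2_eq_square power3_eq_cube field_simps)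

lemma swave_Suc: "swave (Suc n) y = maj3 (swave n y)" unfolding swave_def by simp

text \<open>The defect starts at the squared cosine and is squared by each iteration. It is bounded
  by a power of the cosine because such a power is itself a trigonometric polynomial with a
  computable Gaussian mean.\<close>

lemma swave_props: "\<bar>swave n y\<bar> \<le> 1 \<and> swave n (- y) = - swave n y \<and> 1 - (swave n y)\<^sup>2 \<le> cos y ^ (2 * 2 ^ n)"
proof (induction n)
  case 0
  show ?case by (simp add: swave_def cos_squared_eq)
next
  case (Suc n)
  let ?x = "swave n y"
  have x1: "?x\<^sup>2 \<le> 1" using Suc by (simp add: abs_square_le_1)
  have a: "0 \<le> 1 - (maj3 ?x)\<^sup>2" unfolding one_minus_maj3 using x1 by (intro divide_nonneg_pos mult_nonneg_nonneg) auto
  have "1 - (maj3 ?x)\<^sup>2 \<le> (1 - ?x\<^sup>2)\<^sup>2 * 4 / 4"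
    unfolding one_minus_maj3 by (intro divide_right_mono mult_left_mono) auto
  also have "\<dots> \<le> (cos y ^ (2 * 2 ^ n))\<^sup>2"
    using Suc x1 by (simp add: power_mono)
  also have "\<dots> = cos y ^ (2 * 2 ^ Suc n)" by (simp add: power_mult[symmetric] mult_ac)
  finally show ?case using a Suc by (simp add: swave_Suc abs_square_le_1[symmetric]) (simp add: maj3_def field_simps)
qed

text \<open>On [-1, 1] the derivative of \<open>maj3\<close> lies between 0 and 3/2; here the
  difference quotient is bounded algebraically.\<close>

lemma swave_lipschitz: "\<bar>swave n a - swave n b\<bar> \<le> (3/2) ^ n * \<bar>sin a - sin b\<bar>"
proof (induction n)
  case (Suc n)
  let ?x = "swave n a" and ?y = "swave n b"
  have xy: "?x\<^sup>2 \<le> 1" "?y\<^sup>2 \<le> 1" using swave_props by (simp_all add: abs_square_le_1)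
  have "maj3 ?x - maj3 ?y = (?x - ?y) * ((3 - (?x\<^sup>2 + ?x * ?y + ?y\<^sup>2)) / 2)"
    unfolding maj3_def by (simp add: power2_eq_square power3_eq_cube field_simps)
  then have "\<bar>maj3 ?x - maj3 ?y\<bar> = \<bar>?x - ?y\<bar> * \<bar>(3 - (?x\<^sup>2 + ?x * ?y + ?y\<^sup>2)) / 2\<bar>"
    by (simp only: abs_mult)
  also have "\<bar>(3 - (?x\<^sup>2 + ?x * ?y + ?y\<^sup>2)) / 2\<bar> \<le> 3/2"
  proof -
    have "0 \<le> (?x + ?y)\<^sup>2" "0 \<le> (?x - ?y)\<^sup>2" by auto
    then have "0 \<le> ?x\<^sup>2 + ?y\<^sup>2 + 2 * (?x * ?y)" "0 \<le> ?x\<^sup>2 + ?y\<^sup>2 - 2 * (?x * ?y)"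
      unfolding power2_sum power2_diff by (simp_all add: algebra_simps)
    then show ?thesis using xy by (simp add: abs_le_iff)
  qed
  finally have "\<bar>maj3 ?x - maj3 ?y\<bar> \<le> \<bar>?x - ?y\<bar> * (3/2)" by (simp add: mult_left_mono)
  also have "\<dots> \<le> (3/2) ^ n * \<bar>sin a - sin b\<bar> * (3/2)" using Suc by (intro mult_right_mono) auto
  finally show ?case unfolding swave_Suc by simp
qed (simp add: swave_def)

text \<open>The disagreement of two rounded variables is bounded pointwise by a trigonometric
  polynomial. It has two causes: \<open>a\<close> lies near a zero of the wave (the cosine power),
  or \<open>a\<close> and \<open>s * b\<close> are far apart (the last term).\<close>

lemma swave_pair:
  assumes s: "s = 1 \<or> s = -1" and \<eta>: "0 < \<eta>"
  shows "1 - s * swave n a * swave n b \<le>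
    cos a ^ (2 * 2 ^ n) + \<eta> + ((3/2)^n)\<^sup>2 / (2 * \<eta>) * (1 - cos (a - s * b))"
proof -
  let ?h = "swave n" and ?L = "(3/2::real)^n"
  have sb: "s * ?h b = ?h (s * b)" using s swave_props[of n b] by auto
  define d where "d = \<bar>sin ((a - s * b) / 2)\<bar>"
  have "\<bar>?h a - ?h (s * b)\<bar> \<le> ?L * \<bar>sin a - sin (s * b)\<bar>" by (rule swave_lipschitz)
  also have "\<bar>sin a - sin (s * b)\<bar> \<le> 2 * d"
  proof -
    have "\<bar>sin a - sin (s * b)\<bar> = 2 * d * \<bar>cos ((a + s * b) / 2)\<bar>"
      unfolding sin_diff_sin d_def by (simp add: abs_mult)
    also have "\<dots> \<le> 2 * d * 1" by (rule mult_left_mono) (auto simp: d_def)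
    finally show ?thesis by simp
  qed
  \<comment> \<open>The Lipschitz bound contains the absolute value of a sine, which is no
    trigonometric polynomial, whereas its square is; the inequality of arithmetic and geometric
    means trades one for the other at the price \<eta>.\<close>
  also have "?L * (2 * d) \<le> \<eta> + ?L\<^sup>2 * d\<^sup>2 / \<eta>"
  proof -
    have "0 \<le> (\<eta> - ?L * d)\<^sup>2" by simp
    then have "2 * \<eta> * (?L * d) \<le> \<eta> * \<eta> + (?L * d)\<^sup>2" by (simp add: power2_eq_square algebra_simps)
    then show ?thesis using \<eta> by (simp add: field_simps power_mult_distrib power2_eq_square)
  qed
  also have "d\<^sup>2 = (1 - cos (a - s * b)) / 2"
  proof -
    have "2 * ((a - s * b) / 2) = a - s * b" by simp
    then show ?thesis using cos_double_sin[of "(a - s * b) / 2"] by (simp add: d_def del: times_divide_eq_right)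
  qed
  finally have 1: "\<bar>?h a - ?h (s * b)\<bar> \<le> \<eta> + ?L\<^sup>2 / (2 * \<eta>) * (1 - cos (a - s * b))"
    by (simp add: mult_left_mono)
  have "1 - s * ?h a * ?h b = 1 - (?h a)\<^sup>2 + ?h a * (?h a - ?h (s * b))"
    unfolding sb[symmetric] by (simp add: power2_eq_square algebra_simps)
  also have "?h a * (?h a - ?h (s * b)) \<le> \<bar>?h a\<bar> * \<bar>?h a - ?h (s * b)\<bar>"
    by (simp add: abs_mult[symmetric])
  also have "\<dots> \<le> 1 * \<bar>?h a - ?h (s * b)\<bar>" using swave_props by (intro mult_right_mono) auto
  finally show ?thesis using 1 swave_props[of n a] by simp
qed

lemma trig_poly_swave: "trig_poly (swave n)"
proof (induction n)
  case 0
  then show ?case using trig_poly_sin by (simp add: swave_def[abs_def])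
next
  case (Suc n)
  have "trig_poly (\<lambda>y. (3/2) * swave n y + (-1/2) * (swave n y * (swave n y * swave n y)))"
    by (intro trig_poly_add trig_poly_mult trig_poly_const Suc)
  also have "(\<lambda>y. (3/2) * swave n y + (-1/2) * (swave n y * (swave n y * swave n y))) = swave (Suc n)"
    by (simp add: fun_eq_iff swave_Suc maj3_def power3_eq_cube field_simps)
  finally show ?case .
qed

text \<open>The quotient is the mean of \<open>cos y ^ (2 * n)\<close> over a uniform phase. The
  factor \<open>2 * n + 1\<close> makes the induction close, since consecutive left-hand sides have
  ratio \<open>(2*n+1) * (2*n+3) / (2*n+2)\<^sup>2\<close>, which is below 1.\<close>

lemma central_binomial_bound: "(real ((2 * n) choose n) / 4 ^ n)\<^sup>2 * (2 * real n + 1) \<le> 1"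
proof (induction n)
  case (Suc n)
  let ?p = "\<lambda>n. real ((2 * n) choose n) / 4 ^ n"
  have "Suc n * ((2 * Suc n) choose Suc n) = Suc n * (2 * (Suc (2 * n) choose n))"
    using binomial_absorption[of n "2 * Suc n"] by (simp del: binomial_Suc_Suc add: mult_ac)
  then have 1: "(2 * Suc n) choose Suc n = 2 * (Suc (2 * n) choose n)"
    by (metis mult_cancel1 nat.distinct(1))
  have "Suc n * (Suc (2 * n) choose n) = Suc (2 * n) * ((2 * n) choose n)"
    using binomial_absorb_comp[of "Suc (2 * n)" n] by (simp del: binomial_Suc_Suc)
  then have "Suc n * ((2 * Suc n) choose Suc n) = 2 * Suc (2 * n) * ((2 * n) choose n)"
    unfolding 1 by (metis mult.assoc mult.left_commute)
  then have "real (Suc n) * real ((2 * Suc n) choose Suc n) = 2 * real (Suc (2 * n)) * real ((2 * n) choose n)"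
    by (simp only: of_nat_mult[symmetric] of_nat_numeral[symmetric, where 'a = real])
  then have "real ((2 * Suc n) choose Suc n) = 2 * real (Suc (2 * n)) * real ((2 * n) choose n) / real (Suc n)"
    by (simp add: eq_divide_eq mult.commute del: binomial_Suc_Suc of_nat_Suc)
  then have p: "?p (Suc n) = ?p n * ((2 * real n + 1) / (2 * real n + 2))"
  proof -
    have "?p (Suc n) = (2 * (2 * real n + 1) * real ((2 * n) choose n) / (real n + 1)) / (4 * 4 ^ n)"
      unfolding \<open>real ((2 * Suc n) choose Suc n) = _\<close> by (simp add: algebra_simps del: binomial_Suc_Suc)
    also have "\<dots> = ?p n * ((2 * real n + 1) / (2 * real n + 2))"
      by (simp add: divide_simps) (simp add: algebra_simps)
    finally show ?thesis .
  qed
  have "(?p (Suc n))\<^sup>2 * (2 * real (Suc n) + 1) =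
      ((?p n)\<^sup>2 * (2 * real n + 1)) * (((2 * real n + 1) * (2 * real n + 3)) / (2 * real n + 2)\<^sup>2)"
    unfolding p by (simp add: power_mult_distrib power_divide) (simp add: power2_eq_square algebra_simps)
  also have "\<dots> \<le> 1 * 1"
  proof (intro mult_mono Suc)
    have "(2 * real n + 1) * (2 * real n + 3) \<le> (2 * real n + 2)\<^sup>2" by (simp add: power2_eq_square algebra_simps)
    then show "(2 * real n + 1) * (2 * real n + 3) / (2 * real n + 2)\<^sup>2 \<le> 1" by (simp add: divide_le_eq)
  qed auto
  finally show ?case by simp
qed simp

lemma central_binomial_small:
  assumes "0 < (\<eta>::real)" shows "\<exists>n. real ((2 * 2 ^ n) choose (2 ^ n)) / 4 ^ (2 ^ n) \<le> \<eta>"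
proof -
  obtain n where n: "1 / \<eta>\<^sup>2 < real n" using reals_Archimedean2 by blast
  let ?p = "real ((2 * 2 ^ n) choose (2 ^ n)) / 4 ^ (2 ^ n)"
  have "?p\<^sup>2 * real n \<le> ?p\<^sup>2 * (2 * real (2 ^ n) + 1)"
  proof (rule mult_left_mono)
    have "n < 2 ^ n" by (rule less_exp)
    then have "real n < real (2 ^ n)" by (simp only: of_nat_less_iff)
    then show "real n \<le> 2 * real (2 ^ n) + 1" by linarith
  qed simp
  also have "\<dots> \<le> 1" by (rule central_binomial_bound)
  finally have "?p\<^sup>2 * real n \<le> 1" .
  moreover have "1 < \<eta>\<^sup>2 * real n" using n assms by (simp add: field_simps)
  moreover have "0 < real n" using n assms by (smt (verit) divide_nonneg_nonneg zero_le_power2)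
  ultimately have "?p\<^sup>2 \<le> \<eta>\<^sup>2" by (smt (verit) mult_right_mono mult_le_cancel_right_pos)
  then have "?p \<le> \<eta>" using assms by (simp add: abs_le_square_iff[symmetric])
  then show ?thesis by blast
qed

section \<open>Gaussian means of cosines, and the value of a single edge\<close>

lemma gauss_mean_cis: "gauss_mean J B (\<lambda>y. cis (\<Sum>j\<in>J. t j * y j)) (of_real (exp (- qf J B t / 2)))"
  using gauss_mean_exp[of J B 1 t] by simp

lemma gauss_mean_cos: "gauss_mean J B (\<lambda>y. of_real (cos (\<Sum>j\<in>J. t j * y j))) (of_real (exp (- qf J B t / 2)))"
proof -
  have "gauss_mean J B (\<lambda>y. (1/2) * (cis (\<Sum>j\<in>J. t j * y j) + cis (\<Sum>j\<in>J. - t j * y j)))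
     ((1/2) * (of_real (exp (- qf J B t / 2)) + of_real (exp (- qf J B (\<lambda>j. - t j) / 2))))"
    by (intro gauss_mean_scale gauss_mean_add gauss_mean_cis)
  also have "qf J B (\<lambda>j. - t j) = qf J B t" unfolding qf_def by simp
  also have "(\<lambda>y. (1/2) * (cis (\<Sum>j\<in>J. t j * y j) + cis (\<Sum>j\<in>J. - t j * y j))) =
      (\<lambda>y. complex_of_real (cos (\<Sum>j\<in>J. t j * y j)))"
    by (auto simp: fun_eq_iff complex_eq_iff sum_negf)
  finally show ?thesis by simp
qed

lemma cos_power_sum: "complex_of_real (cos a ^ n) = (\<Sum>j\<le>n. of_nat (n choose j) / 2 ^ n * cis ((2 * real j - real n) * a))"
proof -
  have "complex_of_real (cos a) = (cis a + cis (- a)) / 2" by (simp add: complex_eq_iff)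
  then have "complex_of_real (cos a ^ n) = ((cis a + cis (- a)) / 2) ^ n" by (simp only: of_real_power)
  also have "\<dots> = (\<Sum>j\<le>n. of_nat (n choose j) * cis a ^ j * cis (- a) ^ (n - j)) / 2 ^ n"
    by (simp add: power_divide binomial_ring)
  also have "\<dots> = (\<Sum>j\<le>n. of_nat (n choose j) / 2 ^ n * cis ((2 * real j - real n) * a))"
    unfolding sum_divide_distrib
    by (intro sum.cong refl) (auto simp: Complex.DeMoivre cis_mult mult.assoc of_nat_diff algebra_simps)
  finally show ?thesis .
qed

lemma one_minus_prod_le_sum:
  fixes q :: "'a \<Rightarrow> real"
  assumes "\<And>t. t \<in> A \<Longrightarrow> 0 \<le> q t \<and> q t \<le> 1"
  shows "1 - (\<Prod>t\<in>A. q t) \<le> (\<Sum>t\<in>A. 1 - q t)"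
proof (cases "finite A")
  case True
  then show ?thesis using assms
  proof (induction A rule: finite_induct)
    case (insert x A)
    have P: "0 \<le> (\<Prod>t\<in>A. q t)" "(\<Prod>t\<in>A. q t) \<le> 1" using insert.prems by (auto intro!: prod_nonneg prod_le_1)
    have "1 - (\<Prod>t\<in>insert x A. q t) = (1 - q x) * (\<Prod>t\<in>A. q t) + (1 - (\<Prod>t\<in>A. q t))"
      using insert.hyps by (simp add: algebra_simps)
    also have "\<dots> \<le> (1 - q x) * 1 + (\<Sum>t\<in>A. 1 - q t)"
      using insert P by (intro add_mono mult_left_mono) auto
    finally show ?case using insert.hyps by simp
  qed simp
qed simp

lemma exp_sum_prod: "exp (\<Sum>t<(k::nat). g t) = (\<Prod>t<k. exp (g t :: real))"
  by (induction k) (simp_all add: exp_add)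

context rounding
begin

text \<open>An odd function has mean zero under a centred Gaussian of variance \<open>v\<close>. Its
  expansion plus the reflected one represents the zero function with twice the value in question;
  positivity, applied to the multiples of this representation by 1, -1, \<i> and -\<i>, forces the
  value to vanish.\<close>

lemma mean_zero: "(\<Sum>i=1..N. c i * of_real (exp (- v * (\<nu> i)\<^sup>2 / 2))) = 0" if "0 \<le> v" for v
proof -
  let ?J = "{()}" and ?B = "\<lambda>_ _ :: unit. v"
  let ?Z = "\<Sum>i=1..N. c i * of_real (exp (- v * (\<nu> i)\<^sup>2 / 2))"
  have q: "qf ?J ?B t = v * (t ())\<^sup>2" for t by (simp add: qf_def power2_eq_square)
  have "gauss_mean ?J ?B (\<lambda>y. (\<Sum>i=1..N. c i * cis (\<Sum>j\<in>?J. (\<lambda>_. \<nu> i) j * y j)) + (\<Sum>i=1..N. c i * cis (\<Sum>j\<in>?J. (\<lambda>_. - \<nu> i) j * y j)))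
     ((\<Sum>i=1..N. c i * of_real (exp (- qf ?J ?B (\<lambda>_. \<nu> i) / 2))) + (\<Sum>i=1..N. c i * of_real (exp (- qf ?J ?B (\<lambda>_. - \<nu> i) / 2))))"
    by (intro gauss_mean_add gauss_mean_sum gauss_mean_exp)
  also have "(\<lambda>y. (\<Sum>i=1..N. c i * cis (\<Sum>j\<in>?J. (\<lambda>_. \<nu> i) j * y j)) + (\<Sum>i=1..N. c i * cis (\<Sum>j\<in>?J. (\<lambda>_. - \<nu> i) j * y j))) = (\<lambda>y. 0)"
    using h_eq[of "y ()" for y] h_eq[of "- y ()" for y] h_odd
    by (simp add: fun_eq_iff) (metis add.right_inverse of_real_minus)
  finally have z: "gauss_mean ?J ?B (\<lambda>y. 0) (2 * ?Z)" by (simp add: q)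
  have psd: "0 \<le> qf ?J ?B t" for t using that by (simp add: q)
  have "0 \<le> Re (a * (2 * ?Z))" for a
    by (rule gauss_mean_nonneg[OF gauss_mean_scale[OF z, of a]]) (use psd in auto)
  from this[of 1] this[of "-1"] this[of \<i>] this[of "-\<i>"] show ?thesis
    by (simp add: complex_eq_iff)
qed

text \<open>The variables at one vertex are uncorrelated, so the mean factors over the bits, and
  each bit is fair because \<open>h\<close> is odd.\<close>

lemma gauss_mean_label0:
  fixes u :: 'v
  assumes fin: "finite S" and u: "u \<in> S" and \<sigma>: "0 \<le> v"
    and B: "\<And>t t'. B (u, t) (u, t') = (if t = t' then v else 0)"
  shows "gauss_mean (S \<times> {..<k}) B (\<lambda>y. of_real (label_prob 0 (\<lambda>t. y (u, t)))) (1 / 2 ^ k)"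
proof -
  let ?J = "S \<times> {..<k}"
  define w where "w = (\<lambda>\<phi> :: nat \<Rightarrow> nat. \<lambda>j :: 'v \<times> nat. if fst j = u then \<nu> (\<phi> (snd j)) else 0)"
  have wsum: "(\<Sum>j\<in>?J. w \<phi> j * y j) = (\<Sum>t<k. \<nu> (\<phi> t) * y (u, t))" for \<phi> y
  proof -
    have "(\<Sum>j\<in>?J. w \<phi> j * y j) = (\<Sum>j\<in>{u} \<times> {..<k}. w \<phi> j * y j)"
      using u fin by (intro sum.mono_neutral_right) (auto simp: w_def)
    also have "\<dots> = (\<Sum>j\<in>{u} \<times> {..<k}. case j of (x, t) \<Rightarrow> \<nu> (\<phi> t) * y (u, t))"
      by (rule sum.cong) (auto simp: w_def)
    finally show ?thesis by (simp only: sum.cartesian_product[symmetric]) simp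
  qed
  have wq: "qf ?J B (w \<phi>) = v * (\<Sum>t<k. (\<nu> (\<phi> t))\<^sup>2)" for \<phi>
  proof -
    have "qf ?J B (w \<phi>) = qf ({u} \<times> {..<k}) B (w \<phi>)"
      using u fin by (intro qf_neutral) (auto simp: w_def)
    also have "\<dots> = (\<Sum>t<k. \<Sum>t'<k. \<nu> (\<phi> t) * \<nu> (\<phi> t') * B (u, t) (u, t'))"
      unfolding qf_def
    proof -
      have r: "(\<Sum>j\<in>{u} \<times> {..<k}. f j) = (\<Sum>t<k. f (u, t))" for f :: "'v \<times> nat \<Rightarrow> real"
        by (rule sum.reindex_bij_witness[of _ "\<lambda>t. (u, t)" snd]) auto
      show "(\<Sum>i\<in>{u} \<times> {..<k}. \<Sum>j\<in>{u} \<times> {..<k}. w \<phi> i * w \<phi> j * B i j) =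
          (\<Sum>t<k. \<Sum>t'<k. \<nu> (\<phi> t) * \<nu> (\<phi> t') * B (u, t) (u, t'))"
        unfolding r by (simp add: w_def)
    qed
    also have "\<dots> = (\<Sum>t<k. v * (\<nu> (\<phi> t))\<^sup>2)"
      by (simp add: B sum.delta power2_eq_square mult_ac if_distrib cong: if_cong)
    finally show ?thesis by (simp add: sum_distrib_left)
  qed
  have "gauss_mean ?J B (\<lambda>y. \<Sum>\<phi>\<in>Phi. label_coeff 0 \<phi> * cis (\<Sum>j\<in>?J. w \<phi> j * y j)) (\<Sum>\<phi>\<in>Phi. label_coeff 0 \<phi> * of_real (exp (- qf ?J B (w \<phi>) / 2)))"
    by (intro gauss_mean_sum gauss_mean_exp)
  also have "(\<lambda>y. \<Sum>\<phi>\<in>Phi. label_coeff 0 \<phi> * cis (\<Sum>j\<in>?J. w \<phi> j * y j)) = (\<lambda>y. of_real (label_prob 0 (\<lambda>t. y (u, t))))"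
    unfolding wsum by (rule ext) (rule sum_label_coeff_cis)
  also have "(\<Sum>\<phi>\<in>Phi. label_coeff 0 \<phi> * of_real (exp (- qf ?J B (w \<phi>) / 2))) =
      (\<Sum>\<phi>\<in>Phi. \<Prod>t<k. bit_coeff False (\<phi> t) * of_real (exp (- v * (\<nu> (\<phi> t))\<^sup>2 / 2)))"
  proof (rule sum.cong[OF refl])
    fix \<phi> :: "nat \<Rightarrow> nat"
    have "exp (- qf ?J B (w \<phi>) / 2) = (\<Prod>t<k. exp (- v * (\<nu> (\<phi> t))\<^sup>2 / 2))"
      unfolding exp_sum_prod[symmetric] wq by (simp add: sum_distrib_left sum_divide_distrib sum_negf)
    then show "label_coeff 0 \<phi> * of_real (exp (- qf ?J B (w \<phi>) / 2)) = (\<Prod>t<k. bit_coeff False (\<phi> t) * of_real (exp (- v * (\<nu> (\<phi> t))\<^sup>2 / 2)))"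
      by (simp add: label_coeff_def prod.distrib)
  qed
  also have "\<dots> = (\<Prod>t<k. \<Sum>i\<le>N. bit_coeff False i * of_real (exp (- v * (\<nu> i)\<^sup>2 / 2)))"
    unfolding Phi_def by (subst prod_sum_PiE) auto
  also have "(\<Sum>i\<le>N. bit_coeff False i * of_real (exp (- v * (\<nu> i)\<^sup>2 / 2))) =
      1 / 2 + (\<Sum>i=1..N. c i * of_real (exp (- v * (\<nu> i)\<^sup>2 / 2))) / 2"
    by (simp add: atMost_atLeast0 sum.atLeast_Suc_atMost bit_coeff_def \<nu>0 bit_sign_def sum_divide_distrib)
  also have "\<dots> = 1 / 2" using mean_zero[OF \<sigma>] by simp
  finally show ?thesis by (simp add: power_divide)
qed

text \<open>Given the field, the left side is the probability that one vertex has label 0 and the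
  other a label different from \<open>i\<close>. A union bound over the bits charges it to the bits
  in which the two labels fail to differ exactly by \<open>i\<close>; such a failure at bit
  \<open>t\<close> has probability \<open>(1 - s t * h (y t) * h (z t)) / 2\<close>.\<close>

lemma label_mismatch:
  assumes i: "\<And>t. t < k \<Longrightarrow> s t = bit_sign (bit i t)"
  shows "label_prob 0 y - label_prob 0 y * label_prob i z \<le> (\<Sum>t<k. (1 - s t * h (y t) * h (z t)) / 2)"
proof -
  define p where "p = (\<lambda>t. (1 + h (y t)) / 2)"
  define q where "q = (\<lambda>t. (1 + s t * h (z t)) / 2)"
  have p: "0 \<le> p t \<and> p t \<le> 1" for t using h_le[of "y t"] by (auto simp: p_def abs_le_iff)
  have q: "0 \<le> q t \<and> q t \<le> 1" if "t < k" for t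
    using h_le[of "z t"] i[OF that] by (auto simp: q_def abs_le_iff bit_sign_def)
  have H: "label_prob 0 y = (\<Prod>t<k. p t)" "label_prob i z = (\<Prod>t<k. q t)"
    unfolding label_prob_def p_def q_def by (auto simp: bit_sign_def i intro!: prod.cong)
  have P: "(\<Prod>t<k. p t) \<le> p t'" if "t' < k" for t'
  proof -
    have "(\<Prod>t<k. p t) = p t' * (\<Prod>t\<in>{..<k} - {t'}. p t)"
      using that by (intro prod.remove) auto
    also have "\<dots> \<le> p t' * 1" using p by (intro mult_left_mono prod_le_1) auto
    finally show ?thesis by simp
  qed
  have "label_prob 0 y - label_prob 0 y * label_prob i z = (\<Prod>t<k. p t) * (1 - (\<Prod>t<k. q t))" by (simp add: H algebra_simps)
  also have "\<dots> \<le> (\<Prod>t<k. p t) * (\<Sum>t<k. 1 - q t)"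
    using p q by (intro mult_left_mono one_minus_prod_le_sum prod_nonneg) auto
  also have "\<dots> = (\<Sum>t'<k. (\<Prod>t<k. p t) * (1 - q t'))" by (simp add: sum_distrib_left)
  also have "\<dots> \<le> (\<Sum>t<k. (1 - s t * h (y t) * h (z t)) / 2)"
  proof (rule sum_mono)
    fix t assume "t \<in> {..<k}"
    then have t: "t < k" by simp
    have "(\<Prod>t<k. p t) * (1 - q t) \<le> p t * (1 - q t)" using P[OF t] q[OF t] by (intro mult_right_mono) auto
    also have "\<dots> \<le> p t * (1 - q t) + (1 - p t) * q t" using p q[OF t] by simp
    also have "\<dots> = (1 - s t * h (y t) * h (z t)) / 2" unfolding p_def q_def by (simp add: field_simps)
    finally show "(\<Prod>t<k. p t) * (1 - q t) \<le> (1 - s t * h (y t) * h (z t)) / 2" .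
  qed
  finally show ?thesis .
qed

end

text \<open>Here \<open>\<rho> = 1 - \<mu>\<close> is the correlation along an edge; the diagonal of the kernel carries an extra \<open>\<mu>\<close>
  as slack for positive semidefiniteness.\<close>

lemma sa_sol_pair:
  fixes n :: nat
  assumes rnd: "rounding N c \<nu> (swave n)"
    and \<eta>: "0 < \<eta>" and \<mu>: "0 \<le> \<mu>"
    and uv: "u \<noteq> v"
    and i: "i < 2 ^ k" "\<And>t. t < k \<Longrightarrow> s t = bit_sign (bit i t)"
    and sym: "\<And>i j. B i j = B j i" and psd: "\<And>t. 0 \<le> qf ({u, v} \<times> {..<k}) B t"
    and Buu: "\<And>x t t'. x \<in> {u, v} \<Longrightarrow> B (x, t) (x, t') = (if t = t' then \<sigma> * (1 + \<mu>) else 0)"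
    and Buv: "\<And>t t'. t < k \<Longrightarrow> t' < k \<Longrightarrow> B (u, t) (v, t') = (if t = t' then \<sigma> * s t * (1 - \<mu>) else 0)"
    and \<sigma>: "0 \<le> \<sigma>"
  shows "1 / 2 ^ k - real k / 2 * (real ((2 * 2 ^ n) choose (2 ^ n)) / 4 ^ (2 ^ n) + exp (- 2 * \<sigma>) + \<eta> +
      ((3/2)^n)\<^sup>2 / (2 * \<eta>) * (1 - exp (- 2 * \<sigma> * \<mu>)))
    \<le> Re (rounding.sa_sol k N c \<nu> price B {u, v} (pair_assignment u v (price u 0) (price v i)))"
proof -
  interpret rounding k N c \<nu> "swave n" by (rule rnd)
  let ?h = "swave n" and ?J = "{u, v} \<times> {..<k}"
  define K :: nat where "K = 2 ^ n"
  define C where "C = ((3/2::real)^n)\<^sup>2 / (2 * \<eta>)"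
  have C: "0 \<le> C" using \<eta> by (simp add: C_def)
  have s: "s t = 1 \<or> s t = -1" if "t < k" for t using i(2)[OF that] by (auto simp: bit_sign_def)
  define \<alpha> where "\<alpha> = pair_assignment u v (price u 0) (price v i)"
  have \<alpha>: "\<alpha> u = price u 0" "\<alpha> v = price v i" using uv by (auto simp: \<alpha>_def pair_assignment_def)
  have fJ: "finite ?J" by simp
  define e where "e = (\<lambda>j0 (x::real) (j :: 'a \<times> nat). if j = j0 then x else 0)"
  have esum: "(\<Sum>j\<in>?J. e j0 x j * y j) = x * y j0" if "j0 \<in> ?J" for j0 x y
    using that by (simp add: e_def if_distrib[of "\<lambda>z. z * _"] sum.delta cong: if_cong)
  have eq: "qf ?J B (e (u, t) x) = \<sigma> * (1 + \<mu>) * x\<^sup>2" if "t < k" for t x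
  proof -
    have "qf ?J B (e (u, t) x) = qf {(u, t)} B (e (u, t) x)"
      using that by (intro qf_neutral) (auto simp: e_def)
    then show ?thesis by (simp add: qf_def e_def Buu power2_eq_square)
  qed
  \<comment> \<open>The linear form \<open>y (u, t) - s t * y (v, t)\<close>. Its variance is
    \<open>2 * \<sigma> * (1 + \<mu>) - 2 * \<sigma> * (1 - \<mu>) = 4 * \<sigma> * \<mu>\<close>,
    small once \<mu> is small against \<sigma>.\<close>
  define d where "d = (\<lambda>t j. e (u, t) 1 j - e (v, t) (s t) j)"
  have dsum: "(\<Sum>j\<in>?J. d t j * y j) = y (u, t) - s t * y (v, t)" if "t < k" for t y
    unfolding d_def left_diff_distrib sum_subtractf using that by (simp add: esum)
  have dq: "qf ?J B (d t) = 4 * \<sigma> * \<mu>" if t: "t < k" for t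
  proof -
    have "qf ?J B (d t) = qf {(u, t), (v, t)} B (d t)"
      using that by (intro qf_neutral) (auto simp: e_def d_def)
    also have "\<dots> = \<sigma> * (1 + \<mu>) * (1 + s t * s t) - 2 * s t * (\<sigma> * s t * (1 - \<mu>))"
      using uv t by (simp add: qf_def e_def d_def Buu Buv sym[of "(v, t)" "(u, t)"] algebra_simps)
    also have "\<dots> = 4 * \<sigma> * \<mu>" using s[OF t] by (auto simp: algebra_simps)
    finally show ?thesis .
  qed
  let ?w = "\<lambda>j. of_nat ((2 * K) choose j) / 2 ^ (2 * K) :: complex"
  let ?g = "\<lambda>t y. of_real (cos (y (u, t)) ^ (2 * K)) :: complex"
  \<comment> \<open>The mean of the cosine power. Frequency 0 occurs only at \<open>j = K\<close>
    and leaves the central binomial term; all other frequencies are at least 2 in absolute value and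
    are damped by at least \<open>exp (- 2 * \<sigma>)\<close>.\<close>
  define vg where "vg = (\<Sum>j\<le>2 * K. of_nat ((2 * K) choose j) / 2 ^ (2 * K) * exp (- \<sigma> * (1 + \<mu>) * (2 * real j - real (2 * K))\<^sup>2 / 2))"
  have tpg: "gauss_mean ?J B (?g t) (of_real vg)" if t: "t < k" for t
  proof -
    have "gauss_mean ?J B (\<lambda>y. \<Sum>j\<le>2 * K. ?w j * cis (\<Sum>l\<in>?J. e (u, t) (2 * real j - real (2 * K)) l * y l))
        (\<Sum>j\<le>2 * K. ?w j * of_real (exp (- qf ?J B (e (u, t) (2 * real j - real (2 * K))) / 2)))"
      by (intro gauss_mean_sum gauss_mean_exp)
    also have "(\<lambda>y. \<Sum>j\<le>2 * K. ?w j * cis (\<Sum>l\<in>?J. e (u, t) (2 * real j - real (2 * K)) l * y l)) = ?g t"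
      unfolding cos_power_sum using t by (subst esum) auto
    also have "(\<Sum>j\<le>2 * K. ?w j * of_real (exp (- qf ?J B (e (u, t) (2 * real j - real (2 * K))) / 2))) = of_real vg"
      using t by (simp add: eq vg_def mult.assoc)
    finally show ?thesis .
  qed
  have vg: "vg \<le> real ((2 * K) choose K) / 4 ^ K + exp (- 2 * \<sigma>)"
  proof -
    have "vg = (\<Sum>j\<in>{..2 * K}. real ((2 * K) choose j) / 4 ^ K * exp (- \<sigma> * (1 + \<mu>) * (2 * real j - real (2 * K))\<^sup>2 / 2))"
      by (simp add: vg_def power_mult)
    also have "\<dots> \<le> (\<Sum>j\<in>{..2 * K}. (if j = K then real ((2 * K) choose K) / 4 ^ K else 0) +
        real ((2 * K) choose j) / 4 ^ K * exp (- 2 * \<sigma>))"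
    proof (rule sum_mono)
      fix j assume "j \<in> {..2 * K}"
      show "real ((2 * K) choose j) / 4 ^ K * exp (- \<sigma> * (1 + \<mu>) * (2 * real j - real (2 * K))\<^sup>2 / 2) \<le>
        (if j = K then real ((2 * K) choose K) / 4 ^ K else 0) + real ((2 * K) choose j) / 4 ^ K * exp (- 2 * \<sigma>)"
      proof (cases "j = K")
        case False
        have "1 \<le> \<bar>real j - real K\<bar>" using False by linarith
        then have "1\<^sup>2 \<le> (real j - real K)\<^sup>2" by (metis abs_1 abs_le_square_iff abs_abs)
        moreover have "(2 * real j - real (2 * K))\<^sup>2 = 4 * (real j - real K)\<^sup>2" by (simp add: power2_eq_square algebra_simps)
        ultimately have "4 \<le> (2 * real j - real (2 * K))\<^sup>2" by simp
        then have "\<sigma> * 1 * 4 \<le> \<sigma> * (1 + \<mu>) * (2 * real j - real (2 * K))\<^sup>2"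
          using \<sigma> \<mu> by (intro mult_mono) auto
        then have "exp (- \<sigma> * (1 + \<mu>) * (2 * real j - real (2 * K))\<^sup>2 / 2) \<le> exp (- 2 * \<sigma>)" by simp
        then show ?thesis using False by (simp add: divide_right_mono mult_left_mono)
      qed simp
    qed
    also have "\<dots> = real ((2 * K) choose K) / 4 ^ K + (\<Sum>j\<le>2 * K. real ((2 * K) choose j)) / 4 ^ K * exp (- 2 * \<sigma>)"
      by (simp add: sum.distrib sum_distrib_right[symmetric] sum_divide_distrib[symmetric])
    also have "(\<Sum>j\<le>2 * K. real ((2 * K) choose j)) = 4 ^ K"
      using choose_row_sum[of "2 * K"] by (simp add: power_mult of_nat_sum[symmetric] del: of_nat_sum)
    finally show ?thesis by simp
  qed
  let ?G = "\<lambda>y. (\<Sum>t<k. (1/2) * (?g t y + of_real \<eta> + of_real C * (1 - of_real (cos (\<Sum>j\<in>?J. d t j * y j)))))"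
  let ?vG = "(\<Sum>t<k. (1/2) * (of_real vg + of_real \<eta> + of_real C * (1 - of_real (exp (- qf ?J B (d t) / 2))))) :: complex"
  have tpG: "gauss_mean ?J B ?G ?vG"
    by (intro gauss_mean_sum gauss_mean_scale gauss_mean_add gauss_mean_diff gauss_mean_const gauss_mean_cos tpg) auto
  have tp0: "gauss_mean ?J B (\<lambda>y. of_real (label_prob 0 (\<lambda>t. y (u, t)))) (1 / 2 ^ k)"
    by (rule gauss_mean_label0[where v = "\<sigma> * (1 + \<mu>)"]) (use \<sigma> \<mu> in \<open>auto simp: Buu\<close>)
  have tps: "gauss_mean ?J B (\<lambda>y. of_real (\<Prod>x\<in>{u, v}. price_prob price x (\<alpha> x) (\<lambda>t. y (x, t)))) (sa_sol price B {u, v} \<alpha>)"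
    by (rule gauss_mean_sol) simp
  \<comment> \<open>The pointwise inequality is transferred to the means: label 0 at
    \<open>u\<close> has probability \<open>1 / 2 ^ k\<close>, from which the mean of the
    disagreement bound is subtracted.\<close>
  have "Re (1 / 2 ^ k - ?vG) \<le> Re (sa_sol price B {u, v} \<alpha>)"
  proof (rule gauss_mean_mono[OF gauss_mean_diff[OF tp0 tpG] tps _ fJ sym psd])
    fix y :: "'a \<times> nat \<Rightarrow> real"
    let ?y = "\<lambda>t. y (u, t)" and ?z = "\<lambda>t. y (v, t)"
    have "label_prob 0 ?y - label_prob 0 ?y * label_prob i ?z \<le> (\<Sum>t<k. (1 - s t * ?h (?y t) * ?h (?z t)) / 2)"
      by (rule label_mismatch[OF i(2)])
    also have "\<dots> \<le> (\<Sum>t<k. (1/2) * (cos (?y t) ^ (2 * K) + \<eta> + C * (1 - cos (\<Sum>j\<in>?J. d t j * y j))))"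
    proof (rule sum_mono)
      fix t assume "t \<in> {..<k}"
      then have t: "t < k" by simp
      show "(1 - s t * ?h (?y t) * ?h (?z t)) / 2 \<le> (1/2) * (cos (?y t) ^ (2 * K) + \<eta> + C * (1 - cos (\<Sum>j\<in>?J. d t j * y j)))"
        unfolding dsum[OF t] using swave_pair[OF s[OF t] \<eta>, of n "?y t" "?z t"] by (simp add: K_def C_def)
    qed
    also have "\<dots> = Re (?G y)" by simp
    finally have "label_prob 0 ?y - Re (?G y) \<le> label_prob 0 ?y * label_prob i ?z" by linarith
    also have "\<dots> \<le> price_prob price u (\<alpha> u) ?y * price_prob price v (\<alpha> v) ?z"
      unfolding \<alpha> using i(1) by (intro mult_mono label_prob_le_price_prob label_prob_nonneg price_prob_nonneg) auto
    finally show "Re (of_real (label_prob 0 ?y) - ?G y) \<le> Re (of_real (\<Prod>x\<in>{u, v}. price_prob price x (\<alpha> x) (\<lambda>t. y (x, t))))"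
      using uv by simp
  qed
  moreover have "Re (1 / 2 ^ k - ?vG) = 1 / 2 ^ k - real k / 2 * (vg + \<eta> + C * (1 - exp (- 2 * \<sigma> * \<mu>)))"
  proof -
    have "?vG = (\<Sum>t<k. of_real ((1/2) * (vg + \<eta> + C * (1 - exp (- 2 * \<sigma> * \<mu>)))))"
      by (rule sum.cong) (auto simp: dq mult_ac)
    then have "Re ?vG = Re (\<Sum>t<k. of_real ((1/2) * (vg + \<eta> + C * (1 - exp (- 2 * \<sigma> * \<mu>)))))"
      by (rule arg_cong)
    also have "\<dots> = real k / 2 * (vg + \<eta> + C * (1 - exp (- 2 * \<sigma> * \<mu>)))" by simp
    finally have "Re ?vG = real k / 2 * (vg + \<eta> + C * (1 - exp (- 2 * \<sigma> * \<mu>)))" .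
    moreover have "Re (1 / 2 ^ k) = 1 / 2 ^ k"
      by (metis Re_complex_of_real of_real_1 of_real_divide of_real_numeral of_real_power)
    ultimately show ?thesis by simp
  qed
  moreover have "real k / 2 * (vg + \<eta> + C * (1 - exp (- 2 * \<sigma> * \<mu>))) \<le>
     real k / 2 * (real ((2 * K) choose K) / 4 ^ K + exp (- 2 * \<sigma>) + \<eta> + C * (1 - exp (- 2 * \<sigma> * \<mu>)))"
    using vg by (intro mult_left_mono) auto
  ultimately have "1 / 2 ^ k - real k / 2 * (real ((2 * K) choose K) / 4 ^ K + exp (- 2 * \<sigma>) + \<eta> + C * (1 - exp (- 2 * \<sigma> * \<mu>)))
      \<le> Re (sa_sol price B {u, v} \<alpha>)" by linarith
  then show ?thesis unfolding \<alpha>_def K_def C_def .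
qed

lemma rounding_swave: "\<exists>N c \<nu>. rounding N c \<nu> (swave n)"
proof -
  obtain N :: nat and c \<nu> where r: "\<nu> 0 = 0" "\<forall>y. complex_of_real (swave n y) = (\<Sum>i=1..N. c i * cis (\<nu> i * y))"
    using trig_poly_sum[OF trig_poly_swave] by blast
  then have "rounding N c \<nu> (swave n)" using swave_props[of n] by unfold_locales auto
  then show ?thesis by blast
qed

section \<open>Sparse graphs and their precision forms\<close>

lemma handshake:
  assumes "finite E" "\<And>e. e \<in> E \<Longrightarrow> card e = 2"
  shows "(\<Sum>x\<in>\<Union>E. card {e \<in> E. x \<in> e}) = 2 * card E"
proof -
  have fin: "finite e" if "e \<in> E" for e using assms(2)[OF that] by (intro card_ge_0_finite) simp
  then have fU: "finite (\<Union>E)" using assms(1) by auto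
  have "(\<Sum>x\<in>\<Union>E. card {e \<in> E. x \<in> e}) = (\<Sum>x\<in>\<Union>E. \<Sum>e\<in>E. of_bool (x \<in> e))"
    using assms(1) by (intro sum.cong refl) (simp add: of_bool_def sum.If_cases Int_def)
  also have "\<dots> = (\<Sum>e\<in>E. \<Sum>x\<in>\<Union>E. of_bool (x \<in> e))" by (rule sum.swap)
  also have "\<dots> = (\<Sum>e\<in>E. card e)"
  proof (rule sum.cong[OF refl])
    fix e assume "e \<in> E"
    then have "\<Union>E \<inter> e = e" by auto
    then show "(\<Sum>x\<in>\<Union>E. of_bool (x \<in> e)) = card e" using fU by (simp add: of_bool_def sum.If_cases Int_def)
  qed
  finally show ?thesis using assms(2) by simp
qed

text \<open>The form below is, for a forest, the precision matrix of the Gaussian Markov field whose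
  correlations are the products of the \<open>r e\<close> along paths.\<close>

definition edge_form :: "('v set \<Rightarrow> real) \<Rightarrow> ('v \<Rightarrow> real) \<Rightarrow> 'v set \<Rightarrow> real" where
  "edge_form r f e = (r e)\<^sup>2 / (1 - (r e)\<^sup>2) * (\<Sum>x\<in>e. (f x)\<^sup>2) - 2 * r e / (1 - (r e)\<^sup>2) * (\<Prod>x\<in>e. f x)"

definition precision_form :: "'v set \<Rightarrow> 'v set set \<Rightarrow> ('v set \<Rightarrow> real) \<Rightarrow> ('v \<Rightarrow> real) \<Rightarrow> real" where
  "precision_form U E r f = (\<Sum>v\<in>U. (f v)\<^sup>2) + (\<Sum>e\<in>E. edge_form r f e)"

lemma edge_form_pair: "a \<noteq> b \<Longrightarrow> edge_form r f {a, b} =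
   (r {a, b})\<^sup>2 / (1 - (r {a, b})\<^sup>2) * ((f a)\<^sup>2 + (f b)\<^sup>2) - 2 * r {a, b} / (1 - (r {a, b})\<^sup>2) * (f a * f b)"
  unfolding edge_form_def by simp

text \<open>Elimination of a leaf: the terms that contain it form the perfect square
  \<open>(a - r * b)\<^sup>2 / (1 - r\<^sup>2)\<close>, the conditional Gaussian form of the leaf
  given its neighbour.\<close>

lemma leaf_square:
  fixes r a b :: real
  assumes "r\<^sup>2 < 1"
  shows "0 \<le> a\<^sup>2 + (r\<^sup>2 / (1 - r\<^sup>2) * (a\<^sup>2 + b\<^sup>2) - 2 * r / (1 - r\<^sup>2) * (a * b))"
proof -
  have "a\<^sup>2 + (r\<^sup>2 / (1 - r\<^sup>2) * (a\<^sup>2 + b\<^sup>2) - 2 * r / (1 - r\<^sup>2) * (a * b)) = (a - r * b)\<^sup>2 / (1 - r\<^sup>2)"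
    using assms by (simp add: divide_simps) (simp add: power2_eq_square algebra_simps)
  then show ?thesis using assms by simp
qed

text \<open>Elimination of a vertex of degree two: minimising over its value \<open>t\<close> leaves
  the form of one edge whose correlation is the product, as for a path of a Markov field.\<close>

lemma series_reduction:
  fixes r1 r2 a b t :: real
  assumes r: "r1\<^sup>2 < 1" "r2\<^sup>2 < 1"
  shows "(r1 * r2)\<^sup>2 / (1 - (r1 * r2)\<^sup>2) * (a\<^sup>2 + b\<^sup>2) - 2 * (r1 * r2) / (1 - (r1 * r2)\<^sup>2) * (a * b) \<le>
    t\<^sup>2 + (r1\<^sup>2 / (1 - r1\<^sup>2) * (t\<^sup>2 + a\<^sup>2) - 2 * r1 / (1 - r1\<^sup>2) * (t * a)) +
    (r2\<^sup>2 / (1 - r2\<^sup>2) * (t\<^sup>2 + b\<^sup>2) - 2 * r2 / (1 - r2\<^sup>2) * (t * b))" (is "?l \<le> ?r")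
proof -
  define A B C where "A = 1 - r1\<^sup>2" and "B = 1 - r2\<^sup>2" and "C = 1 - (r1 * r2)\<^sup>2"
  have "(r1 * r2)\<^sup>2 < 1"
    using r mult_left_mono[of "r2\<^sup>2" 1 "r1\<^sup>2"] by (simp add: power_mult_distrib)
  then have pos: "0 < A" "0 < B" "0 < C" using r by (auto simp: A_def B_def C_def)
  \<comment> \<open>The square vanishes at the minimiser
    \<open>t = (r1 * B * a + r2 * A * b) / C\<close>.\<close>
  have "(?r - ?l) * (A * B * C) = (C * t - r1 * B * a - r2 * A * b)\<^sup>2"
  proof -
    have d: "(x / A) * (A * B * C) = x * (B * C)" "(x / B) * (A * B * C) = x * (A * C)" "(x / C) * (A * B * C) = x * (A * B)" for x
      using pos by simp_all
    have "(?r - ?l) * (A * B * C) = t\<^sup>2 * (A * B * C) + r1\<^sup>2 * (t\<^sup>2 + a\<^sup>2) * (B * C) - 2 * r1 * (t * a) * (B * C)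
       + r2\<^sup>2 * (t\<^sup>2 + b\<^sup>2) * (A * C) - 2 * r2 * (t * b) * (A * C)
       - ((r1 * r2)\<^sup>2 * (a\<^sup>2 + b\<^sup>2) * (A * B) - 2 * (r1 * r2) * (a * b) * (A * B))"
      unfolding A_def[symmetric] B_def[symmetric] C_def[symmetric]
      by (simp add: left_diff_distrib distrib_right times_divide_eq_left d[unfolded times_divide_eq_left])
    also have "\<dots> = (C * t - r1 * B * a - r2 * A * b)\<^sup>2"
      unfolding A_def B_def C_def by (simp add: power2_eq_square) algebra
    finally show ?thesis .
  qed
  then have "0 \<le> (?r - ?l) * (A * B * C)" by simp
  moreover have "0 < A * B * C" using pos by simp
  ultimately have "0 \<le> ?r - ?l" unfolding zero_le_mult_iff by linarith
  then show ?thesis by linarith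
qed

lemma degree_two_neighbours:
  assumes "\<And>e. e \<in> E \<Longrightarrow> card e = 2" "card {e \<in> E. t \<in> e} = 2"
  obtains a b where "a \<noteq> b" "a \<noteq> t" "b \<noteq> t" "{e \<in> E. t \<in> e} = {{t, a}, {t, b}}"
proof -
  obtain e1 e2 where e: "{e \<in> E. t \<in> e} = {e1, e2}" "e1 \<noteq> e2"
    using assms(2) by (auto simp: card_2_iff)
  then have m: "e1 \<in> E" "t \<in> e1" "e2 \<in> E" "t \<in> e2" by auto
  have ex: "\<exists>a. a \<noteq> t \<and> e = {t, a}" if "e \<in> E" "t \<in> e" for e
    using assms(1)[OF that(1)] that(2) by (auto simp: card_2_iff)
  obtain a b where "a \<noteq> t" "e1 = {t, a}" "b \<noteq> t" "e2 = {t, b}" using ex m by metis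
  then show ?thesis using that e by metis
qed

text \<open>The left side is the cyclomatic excess of a connected edge set. It is compared with the
  total length and not with the number of edges, because suppressing a vertex of degree two
  preserves excess and length while it removes an edge.\<close>

definition sparse :: "real \<Rightarrow> ('v set \<Rightarrow> nat) \<Rightarrow> 'v set set \<Rightarrow> bool" where
  "sparse \<kappa> len E \<longleftrightarrow> (\<forall>F\<subseteq>E. F \<noteq> {} \<longrightarrow> real (card F) - real (card (\<Union>F)) + 1 \<le> \<kappa> * real (\<Sum>e\<in>F. len e))"

lemma sparse_subset: "sparse \<kappa> len E \<Longrightarrow> E' \<subseteq> E \<Longrightarrow> sparse \<kappa> len E'"
  unfolding sparse_def by blast

text \<open>Every edge \<open>e\<close> stands for a path of length \<open>len e\<close>. Long edges are deleted, leaves are removed and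
  vertices of degree two are suppressed; a graph in which none of this applies violates sparsity.\<close>

lemma precision_form_lower_bound:
  fixes \<rho> \<kappa> A :: real and L :: nat
  assumes \<rho>: "0 < \<rho>" "\<rho> < 1" and \<kappa>: "0 < \<kappa>" "3 * real L * \<kappa> < 1"
    and "finite U" "\<Union>E \<subseteq> U" "finite E"
    and "\<And>e. e \<in> E \<Longrightarrow> card e = 2 \<and> 1 \<le> len e \<and> \<bar>r e\<bar> = \<rho> ^ len e"
    and "sparse \<kappa> len E"
    and f: "\<And>x. \<bar>f x\<bar> \<le> A"
  shows "- (2 * \<rho> ^ L / (1 - \<rho>\<^sup>2) * A\<^sup>2 * real (card E)) \<le> precision_form U E r f"
  using assms(5-9)
proof (induction "card E" arbitrary: U E len r rule: less_induct)
  case (less E U len r)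
  note fU = less.prems(1) and EU = less.prems(2) and fE = less.prems(3) and E = less.prems(4) and sp = less.prems(5)
  let ?c = "2 * \<rho> ^ L / (1 - \<rho>\<^sup>2) * A\<^sup>2"
  have \<rho>2: "0 < 1 - \<rho>\<^sup>2" using \<rho> by (simp add: abs_square_less_1)
  have c: "0 \<le> ?c" using \<rho> \<rho>2 by simp
  have r1: "(r e)\<^sup>2 \<le> \<rho>\<^sup>2" "(r e)\<^sup>2 < 1" if "e \<in> E" for e
  proof -
    have "\<bar>r e\<bar> \<le> \<rho>" using E[OF that] \<rho> power_decreasing[of 1 "len e" \<rho>] by simp
    then show "(r e)\<^sup>2 \<le> \<rho>\<^sup>2" using \<rho> by (simp add: abs_le_square_iff[symmetric])
    then show "(r e)\<^sup>2 < 1" using \<rho>2 by simp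
  qed
  have card_E: "card (E - {e}) < card E" "real (card E) = real (card (E - {e})) + 1" if "e \<in> E" for e
    using card.remove[OF fE that] by simp_all
  have fin_e: "finite e" if "e \<in> E" for e using E[OF that] by (intro card_ge_0_finite) simp
  have pair: "\<exists>y. y \<noteq> x \<and> e = {x, y}" if "e \<in> E" "x \<in> e" for e x
    using E[OF that(1)] that(2) by (auto simp: card_2_iff)
  consider (empty) "E = {}" | (long) e where "e \<in> E" "L < len e"
    | (leaf) x where "\<forall>e\<in>E. len e \<le> L" "x \<in> \<Union>E" "card {e \<in> E. x \<in> e} = 1"
    | (two) x where "\<forall>e\<in>E. len e \<le> L" "card {e \<in> E. x \<in> e} = 2"
    | (stuck) "E \<noteq> {}" "\<forall>e\<in>E. len e \<le> L" "\<forall>x\<in>\<Union>E. 3 \<le> card {e \<in> E. x \<in> e}"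
  proof -
    have "card {e \<in> E. x \<in> e} \<noteq> 0" if "x \<in> \<Union>E" for x using that fE by auto
    then have deg: "card {e \<in> E. x \<in> e} = 1 \<or> card {e \<in> E. x \<in> e} = 2 \<or> 3 \<le> card {e \<in> E. x \<in> e}"
      if "x \<in> \<Union>E" for x using that by fastforce
    show ?thesis
    proof (rule ccontr)
      assume n: "\<not> thesis"
      have 1: "E \<noteq> {}" using n that(1) by blast
      have 2: "\<forall>e\<in>E. len e \<le> L" using n that(2) not_le by blast
      have 3: "\<forall>x\<in>\<Union>E. 3 \<le> card {e \<in> E. x \<in> e}" using n deg that(3,4) 2 by blast
      show False using n that(5) 1 2 3 by blast
    qed
  qed
  then show ?case
  proof cases
    case empty
    then show ?thesis by (simp add: precision_form_def sum_nonneg)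
  next
    \<comment> \<open>A long edge has correlation at most \<open>\<rho> ^ L\<close>. Dropping it
      costs at most \<open>?c\<close>, because only its mixed term can be negative; this is the only
      case that consumes the error budget.\<close>
    case long
    have IH: "- (?c * real (card (E - {e}))) \<le> precision_form U (E - {e}) r f"
      by (rule less.hyps[of "E - {e}" U len r]) (use long card_E fU EU fE E sp in \<open>auto intro: sparse_subset\<close>)
    obtain a b where ab: "e = {a, b}" "a \<noteq> b" using E[OF long(1)] by (auto simp: card_2_iff)
    have "\<bar>r e\<bar> \<le> \<rho> ^ L" using E[OF long(1)] long(2) \<rho> by (simp add: power_decreasing)
    then have "2 * \<bar>r e\<bar> / (1 - (r e)\<^sup>2) \<le> 2 * \<rho> ^ L / (1 - \<rho>\<^sup>2)"
      using r1[OF long(1)] \<rho>2 by (intro frac_le) auto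
    moreover have "\<bar>f a * f b\<bar> \<le> A\<^sup>2"
      using f[of a] f[of b] unfolding abs_mult power2_eq_square by (intro mult_mono) (auto intro: order_trans[OF abs_ge_zero])
    ultimately have "2 * \<bar>r e\<bar> / (1 - (r e)\<^sup>2) * \<bar>f a * f b\<bar> \<le> ?c"
      using r1[OF long(1)] \<rho> \<rho>2 by (intro mult_mono) auto
    moreover have "2 * r e / (1 - (r e)\<^sup>2) * (f a * f b) \<le> 2 * \<bar>r e\<bar> / (1 - (r e)\<^sup>2) * \<bar>f a * f b\<bar>"
    proof -
      have "2 * r e / (1 - (r e)\<^sup>2) * (f a * f b) \<le> \<bar>2 * r e / (1 - (r e)\<^sup>2) * (f a * f b)\<bar>" by (rule abs_ge_self)
      also have "\<dots> = 2 * \<bar>r e\<bar> / (1 - (r e)\<^sup>2) * \<bar>f a * f b\<bar>" using r1[OF long(1)] by (simp add: abs_mult)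
      finally show ?thesis .
    qed
    moreover have "0 \<le> (r e)\<^sup>2 / (1 - (r e)\<^sup>2) * ((f a)\<^sup>2 + (f b)\<^sup>2)" using r1[OF long(1)] by simp
    ultimately have "- ?c \<le> edge_form r f e" using edge_form_pair[OF ab(2), of r f] unfolding ab(1)[symmetric] by linarith
    moreover have "precision_form U E r f = precision_form U (E - {e}) r f + edge_form r f e"
      unfolding precision_form_def using fE long(1) by (simp add: sum.remove)
    ultimately show ?thesis using IH unfolding card_E(2)[OF long(1)] distrib_left by linarith
  next
    case leaf
    obtain e where e: "{e \<in> E. x \<in> e} = {e}" using leaf(3) by (auto simp: card_1_singleton_iff)
    then have eE: "e \<in> E" "x \<in> e" by auto
    obtain p where p: "p \<noteq> x" "e = {x, p}" using pair[OF eE] by auto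
    have U': "\<Union>(E - {e}) \<subseteq> U - {x}" using EU e by auto
    have IH: "- (?c * real (card (E - {e}))) \<le> precision_form (U - {x}) (E - {e}) r f"
      by (rule less.hyps[of "E - {e}" "U - {x}" len r]) (use eE card_E fU U' fE E sp in \<open>auto intro: sparse_subset\<close>)
    have xU: "x \<in> U" using eE EU by auto
    have "precision_form U E r f = precision_form (U - {x}) (E - {e}) r f + ((f x)\<^sup>2 + edge_form r f e)"
      unfolding precision_form_def using fE eE xU fU by (simp add: sum.remove)
    moreover have "0 \<le> (f x)\<^sup>2 + edge_form r f e"
      using leaf_square[OF r1(2)[OF eE(1)], of "f x" "f p"] edge_form_pair[OF p(1)[symmetric], of r f] p by simp
    moreover have "?c * real (card (E - {e})) \<le> ?c * real (card E)"
      using card_E[OF eE(1)] c by (intro mult_left_mono) auto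
    ultimately show ?thesis using IH by linarith
  next
    case two
    obtain a b where ab: "a \<noteq> b" "a \<noteq> x" "b \<noteq> x" "{e \<in> E. x \<in> e} = {{x, a}, {x, b}}"
      using degree_two_neighbours[of E x] E two(2) by metis
    define e1 e2 e3 where "e1 = {x, a}" and "e2 = {x, b}" and "e3 = {a, b}"
    have e12: "e1 \<in> E" "e2 \<in> E" "e1 \<noteq> e2" using ab unfolding e1_def e2_def by (auto simp: doubleton_eq_iff)
    \<comment> \<open>The merged edge cannot duplicate an existing one: a triangle of three short
      edges has excess 1, but sparsity allows at most \<open>3 * L * \<kappa> < 1\<close>.\<close>
    have e3: "e3 \<notin> E"
    proof
      assume e3E: "e3 \<in> E"
      have ne: "e3 \<noteq> e1" "e3 \<noteq> e2" using ab unfolding e1_def e2_def e3_def by (auto simp: doubleton_eq_iff)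
      have "{e1, e2, e3} \<subseteq> E" "{e1, e2, e3} \<noteq> {}" using e12 e3E by auto
      then have "real (card {e1, e2, e3}) - real (card (\<Union>{e1, e2, e3})) + 1 \<le> \<kappa> * real (\<Sum>e\<in>{e1, e2, e3}. len e)"
        using sp unfolding sparse_def by blast
      moreover have "\<Union>{e1, e2, e3} = {x, a, b}" unfolding e1_def e2_def e3_def by auto
      moreover have "card {x, a, b} = 3" "card {e1, e2, e3} = 3" using ab ne e12 by auto
      ultimately have 1: "1 \<le> \<kappa> * (real (len e1) + real (len e2) + real (len e3))" using e12 ne by (simp add: add.assoc)
      have "real (len e1) + real (len e2) + real (len e3) \<le> 3 * real L"
        using two(1) e12 e3E by (smt (verit) of_nat_le_iff)
      then have "\<kappa> * (real (len e1) + real (len e2) + real (len e3)) \<le> \<kappa> * (3 * real L)" using \<kappa> by simp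
      then show False using 1 \<kappa>(2) by (simp add: mult_ac)
    qed
    define E' where "E' = insert e3 (E - {e1, e2})"
    define len' where "len' = len(e3 := len e1 + len e2)"
    define r' where "r' = r(e3 := r e1 * r e2)"
    have xout: "x \<notin> e" if "e \<in> E - {e1, e2}" for e using that ab(4) unfolding e1_def e2_def by blast
    have cE': "Suc (card E') = card E"
    proof -
      have "card E = card (E - {e1, e2}) + 2"
        using card_Diff_subset[of "{e1, e2}" E] e12 fE card_mono[of E "{e1, e2}"] by auto
      moreover have "card E' = Suc (card (E - {e1, e2}))" unfolding E'_def using e3 fE by simp
      ultimately show ?thesis by simp
    qed
    have U': "\<Union>E' \<subseteq> U - {x}"
    proof -
      have "\<Union>(E - {e1, e2}) \<subseteq> U - {x}" using EU xout by blast
      moreover have "e3 \<subseteq> U - {x}" using e12(1,2) EU ab(2,3) unfolding e1_def e2_def e3_def by blast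
      ultimately show ?thesis unfolding E'_def by blast
    qed
    \<comment> \<open>Undoing the merge adds one edge and the vertex \<open>x\<close> and leaves the
      total length unchanged, so both sides of the sparsity inequality agree.\<close>
    have sp': "sparse \<kappa> len' E'"
      unfolding sparse_def
    proof (intro allI impI)
      fix F assume F: "F \<subseteq> E'" "F \<noteq> {}"
      show "real (card F) - real (card (\<Union>F)) + 1 \<le> \<kappa> * real (\<Sum>e\<in>F. len' e)"
      proof (cases "e3 \<in> F")
        case False
        then have "F \<subseteq> E" using F unfolding E'_def by auto
        moreover have "(\<Sum>e\<in>F. len' e) = (\<Sum>e\<in>F. len e)" using False by (intro sum.cong) (auto simp: len'_def)
        ultimately show ?thesis using sp F unfolding sparse_def by simp
      next
        case True
        define F0 where "F0 = F - {e3}"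
        have F0: "F = insert e3 F0" "e3 \<notin> F0" "F0 \<subseteq> E - {e1, e2}" "finite F0"
          using True F fE unfolding F0_def E'_def by (auto intro: finite_subset)
        let ?F = "insert e1 (insert e2 F0)"
        have "?F \<subseteq> E" using F0 e12 by auto
        then have "real (card ?F) - real (card (\<Union>?F)) + 1 \<le> \<kappa> * real (\<Sum>e\<in>?F. len e)"
          using sp unfolding sparse_def by blast
        moreover have "card ?F = Suc (card F)"
        proof -
          have "e1 \<notin> insert e2 F0" "e2 \<notin> F0" using F0(3) e12(3) by auto
          then have "card ?F = Suc (Suc (card F0))" using F0(4) by simp
          moreover have "card F = Suc (card F0)" using F0(2,4) unfolding F0(1) by simp
          ultimately show ?thesis by simp
        qed
        moreover have "\<Union>?F = insert x (\<Union>F)" unfolding F0 e1_def e2_def e3_def by auto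
        moreover have "x \<notin> \<Union>F" using xout F0 ab unfolding e3_def by auto
        moreover have "finite (\<Union>F)" using F0 fin_e unfolding e3_def by auto
        moreover have "(\<Sum>e\<in>?F. len e) = (\<Sum>e\<in>F. len' e)"
        proof -
          have "(\<Sum>e\<in>F0. len' e) = (\<Sum>e\<in>F0. len e)" using F0 by (intro sum.cong) (auto simp: len'_def)
          moreover have "e1 \<notin> insert e2 F0" "e2 \<notin> F0" using F0(3) e12(3) by auto
          ultimately show ?thesis using F0 by (simp add: len'_def)
        qed
        ultimately show ?thesis by simp
      qed
    qed
    have IH: "- (?c * real (card E')) \<le> precision_form (U - {x}) E' r' f"
    proof (rule less.hyps[of E' "U - {x}" len' r'])
      fix e assume "e \<in> E'"
      then show "card e = 2 \<and> 1 \<le> len' e \<and> \<bar>r' e\<bar> = \<rho> ^ len' e"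
        using E[of e] E[OF e12(1)] E[OF e12(2)] e3 ab
        unfolding E'_def len'_def r'_def by (auto simp: e3_def abs_mult power_add)
    qed (use cE' fU U' sp' fE in \<open>auto simp: E'_def\<close>)
    have rest: "(\<Sum>e\<in>E - {e1, e2}. edge_form r' f e) = (\<Sum>e\<in>E - {e1, e2}. edge_form r f e)"
      using e3 by (intro sum.cong) (auto simp: edge_form_def r'_def)
    have xU: "x \<in> U" using e12 EU unfolding e1_def by auto
    have E2: "(\<Sum>e\<in>E. edge_form r f e) = edge_form r f e1 + edge_form r f e2 + (\<Sum>e\<in>E - {e1, e2}. edge_form r f e)"
      using fE e12 sum.subset_diff[of "{e1, e2}" E "edge_form r f"] by simp
    have "precision_form U E r f = (\<Sum>v\<in>U - {x}. (f v)\<^sup>2) + (\<Sum>e\<in>E - {e1, e2}. edge_form r f e) +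
        ((f x)\<^sup>2 + edge_form r f e1 + edge_form r f e2)"
      unfolding precision_form_def E2 using xU fU by (simp add: sum.remove)
    moreover have "precision_form (U - {x}) E' r' f = (\<Sum>v\<in>U - {x}. (f v)\<^sup>2) + (\<Sum>e\<in>E - {e1, e2}. edge_form r f e) + edge_form r' f e3"
      unfolding precision_form_def E'_def using e3 fE by (simp add: rest)
    moreover have "edge_form r' f e3 \<le> (f x)\<^sup>2 + edge_form r f e1 + edge_form r f e2"
    proof -
      have r3: "r' e3 = r e1 * r e2" by (simp add: r'_def)
      show ?thesis
        using series_reduction[OF r1(2)[OF e12(1)] r1(2)[OF e12(2)], of "f a" "f b" "f x"]
          edge_form_pair[OF ab(1), of r' f] edge_form_pair[OF ab(2)[symmetric], of r f] edge_form_pair[OF ab(3)[symmetric], of r f]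
        unfolding e1_def[symmetric] e2_def[symmetric] e3_def[symmetric] r3 by linarith
    qed
    moreover have "?c * real (card E') \<le> ?c * real (card E)"
      using cE' c by (intro mult_left_mono) auto
    ultimately show ?thesis using IH by linarith
  next
    \<comment> \<open>Minimum degree three gives at most two thirds as many vertices as edges, hence
      an excess above \<open>card E / 3\<close>; sparsity with lengths at most \<open>L\<close>
      allows less than that.\<close>
    case stuck
    have "3 * card (\<Union>E) \<le> (\<Sum>x\<in>\<Union>E. card {e \<in> E. x \<in> e})"
    proof -
      have "3 \<le> card {e \<in> E. x \<in> e}" if "x \<in> \<Union>E" for x using that stuck(3) by blast
      from sum_bounded_below[of "\<Union>E" 3, OF this] show ?thesis by (simp add: mult.commute)
    qed
    also have "\<dots> = 2 * card E" using handshake[OF fE] E by blast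
    finally have V: "3 * real (card (\<Union>E)) \<le> 2 * real (card E)" by linarith
    have "real (card E) - real (card (\<Union>E)) + 1 \<le> \<kappa> * real (\<Sum>e\<in>E. len e)"
      using sp stuck(1) unfolding sparse_def by blast
    also have "\<dots> \<le> \<kappa> * (real L * real (card E))"
    proof -
      have "(\<Sum>e\<in>E. len e) \<le> card E * L" using stuck(2) sum_bounded_above[of E len L] by simp
      then have "real (\<Sum>e\<in>E. len e) \<le> real L * real (card E)" by (metis of_nat_le_iff of_nat_mult mult.commute)
      then show ?thesis using \<kappa> by (intro mult_left_mono) auto
    qed
    also have "\<dots> = (3 * real L * \<kappa>) * real (card E) / 3" by simp
    also have "\<dots> \<le> 1 * real (card E) / 3" using \<kappa> by (intro divide_right_mono mult_right_mono) auto
    finally show ?thesis using V by linarith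
  qed
qed

section \<open>Walks without backtracking\<close>

text \<open>For a graph this means girth greater than \<open>n\<close>. The counting form is what
  sparsity delivers, and it is what a degree count contradicts.\<close>

definition forest_upto :: "nat \<Rightarrow> 'v set set \<Rightarrow> bool" where
  "forest_upto n E \<longleftrightarrow> (\<forall>F\<subseteq>E. F \<noteq> {} \<and> finite F \<and> card F \<le> n \<longrightarrow> card F < card (\<Union>F))"

fun nonback :: "'v list \<Rightarrow> bool" where
  "nonback (x # y # z # xs) = (x \<noteq> z \<and> nonback (y # z # xs))"
| "nonback _ = True"

definition nbwalk :: "'v set set \<Rightarrow> 'v list \<Rightarrow> bool" where
  "nbwalk E xs \<longleftrightarrow> xs \<noteq> [] \<and> successively (\<lambda>x y. {x, y} \<in> E) xs \<and> nonback xs"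

lemma nonback_nth: "nonback xs \<Longrightarrow> Suc (Suc i) < length xs \<Longrightarrow> xs ! i \<noteq> xs ! Suc (Suc i)"
proof (induction xs arbitrary: i rule: nonback.induct)
  case (1 x y z xs)
  then show ?case by (cases i) auto
qed auto

lemma nonback_append: "nonback (as @ [a, b] @ bs) \<longleftrightarrow> nonback (as @ [a, b]) \<and> nonback ([a, b] @ bs)"
proof (induction as rule: nonback.induct)
  case ("2_3" x y)
  then show ?case by (cases bs) auto
qed auto

lemma nonback_rev: "nonback (rev xs) = nonback xs"
proof (induction xs rule: nonback.induct)
  case (1 x y z xs)
  have "nonback (rev (x # y # z # xs)) = nonback (rev xs @ [z, y] @ [x])" by simp
  also have "\<dots> = (nonback (rev xs @ [z, y]) \<and> nonback ([z, y] @ [x]))" by (rule nonback_append)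
  finally show ?case using 1 by auto
qed auto

lemma nbwalk_Cons: "nbwalk E (x # y # xs) \<longleftrightarrow> {x, y} \<in> E \<and> (case xs of [] \<Rightarrow> True | z # _ \<Rightarrow> x \<noteq> z) \<and> nbwalk E (y # xs)"
  unfolding nbwalk_def by (cases xs) auto

lemma nbwalk_sing: "nbwalk E [x]" unfolding nbwalk_def by simp

lemma nbwalk_rev: "nbwalk E (rev xs) = nbwalk E xs"
  unfolding nbwalk_def by (simp add: nonback_rev successively_rev insert_commute)

text \<open>In the edge set of a closed walk without backtracking every vertex except the base point has degree at least two.\<close>

lemma nbwalk_not_closed:
  assumes E: "\<And>e. e \<in> E \<Longrightarrow> card e = 2" and fo: "forest_upto n E"
    and nb: "nbwalk E xs" and len: "2 \<le> length xs" "length xs \<le> Suc n"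
  shows "hd xs \<noteq> last xs"
proof
  assume closed: "hd xs = last xs"
  define m where "m = length xs - 1"
  have m: "length xs = Suc m" "1 \<le> m" "m \<le> n" using len unfolding m_def by auto
  define ed where "ed = (\<lambda>i. {xs ! i, xs ! Suc i})"
  have edE: "ed i \<in> E" if "i < m" for i
    using nb that m unfolding nbwalk_def successively_conv_nth ed_def by auto
  define F where "F = ed ` {..<m}"
  have F: "F \<subseteq> E" "F \<noteq> {}" "finite F" "card F \<le> n"
    using edE m card_image_le[of "{..<m}" ed] unfolding F_def by (auto simp: lessThan_empty_iff)
  then have less: "card F < card (\<Union>F)" using fo unfolding forest_upto_def by blast
  have VF: "\<Union>F = set xs"
  proof
    show "\<Union>F \<subseteq> set xs" unfolding F_def ed_def using m by auto
    show "set xs \<subseteq> \<Union>F"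
    proof
      fix x assume "x \<in> set xs"
      then obtain i where i: "i < Suc m" "x = xs ! i" using m by (metis in_set_conv_nth)
      then have "x \<in> ed i \<and> i < m \<or> x \<in> ed (i - 1) \<and> i - 1 < m" using m unfolding ed_def by (cases i) auto
      then show "x \<in> \<Union>F" unfolding F_def by auto
    qed
  qed
  have deg1: "1 \<le> card {e \<in> F. x \<in> e}" if "x \<in> \<Union>F" for x
  proof -
    have "{e \<in> F. x \<in> e} \<noteq> {}" using that by auto
    then show ?thesis using F(3) by (simp add: Suc_le_eq card_gt_0_iff)
  qed
  have deg2: "2 \<le> card {e \<in> F. x \<in> e}" if x: "x \<in> \<Union>F" "x \<noteq> hd xs" for x
  proof -
    obtain i where i: "i < Suc m" "x = xs ! i" using x VF m by (metis in_set_conv_nth)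
    have "i \<noteq> 0" using i x(2) m by (metis hd_conv_nth length_0_conv nat.distinct(1))
    moreover have "i \<noteq> m" using i x(2) m closed by (metis diff_Suc_1 last_conv_nth length_0_conv nat.distinct(1))
    ultimately obtain j where j: "i = Suc j" "Suc j < m" using i by (metis less_SucE not0_implies_Suc)
    have ne: "xs ! j \<noteq> xs ! Suc (Suc j)" using nb j m nonback_nth unfolding nbwalk_def by fastforce
    have "card (ed j) = 2" "card (ed (Suc j)) = 2" using E edE j by auto
    then have "ed j \<noteq> ed (Suc j)" using ne unfolding ed_def by (auto simp: doubleton_eq_iff card_2_iff)
    moreover have "{ed j, ed (Suc j)} \<subseteq> {e \<in> F. x \<in> e}"
      using j i unfolding F_def by (auto simp: ed_def)
    ultimately show ?thesis using card_mono[of "{e \<in> F. x \<in> e}" "{ed j, ed (Suc j)}"] F(3) by simp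
  qed
  have h: "hd xs \<in> \<Union>F" unfolding VF using m by (metis hd_in_set length_0_conv nat.distinct(1))
  have fU: "finite (\<Union>F)" unfolding VF by simp
  \<comment> \<open>All vertices but the base point have degree at least two, and the base point at
    least one. With the handshake identity this gives at least as many edges as vertices, against
    \<open>forest_upto\<close>.\<close>
  have "2 * card (\<Union>F) \<le> (\<Sum>x\<in>\<Union>F. card {e \<in> F. x \<in> e}) + 1"
  proof -
    have "(\<Sum>x\<in>\<Union>F. card {e \<in> F. x \<in> e}) = card {e \<in> F. hd xs \<in> e} + (\<Sum>x\<in>\<Union>F - {hd xs}. card {e \<in> F. x \<in> e})"
      by (rule sum.remove[OF fU h])
    moreover have "2 * card (\<Union>F - {hd xs}) \<le> (\<Sum>x\<in>\<Union>F - {hd xs}. card {e \<in> F. x \<in> e})"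
      using sum_bounded_below[of "\<Union>F - {hd xs}" 2 "\<lambda>x. card {e \<in> F. x \<in> e}"] deg2 by (simp add: mult.commute)
    moreover have "card (\<Union>F) = Suc (card (\<Union>F - {hd xs}))" using card.remove[OF fU h] .
    ultimately show ?thesis using deg1[OF h] by linarith
  qed
  also have "(\<Sum>x\<in>\<Union>F. card {e \<in> F. x \<in> e}) = 2 * card F"
    by (rule handshake) (use F E in auto)
  finally show False using less by linarith
qed

text \<open>Common initial steps are stripped. Where two walks part, the reversal of one followed by
  the other is a closed walk without backtracking. Their start is shared, so the joined walk has at
  most \<open>n + 1\<close> vertices and \<open>nbwalk_not_closed\<close> applies.\<close>

lemma nbwalk_unique:
  assumes E: "\<And>e. e \<in> E \<Longrightarrow> card e = 2" and fo: "forest_upto n E"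
    and "nbwalk E xs" "nbwalk E ys" "hd xs = hd ys" "last xs = last ys" "length xs + length ys \<le> n + 2"
  shows "xs = ys"
  using assms(3-7)
proof (induction xs arbitrary: ys)
  case Nil
  then show ?case by (simp add: nbwalk_def)
next
  case (Cons x xs ys)
  have nc: "hd zs \<noteq> last zs" if "nbwalk E zs" "2 \<le> length zs" "length zs \<le> Suc n" for zs
    using nbwalk_not_closed[of E n zs] E fo that by blast
  obtain ys' where ys: "ys = x # ys'" using Cons.prems by (cases ys) (auto simp: nbwalk_def)
  show ?case
  proof (cases xs)
    case Nil
    then have "last ys = hd ys" using Cons.prems ys by simp
    moreover have "hd ys \<noteq> last ys" if "2 \<le> length ys"
      by (rule nc[OF Cons.prems(2) that]) (use Cons.prems Nil in simp)
    ultimately have "ys' = []" unfolding ys by (cases ys') auto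
    then show ?thesis using Nil ys by simp
  next
    case xs: (Cons x' xs')
    show ?thesis
    proof (cases ys')
      case Nil
      then have "last (x # xs) = hd (x # xs)" using Cons.prems ys by simp
      moreover have "hd (x # xs) \<noteq> last (x # xs)"
        by (rule nc[OF Cons.prems(1)]) (use Cons.prems Nil xs ys in auto)
      ultimately show ?thesis by simp
    next
      case ys': (Cons y' ys'')
      have nx: "nbwalk E xs" "nbwalk E ys'" using Cons.prems unfolding ys ys' xs by (auto simp: nbwalk_Cons)
      show ?thesis
      proof (cases "x' = y'")
        case True
        have "xs = ys'" by (rule Cons.IH) (use Cons.prems nx True in \<open>auto simp: ys ys' xs\<close>)
        then show ?thesis using ys by simp
      next
        case False
        \<comment> \<open>The turn at \<open>x\<close> goes from \<open>x'\<close> to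
          \<open>y'\<close>; it does not backtrack precisely because the two walks differ
          there.\<close>
        define zs where "zs = rev xs' @ [x', x] @ ys'"
        have r: "rev (x # xs) = rev xs' @ [x', x]" using xs by simp
        have rx: "nbwalk E (rev xs' @ [x', x])" using Cons.prems(1) nbwalk_rev[of E "x # xs"] unfolding r by simp
        have "nonback zs"
          unfolding zs_def nonback_append using rx Cons.prems(2) False unfolding ys ys' nbwalk_def by auto
        moreover have "successively (\<lambda>x y. {x, y} \<in> E) zs"
          using rx Cons.prems(2) unfolding zs_def ys ys' nbwalk_def
          by (auto simp: successively_append_iff successively_Cons)
        ultimately have "nbwalk E zs" unfolding nbwalk_def by (simp add: zs_def)
        then have "hd zs \<noteq> last zs"
          by (rule nc) (use Cons.prems in \<open>auto simp: zs_def ys ys' xs\<close>)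
        moreover have "hd zs = last zs"
        proof -
          have "zs = rev (x # xs) @ ys'" unfolding r zs_def by simp
          then have "hd zs = hd (rev (x # xs))" by (simp add: hd_append)
          then have "hd zs = last (x # xs)" unfolding hd_rev .
          moreover have "last zs = last ys" unfolding zs_def ys ys' by simp
          ultimately show ?thesis using Cons.prems(4) by (simp only:)
        qed
        ultimately show ?thesis by simp
      qed
    qed
  qed
qed

section \<open>The truncated tree kernel and its approximate inverse\<close>

definition walks :: "'v set set \<Rightarrow> nat \<Rightarrow> 'v \<Rightarrow> 'v \<Rightarrow> 'v list set" where
  "walks E L u v = {xs. nbwalk E xs \<and> hd xs = u \<and> last xs = v \<and> length xs \<le> Suc L}"

fun walk_weight :: "real \<Rightarrow> ('v set \<Rightarrow> real) \<Rightarrow> 'v list \<Rightarrow> real" where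
  "walk_weight \<rho> s (x # y # xs) = \<rho> * s {x, y} * walk_weight \<rho> s (y # xs)"
| "walk_weight \<rho> s _ = 1"

text \<open>A sum only in form: at the girth assumed in \<open>nbgraph\<close> it has at most one
  term, and the kernel is the correlation of a tree-indexed Markov field, cut off beyond
  \<open>L\<close> edges.\<close>

definition wkernel :: "'v set set \<Rightarrow> nat \<Rightarrow> real \<Rightarrow> ('v set \<Rightarrow> real) \<Rightarrow> 'v \<Rightarrow> 'v \<Rightarrow> real" where
  "wkernel E L \<rho> s u v = (\<Sum>xs\<in>walks E L u v. walk_weight \<rho> s xs)"

lemma walk_weight_snoc: "walk_weight \<rho> s (xs @ [x, y]) = walk_weight \<rho> s (xs @ [x]) * (\<rho> * s {x, y})"
proof (induction xs)
  case (Cons a xs)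
  then show ?case by (cases xs) auto
qed simp

lemma walk_weight_rev: "walk_weight \<rho> s (rev xs) = walk_weight \<rho> s xs"
proof (induction \<rho> s xs rule: walk_weight.induct)
  case (1 \<rho> s x y xs)
  then show ?case using walk_weight_snoc[of \<rho> s "rev xs" y x] by (simp add: insert_commute)
qed auto

lemma wkernel_sym: "wkernel E L \<rho> s u v = wkernel E L \<rho> s v u"
  unfolding wkernel_def
  by (rule sum.reindex_bij_witness[of _ rev rev])
     (auto simp: walks_def nbwalk_rev walk_weight_rev hd_rev last_rev)

lemma walk_weight_abs:
  assumes "\<And>e. \<bar>s e\<bar> = 1" "0 \<le> \<rho>"
  shows "\<bar>walk_weight \<rho> s xs\<bar> = \<rho> ^ (length xs - 1)"
  using assms by (induction \<rho> s xs rule: walk_weight.induct) (auto simp: abs_mult)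

text \<open>The girth exceeds \<open>2 * L + 1\<close> because \<open>local_equation\<close>
  compares a walk of at most \<open>L\<close> edges with one that has been prolonged by an edge;
  together they have up to \<open>2 * L + 3\<close> vertices.\<close>

locale nbgraph =
  fixes E :: "'v set set" and L :: nat and \<rho> :: real and s :: "'v set \<Rightarrow> real"
  assumes E2: "\<And>e. e \<in> E \<Longrightarrow> card e = 2" and fo: "forest_upto (2 * L + 1) E"
    and L: "1 \<le> L" and \<rho>: "0 < \<rho>" "\<rho> < 1" and s: "\<And>e. s e = 1 \<or> s e = -1"
begin

abbreviation "K \<equiv> wkernel E L \<rho> s"

lemma uniq: "nbwalk E xs \<Longrightarrow> nbwalk E ys \<Longrightarrow> hd xs = hd ys \<Longrightarrow> last xs = last ys \<Longrightarrow>
    length xs + length ys \<le> 2 * L + 3 \<Longrightarrow> xs = ys"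
  by (rule nbwalk_unique[where n = "2 * L + 1" and E = E]) (use E2 fo in auto)

lemma walk_eq: "xs \<in> walks E L u v \<Longrightarrow> walks E L u v = {xs}"
  using uniq[of _ xs] unfolding walks_def by fastforce

lemma K_walk: "xs \<in> walks E L u v \<Longrightarrow> K u v = walk_weight \<rho> s xs"
  unfolding wkernel_def by (simp add: walk_eq)

lemma K_none: "walks E L u v = {} \<Longrightarrow> K u v = 0"
  unfolding wkernel_def by simp

lemma s_abs: "\<bar>s e\<bar> = 1" using s[of e] by auto
lemma wabs: "\<bar>walk_weight \<rho> s xs\<bar> = \<rho> ^ (length xs - 1)"
  using \<rho> s_abs by (intro walk_weight_abs) auto
lemma s_sq: "s e * s e = 1" using s[of e] by auto

lemma K_abs: "\<bar>K u v\<bar> \<le> 1"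
proof (cases "walks E L u v = {}")
  case False
  then obtain xs where "xs \<in> walks E L u v" by auto
  then show ?thesis using wabs[of xs] \<rho> by (simp add: K_walk power_le_one)
qed (simp add: K_none)

lemma K_refl: "K u u = 1"
proof -
  have "[u] \<in> walks E L u u" unfolding walks_def by (simp add: nbwalk_sing)
  from K_walk[OF this] show ?thesis by simp
qed

lemma K_edge: "{u, v} \<in> E \<Longrightarrow> K u v = \<rho> * s {u, v}"
proof -
  assume "{u, v} \<in> E"
  then have "[u, v] \<in> walks E L u v" unfolding walks_def using L by (simp add: nbwalk_Cons nbwalk_sing)
  from K_walk[OF this] show ?thesis by simp
qed

definition nbr :: "'v \<Rightarrow> 'v set" where "nbr w = {x. {w, x} \<in> E}"

text \<open>Row \<open>w\<close> of the tree precision matrix, scaled by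
  \<open>1 - \<rho>\<^sup>2\<close>, applied to the kernel is nearly a row of the scaled identity.
  The equation is exact when \<open>w = v\<close> or when the walk from \<open>w\<close> to
  \<open>v\<close> has fewer than \<open>L\<close> edges; an error arises only at the cutoff, where
  all entries involved are of order \<open>\<rho> ^ L\<close>.\<close>

lemma local_equation:
  assumes fin: "finite (nbr w)"
  shows "\<bar>(1 - \<rho>\<^sup>2) * K w v + \<rho>\<^sup>2 * card (nbr w) * K w v - \<rho> * (\<Sum>x\<in>nbr w. s {w, x} * K x v)
     - (1 - \<rho>\<^sup>2) * of_bool (w = v)\<bar> \<le> card (nbr w) * \<rho> ^ L"
proof -
  have rl: "\<rho> ^ n \<le> \<rho> ^ L" if "L \<le> n" for n using that \<rho> by (simp add: power_decreasing)
  consider (eq) "w = v" | (none) "w \<noteq> v" "walks E L w v = {}"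
    | (walk) xs where "w \<noteq> v" "xs \<in> walks E L w v" by blast
  then show ?thesis
  proof cases
    case eq
    have "(\<Sum>x\<in>nbr w. s {w, x} * K x v) = (\<Sum>x\<in>nbr w. \<rho>)"
    proof (rule sum.cong[OF refl])
      fix x assume "x \<in> nbr w"
      then have "{x, w} \<in> E" "{w, x} = {x, w}" unfolding nbr_def by (auto simp: insert_commute)
      then show "s {w, x} * K x v = \<rho>" unfolding eq[symmetric] using K_edge[of x w] s_sq[of "{x, w}"]
        by (simp add: mult.left_commute)
    qed
    then show ?thesis using \<rho> K_refl by (simp add: eq power2_eq_square)
  next
    case none
    have b: "\<bar>s {w, x} * K x v\<bar> \<le> \<rho> ^ L" if x: "x \<in> nbr w" for x
    proof (cases "walks E L x v = {}")
      case True
      then show ?thesis using \<rho> by (simp add: K_none)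
    next
      case False
      then obtain ys where ys: "ys \<in> walks E L x v" by auto
      \<comment> \<open>A shorter walk from the neighbour \<open>x\<close> would yield one from
        \<open>w\<close>: drop \<open>x\<close> if the walk continues to \<open>w\<close>, prepend
        \<open>w\<close> otherwise.\<close>
      have "length ys = Suc L"
      proof (rule ccontr)
        assume "length ys \<noteq> Suc L"
        then have len: "length ys \<le> L" using ys by (simp add: walks_def)
        obtain ys' where y: "ys = x # ys'" using ys by (cases ys) (auto simp: walks_def nbwalk_def)
        show False
        proof (cases "\<exists>r. ys' = w # r")
          case True
          then obtain r where "ys = x # w # r" using y by auto
          then have "w # r \<in> walks E L w v" using ys by (auto simp: walks_def nbwalk_Cons)
          then show False using none by simp
        next
          case False
          then have "w # ys \<in> walks E L w v"
            using ys x len unfolding y walks_def nbr_def by (auto simp: nbwalk_Cons split: list.splits)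
          then show False using none by simp
        qed
      qed
      then show ?thesis using K_walk[OF ys] wabs[of ys] s_abs \<rho> by (simp add: abs_mult)
    qed
    have "\<bar>\<rho> * (\<Sum>x\<in>nbr w. s {w, x} * K x v)\<bar> = \<rho> * \<bar>\<Sum>x\<in>nbr w. s {w, x} * K x v\<bar>"
      using \<rho> by (simp add: abs_mult)
    also have "\<dots> \<le> 1 * (\<Sum>x\<in>nbr w. \<bar>s {w, x} * K x v\<bar>)"
      using \<rho> by (intro mult_mono sum_abs) (auto intro: sum_nonneg)
    also have "\<dots> \<le> card (nbr w) * \<rho> ^ L" using sum_bounded_above[OF b] by simp
    finally show ?thesis using none by (simp add: K_none)
  next
    case walk
    obtain w1 r where xs: "xs = w # w1 # r"
      using walk unfolding walks_def nbwalk_def by (cases xs; cases "tl xs") auto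
    define \<kappa>0 where "\<kappa>0 = K w v"
    have k0: "\<kappa>0 = walk_weight \<rho> s xs" unfolding \<kappa>0_def by (rule K_walk[OF walk(2)])
    have w1: "w1 \<in> nbr w" using walk unfolding xs walks_def nbr_def by (simp add: nbwalk_Cons)
    have "w1 # r \<in> walks E L w1 v" using walk unfolding xs walks_def by (auto simp: nbwalk_Cons)
    then have K1: "\<rho> * (s {w, w1} * K w1 v) = \<kappa>0" unfolding k0 xs using K_walk by simp
    have oth: "nbwalk E (x # xs)" "hd (x # xs) = x" "last (x # xs) = v" "x # xs \<noteq> []" if "x \<in> nbr w - {w1}" for x
      using that walk unfolding xs walks_def nbr_def by (auto simp: nbwalk_Cons insert_commute)
    show ?thesis
    proof (cases "length xs \<le> L")
      case True
      \<comment> \<open>Away from the cutoff every neighbour other than \<open>w1\<close> reaches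
        \<open>v\<close> through \<open>w\<close>, with one more factor \<rho>; these contributions
        cancel the degree term, and \<open>w1\<close> cancels the rest.\<close>
      have "\<rho> * (s {w, x} * K x v) = \<rho>\<^sup>2 * \<kappa>0" if x: "x \<in> nbr w - {w1}" for x
      proof -
        have "x # xs \<in> walks E L x v" using oth[OF x] True unfolding walks_def by simp
        then have "K x v = \<rho> * s {x, w} * \<kappa>0" using K_walk unfolding k0 xs by simp
        then show ?thesis using s_sq[of "{x, w}"] by (simp add: insert_commute power2_eq_square mult_ac)
      qed
      then have "(\<Sum>x\<in>nbr w - {w1}. \<rho> * (s {w, x} * K x v)) = (real (card (nbr w)) - 1) * (\<rho>\<^sup>2 * \<kappa>0)"
        using w1 fin card.remove[OF fin w1] by simp
      then have "\<rho> * (\<Sum>x\<in>nbr w. s {w, x} * K x v) = \<kappa>0 + (real (card (nbr w)) - 1) * (\<rho>\<^sup>2 * \<kappa>0)"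
        unfolding sum.remove[OF fin w1] distrib_left K1 by (simp add: sum_distrib_left)
      then have "(1 - \<rho>\<^sup>2) * K w v + \<rho>\<^sup>2 * card (nbr w) * K w v - \<rho> * (\<Sum>x\<in>nbr w. s {w, x} * K x v)
         - (1 - \<rho>\<^sup>2) * of_bool (w = v) = 0"
        using walk(1) unfolding \<kappa>0_def[symmetric] by (simp add: algebra_simps)
      then show ?thesis using \<rho> by simp
    next
      case False
      then have len: "length xs = Suc L" using walk by (simp add: walks_def)
      have ka: "\<bar>\<kappa>0\<bar> = \<rho> ^ L" unfolding k0 using wabs[of xs] \<rho> len by simp
      \<comment> \<open>At the cutoff the only candidate for a walk from \<open>x\<close> to
        \<open>v\<close> is \<open>x # xs\<close>, which is one edge too long, so the truncated
        kernel vanishes there.\<close>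
      have z: "K x v = 0" if x: "x \<in> nbr w - {w1}" for x
      proof (rule K_none, rule ccontr)
        assume "walks E L x v \<noteq> {}"
        then obtain ys where ys: "ys \<in> walks E L x v" by auto
        have "x # xs = ys"
          by (rule uniq) (use ys oth[OF x] len in \<open>auto simp: walks_def\<close>)
        then show False using ys len by (auto simp: walks_def)
      qed
      then have "(\<Sum>x\<in>nbr w - {w1}. s {w, x} * K x v) = 0" by (intro sum.neutral) auto
      then have "\<rho> * (\<Sum>x\<in>nbr w. s {w, x} * K x v) = \<kappa>0"
        unfolding sum.remove[OF fin w1] distrib_left K1 by simp
      then have "(1 - \<rho>\<^sup>2) * K w v + \<rho>\<^sup>2 * card (nbr w) * K w v - \<rho> * (\<Sum>x\<in>nbr w. s {w, x} * K x v)
         - (1 - \<rho>\<^sup>2) * of_bool (w = v) = \<rho>\<^sup>2 * (real (card (nbr w)) - 1) * \<kappa>0"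
        using walk(1) unfolding \<kappa>0_def[symmetric] by (simp add: algebra_simps)
      also have "\<bar>\<dots>\<bar> = \<rho>\<^sup>2 * \<bar>real (card (nbr w)) - 1\<bar> * \<rho> ^ L" by (simp add: abs_mult ka)
      also have "\<dots> \<le> 1 * real (card (nbr w)) * \<rho> ^ L"
      proof -
        have "1 \<le> card (nbr w)" using w1 fin by (metis One_nat_def Suc_leI card_gt_0_iff empty_iff)
        then have "\<bar>real (card (nbr w)) - 1\<bar> \<le> real (card (nbr w))" by simp
        moreover have "\<rho>\<^sup>2 \<le> 1" using \<rho> by (simp add: power_le_one)
        ultimately show ?thesis using \<rho> by (intro mult_mono) auto
      qed
      finally show ?thesis by simp
    qed
  qed
qed

end

section \<open>Positive semidefiniteness of the local kernel\<close>

lemma abs_weighted_sum_le: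
  fixes f e :: "'a \<Rightarrow> real"
  assumes "\<And>v. \<bar>e v\<bar> \<le> b"
  shows "\<bar>\<Sum>v\<in>S. f v * e v\<bar> \<le> (\<Sum>v\<in>S. \<bar>f v\<bar>) * b"
proof -
  have "\<bar>\<Sum>v\<in>S. f v * e v\<bar> \<le> (\<Sum>v\<in>S. \<bar>f v * e v\<bar>)" by (rule sum_abs)
  also have "\<dots> \<le> (\<Sum>v\<in>S. \<bar>f v\<bar> * b)"
    by (intro sum_mono) (simp add: abs_mult assms mult_left_mono)
  finally show ?thesis by (simp add: sum_distrib_right)
qed

context nbgraph
begin

lemma sum_nbr:
  fixes h :: "'v \<Rightarrow> 'v \<Rightarrow> real"
  assumes E: "finite E" and U: "finite U" "\<Union>E \<subseteq> U"
    and H: "\<And>a b. {a, b} \<in> E \<Longrightarrow> a \<noteq> b \<Longrightarrow> H {a, b} = h a b + h b a"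
  shows "(\<Sum>w\<in>U. \<Sum>x\<in>nbr w. h w x) = (\<Sum>e\<in>E. H e)"
proof -
  have nU: "nbr w \<subseteq> U" for w using U unfolding nbr_def by auto
  then have fn: "finite (nbr w)" for w using U finite_subset by blast
  let ?P = "Sigma U nbr" and ?g = "\<lambda>p. {fst p, snd p}"
  have "(\<Sum>w\<in>U. \<Sum>x\<in>nbr w. h w x) = (\<Sum>p\<in>?P. h (fst p) (snd p))"
    using U fn by (simp add: sum.Sigma case_prod_unfold)
  also have "\<dots> = (\<Sum>e\<in>E. \<Sum>p\<in>{p \<in> ?P. ?g p = e}. h (fst p) (snd p))"
    using U fn E by (intro sum.group[symmetric]) (auto simp: nbr_def)
  also have "\<dots> = (\<Sum>e\<in>E. H e)"
  proof (rule sum.cong[OF refl])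
    fix e assume e: "e \<in> E"
    then obtain a b where ab: "e = {a, b}" "a \<noteq> b" using E2[OF e] by (auto simp: card_2_iff)
    have "{p \<in> ?P. ?g p = e} = {(a, b), (b, a)}"
    proof -
      have "{b, a} = {a, b}" by blast
      then have "a \<in> U" "b \<in> U" "b \<in> nbr a" "a \<in> nbr b" using e U(2) unfolding nbr_def ab by auto
      then show ?thesis unfolding ab(1) doubleton_eq_iff by auto
    qed
    then show "(\<Sum>p\<in>{p \<in> ?P. ?g p = e}. h (fst p) (snd p)) = H e"
      using ab H[of a b] e by simp
  qed
  finally show ?thesis .
qed

text \<open>If \<open>P\<close> is the precision matrix and \<open>g = K f\<close>, then the form of
  \<open>P\<close> at \<open>g\<close> nearly equals the form of \<open>K\<close> at
  \<open>f\<close>, since \<open>P\<close> nearly inverts \<open>K\<close>. So the lower bound for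
  the precision form carries over to the kernel. The factor 4 collects two equal errors: deleted
  long edges and the defect of the inversion.\<close>

lemma kernel_lower_bound:
  assumes E: "finite E" and sp: "sparse \<kappa> (\<lambda>_. 1) E" and \<kappa>: "0 < \<kappa>" "3 * real L * \<kappa> < 1" and S: "finite S"
  shows "- (4 * \<rho> ^ L / (1 - \<rho>\<^sup>2) * real (card E) * (\<Sum>v\<in>S. \<bar>f v\<bar>)\<^sup>2) \<le> qf S K f"
proof -
  define A where "A = (\<Sum>v\<in>S. \<bar>f v\<bar>)"
  define U where "U = S \<union> \<Union>E"
  define g where "g = (\<lambda>w. \<Sum>v\<in>S. f v * K w v)"
  define D where "D = 1 - \<rho>\<^sup>2"
  have D: "0 < D" using \<rho> by (simp add: D_def abs_square_less_1)
  have fE: "finite e" if "e \<in> E" for e using E2[OF that] by (intro card_ge_0_finite) simp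
  have U: "finite U" "\<Union>E \<subseteq> U" "S \<subseteq> U" unfolding U_def using S E fE by auto
  have nU: "nbr w \<subseteq> U" for w using U unfolding nbr_def by auto
  then have fn: "finite (nbr w)" for w using U finite_subset by blast
  have A0: "0 \<le> A" unfolding A_def by (simp add: sum_nonneg)
  have gA: "\<bar>g w\<bar> \<le> A" for w
  proof -
    have "\<bar>g w\<bar> \<le> (\<Sum>v\<in>S. \<bar>f v\<bar> * \<bar>K w v\<bar>)" unfolding g_def abs_mult[symmetric] by (rule sum_abs)
    also have "\<dots> \<le> (\<Sum>v\<in>S. \<bar>f v\<bar> * 1)" by (intro sum_mono mult_left_mono K_abs) auto
    finally show ?thesis by (simp add: A_def)
  qed
  let ?r = "\<lambda>e. \<rho> * s e"
  have q: "- (2 * \<rho> ^ L / D * A\<^sup>2 * real (card E)) \<le> precision_form U E ?r g"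
    unfolding D_def
    by (rule precision_form_lower_bound[where len = "\<lambda>_. 1" and \<kappa> = \<kappa>])
       (use \<rho> \<kappa> U E sp gA s_abs E2 in \<open>auto simp: abs_mult\<close>)
  have rr: "(\<rho> * s e)\<^sup>2 = \<rho>\<^sup>2" for e using s_sq[of e] by (simp add: power2_eq_square mult_ac)
  have et: "edge_form ?r g {a, b} = (\<rho>\<^sup>2 / D * (g a)\<^sup>2 - \<rho> / D * s {a, b} * g a * g b) + (\<rho>\<^sup>2 / D * (g b)\<^sup>2 - \<rho> / D * s {b, a} * g b * g a)"
    if "a \<noteq> b" for a b
    unfolding edge_form_pair[OF that] rr D_def[symmetric] by (simp add: insert_commute add_divide_distrib algebra_simps)
  \<comment> \<open>The defect in \<open>(1 - \<rho>\<^sup>2) P K f = (1 - \<rho>\<^sup>2) f\<close>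
    at \<open>w\<close>, where \<open>f\<close> is extended by 0 outside \<open>S\<close>.\<close>
  define err where "err = (\<lambda>w. D * g w + \<rho>\<^sup>2 * card (nbr w) * g w - \<rho> * (\<Sum>x\<in>nbr w. s {w, x} * g x) - D * (if w \<in> S then f w else 0))"
  have errb: "\<bar>err w\<bar> \<le> card (nbr w) * \<rho> ^ L * A" for w
  proof -
    let ?e = "\<lambda>v. D * K w v + \<rho>\<^sup>2 * card (nbr w) * K w v - \<rho> * (\<Sum>x\<in>nbr w. s {w, x} * K x v) - D * of_bool (w = v)"
    have 1: "(\<Sum>x\<in>nbr w. s {w, x} * g x) = (\<Sum>v\<in>S. f v * (\<Sum>x\<in>nbr w. s {w, x} * K x v))"
      unfolding g_def sum_distrib_left by (subst sum.swap) (simp add: mult_ac)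
    have 2: "(if w \<in> S then f w else 0) = (\<Sum>v\<in>S. f v * of_bool (w = v))"
      using S by (simp add: of_bool_def if_distrib cong: if_cong)
    have "err w = (\<Sum>v\<in>S. f v * ?e v)"
    proof -
      have c: "c * (\<Sum>v\<in>S. f v * h v) = (\<Sum>v\<in>S. f v * (c * h v))" for c and h :: "'v \<Rightarrow> real"
        unfolding sum_distrib_left by (simp only: mult.left_commute)
      have "(\<Sum>v\<in>S. f v * ?e v) = (\<Sum>v\<in>S. f v * (D * K w v)) + (\<Sum>v\<in>S. f v * (\<rho>\<^sup>2 * card (nbr w) * K w v)) -
          (\<Sum>v\<in>S. f v * (\<rho> * (\<Sum>x\<in>nbr w. s {w, x} * K x v))) - (\<Sum>v\<in>S. f v * (D * of_bool (w = v)))"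
        by (simp only: right_diff_distrib distrib_left sum.distrib sum_subtractf)
      also have "\<dots> = err w"
        unfolding err_def 1 2 unfolding g_def c[symmetric] ..
      finally show ?thesis ..
    qed
    have "\<bar>err w\<bar> \<le> A * (card (nbr w) * \<rho> ^ L)"
      unfolding \<open>err w = _\<close> A_def
    proof (rule abs_weighted_sum_le)
      fix v show "\<bar>?e v\<bar> \<le> card (nbr w) * \<rho> ^ L" unfolding D_def by (rule local_equation[OF fn])
    qed
    then show ?thesis unfolding mult.commute[of A] .
  qed
  have "D * precision_form U E ?r g = D * (\<Sum>w\<in>U. (g w)\<^sup>2) + D * (\<Sum>w\<in>U. \<Sum>x\<in>nbr w. \<rho>\<^sup>2 / D * (g w)\<^sup>2 - \<rho> / D * s {w, x} * g w * g x)"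
  proof -
    have "(\<Sum>w\<in>U. \<Sum>x\<in>nbr w. \<rho>\<^sup>2 / D * (g w)\<^sup>2 - \<rho> / D * s {w, x} * g w * g x) = (\<Sum>e\<in>E. edge_form ?r g e)"
    proof (rule sum_nbr[OF E U(1,2), where H = "edge_form ?r g"])
      fix a b :: 'v assume "a \<noteq> b"
      then show "edge_form ?r g {a, b} = (\<rho>\<^sup>2 / D * (g a)\<^sup>2 - \<rho> / D * s {a, b} * g a * g b) + (\<rho>\<^sup>2 / D * (g b)\<^sup>2 - \<rho> / D * s {b, a} * g b * g a)"
        by (rule et)
    qed
    then show ?thesis unfolding precision_form_def distrib_left by (simp only:)
  qed
  also have "\<dots> = (\<Sum>w\<in>U. g w * (D * g w + \<rho>\<^sup>2 * card (nbr w) * g w - \<rho> * (\<Sum>x\<in>nbr w. s {w, x} * g x)))"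
    unfolding sum_distrib_left[of D _ U] sum.distrib[symmetric]
  proof (rule sum.cong[OF refl])
    fix w
    have "D * (\<Sum>x\<in>nbr w. \<rho>\<^sup>2 / D * (g w)\<^sup>2 - \<rho> / D * s {w, x} * g w * g x) =
        (\<Sum>x\<in>nbr w. \<rho>\<^sup>2 * (g w)\<^sup>2 - \<rho> * g w * (s {w, x} * g x))"
      unfolding sum_distrib_left using D by (intro sum.cong refl) (simp add: right_diff_distrib)
    also have "\<dots> = card (nbr w) * (\<rho>\<^sup>2 * (g w)\<^sup>2) - \<rho> * g w * (\<Sum>x\<in>nbr w. s {w, x} * g x)"
      by (simp add: sum_subtractf sum_distrib_left)
    finally show "D * (g w)\<^sup>2 + D * (\<Sum>x\<in>nbr w. \<rho>\<^sup>2 / D * (g w)\<^sup>2 - \<rho> / D * s {w, x} * g w * g x) =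
        g w * (D * g w + \<rho>\<^sup>2 * card (nbr w) * g w - \<rho> * (\<Sum>x\<in>nbr w. s {w, x} * g x))"
      by (simp only:) (simp add: power2_eq_square distrib_left right_diff_distrib mult_ac)
  qed
  also have "\<dots> = (\<Sum>w\<in>U. g w * err w) + (\<Sum>w\<in>U. g w * (D * (if w \<in> S then f w else 0)))"
    unfolding sum.distrib[symmetric] by (intro sum.cong refl) (simp add: err_def algebra_simps)
  also have "(\<Sum>w\<in>U. g w * (D * (if w \<in> S then f w else 0))) = D * qf S K f"
  proof -
    have "(\<Sum>w\<in>U. g w * (D * (if w \<in> S then f w else 0))) = (\<Sum>w\<in>S. g w * (D * f w))"
      using U S by (intro sum.mono_neutral_cong_right) auto
    also have "\<dots> = D * qf S K f"
      unfolding qf_def g_def sum_distrib_left sum_distrib_right by (intro sum.cong refl) (simp add: mult_ac)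
    finally show ?thesis .
  qed
  finally have main: "D * qf S K f = D * precision_form U E ?r g - (\<Sum>w\<in>U. g w * err w)" by linarith
  have "(\<Sum>w\<in>U. g w * err w) \<le> (\<Sum>w\<in>U. A * (card (nbr w) * \<rho> ^ L * A))"
  proof (rule sum_mono)
    fix w
    have "g w * err w \<le> \<bar>g w\<bar> * \<bar>err w\<bar>" by (metis abs_ge_self abs_mult)
    also have "\<dots> \<le> A * (card (nbr w) * \<rho> ^ L * A)" using gA errb A0 by (intro mult_mono) auto
    finally show "g w * err w \<le> A * (card (nbr w) * \<rho> ^ L * A)" .
  qed
  also have "\<dots> = \<rho> ^ L * A\<^sup>2 * (\<Sum>w\<in>U. \<Sum>x\<in>nbr w. 1)"
    by (simp add: sum_distrib_left power2_eq_square mult_ac)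
  also have "(\<Sum>w\<in>U. \<Sum>x\<in>nbr w. 1) = 2 * real (card E)"
    using sum_nbr[OF E U(1,2), of "\<lambda>_. 2" "\<lambda>_ _. 1"] by simp
  finally have err: "(\<Sum>w\<in>U. g w * err w) \<le> \<rho> ^ L * A\<^sup>2 * (2 * real (card E))" .
  have "- (2 * \<rho> ^ L * A\<^sup>2 * real (card E)) \<le> D * precision_form U E ?r g"
    using mult_left_mono[OF q, of D] D by (simp add: field_simps)
  then have "- (4 * \<rho> ^ L * real (card E) * A\<^sup>2) \<le> D * qf S K f" unfolding main using err by (simp add: algebra_simps)
  then show ?thesis unfolding A_def[symmetric] D_def[symmetric] using D by (simp add: field_simps)
qed

end

section \<open>Restriction of the kernel to small subgraphs\<close>

definition walk_edges :: "'v list \<Rightarrow> 'v set set" where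
  "walk_edges xs = (\<lambda>i. {xs ! i, xs ! Suc i}) ` {..<length xs - 1}"

lemma walk_edges_subset_iff: "nbwalk E xs \<Longrightarrow> walk_edges xs \<subseteq> H \<Longrightarrow> nbwalk H xs"
  unfolding nbwalk_def walk_edges_def successively_conv_nth by (auto simp: image_subset_iff)

lemma nbwalk_mono: "nbwalk H xs \<Longrightarrow> H \<subseteq> E \<Longrightarrow> nbwalk E xs"
  unfolding nbwalk_def successively_conv_nth by auto

lemma walk_edges_in: "nbwalk E xs \<Longrightarrow> walk_edges xs \<subseteq> E"
  unfolding nbwalk_def walk_edges_def successively_conv_nth by auto

definition sparse_upto :: "nat \<Rightarrow> real \<Rightarrow> 'v set set \<Rightarrow> bool" where
  "sparse_upto m \<kappa> E \<longleftrightarrow> (\<forall>F\<subseteq>E. F \<noteq> {} \<and> finite F \<and> card F \<le> m \<longrightarrow>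
     real (card F) - real (card (\<Union>F)) + 1 \<le> \<kappa> * real (card F))"

text \<open>The excess is an integer, so an excess below 1 is at most 0.\<close>

lemma sparse_upto_forest:
  assumes "sparse_upto m \<kappa> E" "n \<le> m" "\<kappa> * real n < 1" "0 < \<kappa>"
  shows "forest_upto n E"
  unfolding forest_upto_def
proof (intro allI impI)
  fix F assume F: "F \<subseteq> E" "F \<noteq> {} \<and> finite F \<and> card F \<le> n"
  then have "real (card F) - real (card (\<Union>F)) + 1 \<le> \<kappa> * real (card F)"
    using assms unfolding sparse_upto_def by (meson order_trans)
  also have "\<dots> \<le> \<kappa> * real n" using F assms by (intro mult_left_mono) auto
  finally show "card F < card (\<Union>F)" using assms(3) by linarith
qed

text \<open>The kernel on \<open>S\<close> only depends on the union of the short walks between points of \<open>S\<close>, which is a small graph.\<close>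

lemma kernel_lower_bound_local:
  fixes S :: "'v set"
  assumes E2: "\<And>e. e \<in> E \<Longrightarrow> card e = 2" and sp: "sparse_upto m \<kappa> E" and \<kappa>: "0 < \<kappa>" "3 * real L * \<kappa> < 1"
    and L: "2 \<le> L" and \<rho>: "0 < \<rho>" "\<rho> < 1" and s: "\<And>e. s e = 1 \<or> s e = -1"
    and S: "finite S" "card S \<le> r" "r * r * L \<le> m" "2 * L + 1 \<le> m"
  shows "- (4 * \<rho> ^ L / (1 - \<rho>\<^sup>2) * real (r * r * L) * (\<Sum>v\<in>S. \<bar>f v\<bar>)\<^sup>2) \<le> qf S (wkernel E L \<rho> s) f"
proof -
  have "real (2 * L + 1) \<le> 3 * real L" using L by linarith
  then have "\<kappa> * real (2 * L + 1) \<le> \<kappa> * (3 * real L)" using \<kappa>(1) by (intro mult_left_mono) auto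
  also have "\<dots> < 1" using \<kappa>(2) by (simp add: mult_ac)
  finally have k1: "\<kappa> * real (2 * L + 1) < 1" .
  have fo: "forest_upto (2 * L + 1) E" by (rule sparse_upto_forest[OF sp S(4) k1 \<kappa>(1)])
  interpret G: nbgraph E L \<rho> s by unfold_locales (use E2 fo L \<rho> s in auto)
  \<comment> \<open>Each of the at most \<open>r * r\<close> pairs contributes at most one walk of
    at most \<open>L\<close> edges. Thus \<open>H\<close> is small enough for
    \<open>sparse_upto\<close> to make it fully sparse.\<close>
  define H where "H = (\<Union>(u, v)\<in>S \<times> S. \<Union>(walk_edges ` walks E L u v))"
  have HE: "H \<subseteq> E" unfolding H_def walks_def using walk_edges_in by fastforce
  have we: "finite (\<Union>(walk_edges ` walks E L u v)) \<and> card (\<Union>(walk_edges ` walks E L u v)) \<le> L" for u v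
  proof (cases "walks E L u v = {}")
    case False
    then obtain xs where xs: "xs \<in> walks E L u v" by auto
    have "card (walk_edges xs) \<le> length xs - 1"
      unfolding walk_edges_def using card_image_le[of "{..<length xs - 1}"] by fastforce
    also have "\<dots> \<le> L" using xs unfolding walks_def by auto
    finally show ?thesis unfolding G.walk_eq[OF xs] by (simp add: walk_edges_def)
  qed simp
  have fH: "finite H" unfolding H_def using S we by auto
  have "card H \<le> (\<Sum>p\<in>S \<times> S. card (case p of (u, v) \<Rightarrow> \<Union>(walk_edges ` walks E L u v)))"
    unfolding H_def using S by (intro card_UN_le) auto
  also have "\<dots> \<le> (\<Sum>p\<in>S \<times> S. L)" using we by (intro sum_mono) auto
  also have "\<dots> = card S * card S * L" by (simp add: card_cartesian_product)
  also have "\<dots> \<le> r * r * L" using S by (intro mult_mono) auto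
  finally have cH: "card H \<le> r * r * L" .
  have spH: "sparse \<kappa> (\<lambda>_. 1) H"
    unfolding sparse_def
  proof (intro allI impI)
    fix F assume F: "F \<subseteq> H" "F \<noteq> {}"
    then have "finite F" "card F \<le> m" using fH cH S card_mono[of H F] finite_subset by auto
    then show "real (card F) - real (card (\<Union>F)) + 1 \<le> \<kappa> * real (\<Sum>e\<in>F. 1)"
      using sp F HE unfolding sparse_upto_def by auto
  qed
  have foH: "forest_upto (2 * L + 1) H" using fo HE unfolding forest_upto_def by blast
  interpret H: nbgraph H L \<rho> s by unfold_locales (use E2 HE foH L \<rho> s in auto)
  have "walks H L u v = walks E L u v" if "u \<in> S" "v \<in> S" for u v
  proof
    show "walks H L u v \<subseteq> walks E L u v" unfolding walks_def using nbwalk_mono HE by blast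
    show "walks E L u v \<subseteq> walks H L u v"
    proof
      fix xs assume xs: "xs \<in> walks E L u v"
      then have "walk_edges xs \<subseteq> H" using that unfolding H_def by blast
      then show "xs \<in> walks H L u v" using xs walk_edges_subset_iff unfolding walks_def by blast
    qed
  qed
  then have "qf S (wkernel H L \<rho> s) f = qf S (wkernel E L \<rho> s) f"
    by (intro qf_cong) (auto simp: wkernel_def)
  moreover have "4 * \<rho> ^ L / (1 - \<rho>\<^sup>2) * real (card H) * (\<Sum>v\<in>S. \<bar>f v\<bar>)\<^sup>2 \<le>
      4 * \<rho> ^ L / (1 - \<rho>\<^sup>2) * real (r * r * L) * (\<Sum>v\<in>S. \<bar>f v\<bar>)\<^sup>2"
  proof (intro mult_right_mono mult_left_mono)
    show "real (card H) \<le> real (r * r * L)" using cH by (simp only: of_nat_le_iff)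
  qed (use \<rho> in \<open>auto simp: power_le_one\<close>)
  ultimately show ?thesis using H.kernel_lower_bound[OF fH spH \<kappa> S(1), of f] by linarith
qed

section \<open>The covariance of the label bits\<close>

lemma sum_abs_squared_le:
  fixes f :: "'a \<Rightarrow> real"
  shows "(\<Sum>v\<in>S. \<bar>f v\<bar>)\<^sup>2 \<le> real (card S) * (\<Sum>v\<in>S. (f v)\<^sup>2)"
  using sum_squared_le_sum_of_squares[of "\<lambda>v. \<bar>f v\<bar>" S] by (simp add: mult.commute)

text \<open>One uncorrelated copy of the kernel per bit. The sign pattern \<open>s t\<close> depends
  on the bit: a negative sign on an edge asks its endpoints to differ in bit
  \<open>t\<close>.\<close>

definition label_cov :: "'v set set \<Rightarrow> nat \<Rightarrow> real \<Rightarrow> real \<Rightarrow> (nat \<Rightarrow> 'v set \<Rightarrow> real) \<Rightarrow> 'v \<times> nat \<Rightarrow> 'v \<times> nat \<Rightarrow> real" where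
  "label_cov E L \<sigma> \<mu> s = (\<lambda>(u, t) (v, t'). if t = t' then \<sigma> * (wkernel E L (1 - \<mu>) (s t) u v + (if u = v then \<mu> else 0)) else 0)"

lemma label_cov_sym: "label_cov E L \<sigma> \<mu> s i j = label_cov E L \<sigma> \<mu> s j i"
  unfolding label_cov_def by (auto simp: case_prod_unfold wkernel_sym)

text \<open>The form splits over the bits. For each bit the Cauchy-Schwarz inequality turns the
  error of \<open>kernel_lower_bound_local\<close> into a multiple of the sum of squares, at the
  cost of a factor \<open>r\<close>, and \<open>small\<close> says that the diagonal \<mu> absorbs
  it.\<close>

lemma label_cov_psd:
  fixes S :: "'v set"
  assumes E2: "\<And>e. e \<in> E \<Longrightarrow> card e = 2" and sp: "sparse_upto m \<kappa> E" and \<kappa>: "0 < \<kappa>" "3 * real L * \<kappa> < 1"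
    and L: "2 \<le> L" and \<mu>: "0 < \<mu>" "\<mu> < 1" and s: "\<And>t e. s t e = 1 \<or> s t e = -1"
    and S: "finite S" "card S \<le> r" "r * r * L \<le> m" "2 * L + 1 \<le> m"
    and small: "4 * (1 - \<mu>) ^ L / (1 - (1 - \<mu>)\<^sup>2) * real (r * r * L) * real r \<le> \<mu>" and \<sigma>: "0 \<le> \<sigma>"
  shows "0 \<le> qf (S \<times> {..<k}) (label_cov E L \<sigma> \<mu> s) f"
proof -
  let ?K = "\<lambda>t. wkernel E L (1 - \<mu>) (s t)"
  have "qf (S \<times> {..<k}) (label_cov E L \<sigma> \<mu> s) f = (\<Sum>u\<in>S. \<Sum>t<k. \<Sum>v\<in>S. \<Sum>t'<k. f (u, t) * f (v, t') * label_cov E L \<sigma> \<mu> s (u, t) (v, t'))"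
    unfolding qf_def by (simp add: sum.cartesian_product')
  also have "\<dots> = (\<Sum>u\<in>S. \<Sum>t<k. \<Sum>v\<in>S. f (u, t) * f (v, t) * (\<sigma> * (?K t u v + (if u = v then \<mu> else 0))))"
  proof (intro sum.cong refl)
    fix u v t assume t: "t \<in> {..<k}"
    have diag: "(\<Sum>t'<k. g t' * (if t = t' then Z t' else 0)) = g t * Z t" for g Z :: "nat \<Rightarrow> real"
      using t by (simp add: if_distrib cong: if_cong)
    show "(\<Sum>t'<k. f (u, t) * f (v, t') * label_cov E L \<sigma> \<mu> s (u, t) (v, t')) =
        f (u, t) * f (v, t) * (\<sigma> * (?K t u v + (if u = v then \<mu> else 0)))"
      unfolding label_cov_def prod.case diag[of "\<lambda>t'. f (u, t) * f (v, t')" "\<lambda>t'. \<sigma> * (?K t u v + (if u = v then \<mu> else 0))"] ..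
  qed
  also have "\<dots> = (\<Sum>t<k. \<sigma> * (qf S (?K t) (\<lambda>u. f (u, t)) + \<mu> * (\<Sum>u\<in>S. (f (u, t))\<^sup>2)))"
  proof (subst sum.swap, rule sum.cong[OF refl])
    fix t
    have "(\<Sum>u\<in>S. \<Sum>v\<in>S. f (u, t) * f (v, t) * (if u = v then \<mu> else 0)) = \<mu> * (\<Sum>u\<in>S. (f (u, t))\<^sup>2)"
      using S(1) by (simp add: if_distrib power2_eq_square sum_distrib_left mult_ac cong: if_cong)
    then show "(\<Sum>u\<in>S. \<Sum>v\<in>S. f (u, t) * f (v, t) * (\<sigma> * (?K t u v + (if u = v then \<mu> else 0)))) =
        \<sigma> * (qf S (?K t) (\<lambda>u. f (u, t)) + \<mu> * (\<Sum>u\<in>S. (f (u, t))\<^sup>2))"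
      unfolding qf_def by (simp add: distrib_left sum.distrib sum_distrib_left mult_ac del: if_distrib)
        (simp add: sum_distrib_left[symmetric] mult_ac)
  qed
  also have "0 \<le> \<dots>"
  proof (intro sum_nonneg mult_nonneg_nonneg \<sigma>)
    fix t
    let ?f = "\<lambda>u. f (u, t)"
    let ?c = "4 * (1 - \<mu>) ^ L / (1 - (1 - \<mu>)\<^sup>2) * real (r * r * L)"
    have "0 < 1 - (1 - \<mu>)\<^sup>2" using \<mu> by (simp add: abs_square_less_1)
    then have c: "0 \<le> ?c" using \<mu> by simp
    have "- (?c * (\<Sum>v\<in>S. \<bar>?f v\<bar>)\<^sup>2) \<le> qf S (?K t) ?f"
      by (rule kernel_lower_bound_local[OF E2 sp \<kappa> L _ _ s S]) (use \<mu> in auto)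
    moreover have "?c * (\<Sum>v\<in>S. \<bar>?f v\<bar>)\<^sup>2 \<le> ?c * (real r * (\<Sum>v\<in>S. (?f v)\<^sup>2))"
    proof (intro mult_left_mono c)
      have "(\<Sum>v\<in>S. \<bar>?f v\<bar>)\<^sup>2 \<le> real (card S) * (\<Sum>v\<in>S. (?f v)\<^sup>2)" by (rule sum_abs_squared_le)
      also have "\<dots> \<le> real r * (\<Sum>v\<in>S. (?f v)\<^sup>2)" using S by (intro mult_right_mono) (auto simp: sum_nonneg)
      finally show "(\<Sum>v\<in>S. \<bar>?f v\<bar>)\<^sup>2 \<le> real r * (\<Sum>v\<in>S. (?f v)\<^sup>2)" .
    qed
    moreover have "?c * (real r * (\<Sum>v\<in>S. (?f v)\<^sup>2)) \<le> \<mu> * (\<Sum>v\<in>S. (?f v)\<^sup>2)"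
      using mult_right_mono[OF small, of "\<Sum>v\<in>S. (?f v)\<^sup>2"] by (simp add: sum_nonneg mult.assoc)
    ultimately show "0 \<le> qf S (?K t) ?f + \<mu> * (\<Sum>u\<in>S. (?f u)\<^sup>2)" by linarith
  qed
  finally show ?thesis .
qed

section \<open>Ordered types and directed cuts\<close>

lemma sum_lessThan_double: "(\<Sum>P<2*n. f P) = (\<Sum>P<n. f (2*P) + f (2*P+1))" for f :: "nat \<Rightarrow> 'a::comm_monoid_add"
  by (induction n) (simp_all add: add.assoc)

lemma sum_lessThan_add: "(\<Sum>y<m+n. f y) = (\<Sum>y<m. f y) + (\<Sum>y<n. f (m + y))" for f :: "nat \<Rightarrow> 'a::comm_monoid_add"
  by (induction n) (simp_all add: add.assoc)

definition bavg :: "(nat \<Rightarrow> real) \<Rightarrow> nat \<Rightarrow> nat \<Rightarrow> real" where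
  "bavg a j P = (\<Sum>y<2^j. a (P * 2^j + y)) / 2^j"

lemma bavg_Suc: "bavg a (Suc j) P = (bavg a j (2*P) + bavg a j (2*P+1)) / 2"
proof -
  have "(\<Sum>y<2^Suc j. a (P * 2^Suc j + y)) =
      (\<Sum>y<2^j. a (2*P * 2^j + y)) + (\<Sum>y<2^j. a ((2*P+1) * 2^j + y))"
    using sum_lessThan_add[of "\<lambda>y. a (P * 2^Suc j + y)" "2^j" "2^j"] by (simp add: algebra_simps mult_2)
  then show ?thesis unfolding bavg_def by (simp add: add_divide_distrib)
qed

text \<open>The block averages form a martingale, so their squared increments add up to at most one.\<close>

definition benergy :: "nat \<Rightarrow> (nat \<Rightarrow> real) \<Rightarrow> nat \<Rightarrow> real" where
  "benergy J a j = (\<Sum>P<2^(J-j). (bavg a j P)\<^sup>2) / 2^(J-j)"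

text \<open>If the two children of a node have averages \<open>m + d\<close> and
  \<open>m - d\<close>, the cut there is \<open>m - m\<^sup>2 + d + d\<^sup>2\<close>, at most 1/4
  plus a term in \<open>d\<close>. The linear \<open>d\<close> is traded for \<eta> and a multiple
  of \<open>d\<^sup>2\<close>, and the mean of \<open>d\<^sup>2\<close> over the nodes is exactly
  the energy lost between the two levels.\<close>

lemma level_bound:
  assumes j: "j < J" and \<eta>: "0 < \<eta>"
  shows "(\<Sum>P<2^(J-1-j). bavg a j (2*P) * (1 - bavg a j (2*P+1))) \<le>
    2^(J-1-j) * (1/4 + \<eta> + (1 + 1/(4*\<eta>)) * (benergy J a j - benergy J a (Suc j)))"
proof -
  let ?n = "2^(J-1-j) :: nat" and ?K = "1 + 1/(4*\<eta>)"
  have "J - j = Suc (J-1-j)" using j by simp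
  then have Jj: "(2::nat)^(J-j) = 2 * ?n" "(2::real)^(J-j) = 2 * 2^(J-1-j)" by (simp_all only: power_Suc)
  have pt: "l * (1 - r) \<le> 1/4 + \<eta> + ?K * ((l\<^sup>2 + r\<^sup>2) / 2 - ((l + r) / 2)\<^sup>2)" for l r :: real
  proof -
    define d m where "d = (l - r) / 2" and "m = (l + r) / 2"
    have lr: "l = m + d" "r = m - d" by (auto simp: d_def m_def field_simps)
    have "0 \<le> (2 * \<eta> - d)\<^sup>2" by simp
    then have "4 * \<eta> * d \<le> 4 * \<eta>\<^sup>2 + d\<^sup>2" by (simp add: power2_eq_square algebra_simps)
    then have 1: "d \<le> \<eta> + d\<^sup>2 / (4 * \<eta>)" using \<eta> by (simp add: field_simps power2_eq_square)
    have "0 \<le> (m - 1/2)\<^sup>2" by simp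
    then have 2: "m - m\<^sup>2 \<le> 1/4" by (simp add: power2_eq_square algebra_simps)
    have 3: "l * (1 - r) = m - m\<^sup>2 + d + d\<^sup>2" unfolding lr by (simp add: power2_eq_square algebra_simps)
    have 4: "(l\<^sup>2 + r\<^sup>2) / 2 - ((l + r) / 2)\<^sup>2 = d\<^sup>2" unfolding lr by (simp add: power2_eq_square algebra_simps)
    have 5: "?K * d\<^sup>2 = d\<^sup>2 + d\<^sup>2 / (4 * \<eta>)" by (simp add: distrib_right)
    show ?thesis unfolding 3 4 5 using 1 2 by linarith
  qed
  have "(\<Sum>P<?n. bavg a j (2*P) * (1 - bavg a j (2*P+1))) \<le>
     (\<Sum>P<?n. 1/4 + \<eta> + ?K * (((bavg a j (2*P))\<^sup>2 + (bavg a j (2*P+1))\<^sup>2) / 2 - (bavg a (Suc j) P)\<^sup>2))"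
    unfolding bavg_Suc by (intro sum_mono pt)
  also have "\<dots> = real ?n * (1/4 + \<eta>) + ?K * (((\<Sum>P<?n. (bavg a j (2*P))\<^sup>2 + (bavg a j (2*P+1))\<^sup>2) / 2) - (\<Sum>P<?n. (bavg a (Suc j) P)\<^sup>2))"
    by (simp add: sum.distrib sum_distrib_left[symmetric] sum_subtractf sum_divide_distrib[symmetric])
  also have "(\<Sum>P<?n. (bavg a j (2*P))\<^sup>2 + (bavg a j (2*P+1))\<^sup>2) = 2 * real ?n * benergy J a j"
    unfolding benergy_def Jj sum_lessThan_double by simp
  also have "(\<Sum>P<?n. (bavg a (Suc j) P)\<^sup>2) = real ?n * benergy J a (Suc j)"
    unfolding benergy_def by simp
  finally show ?thesis by (simp add: algebra_simps)
qed

lemma energy_bounds: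
  assumes "\<And>x. 0 \<le> a x \<and> a x \<le> (1::real)"
  shows "0 \<le> benergy J a j" "benergy J a 0 \<le> 1"
proof -
  show "0 \<le> benergy J a j" unfolding benergy_def by (simp add: sum_nonneg)
  have "(a P)\<^sup>2 \<le> 1" for P using assms[of P] by (simp add: abs_square_le_1)
  then have "(\<Sum>P<2^J. (a P)\<^sup>2) \<le> (\<Sum>P<(2::nat)^J. 1)" by (intro sum_mono) auto
  then show "benergy J a 0 \<le> 1" unfolding benergy_def bavg_def by simp
qed

text \<open>Types are the leaves of a binary tree of depth \<open>J\<close>. An index picks a level, a node of that level and one
  leaf on either side below it; the last component equalises the number of indices per level.\<close>

definition tree_pairs :: "nat \<Rightarrow> (nat \<times> nat \<times> nat \<times> nat \<times> nat) set" where
  "tree_pairs J = (SIGMA j:{..<J}. {..<2^(J-1-j)} \<times> {..<2^j} \<times> {..<2^j} \<times> {..<2^(J-1-j)})"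

definition lo_type :: "nat \<times> nat \<times> nat \<times> nat \<times> nat \<Rightarrow> nat" where
  "lo_type = (\<lambda>(j, P, y, y', r). 2*P * 2^j + y)"

definition hi_type :: "nat \<times> nat \<times> nat \<times> nat \<times> nat \<Rightarrow> nat" where
  "hi_type = (\<lambda>(j, P, y, y', r). (2*P+1) * 2^j + y')"

lemma sum_tree_pairs:
  fixes F :: "nat \<Rightarrow> nat \<Rightarrow> real"
  shows "(\<Sum>x\<in>tree_pairs J. F (lo_type x) (hi_type x)) =
    (\<Sum>j<J. 2^(J-1-j) * (\<Sum>P<2^(J-1-j). \<Sum>y<2^j. \<Sum>y'<2^j. F (2*P * 2^j + y) ((2*P+1) * 2^j + y')))"
proof -
  let ?B = "\<lambda>j. {..<(2::nat)^(J-1-j)} \<times> {..<(2::nat)^j} \<times> {..<(2::nat)^j} \<times> {..<(2::nat)^(J-1-j)}"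
  let ?f = "\<lambda>j q. case q of (P, y, y', r) \<Rightarrow> F (2*P * 2^j + y) ((2*P+1) * 2^j + y')"
  have "(\<Sum>x\<in>Sigma {..<J} ?B. F (case x of (j, P, y, y', r) \<Rightarrow> 2*P * 2^j + y) (case x of (j, P, y, y', r) \<Rightarrow> (2*P+1) * 2^j + y')) =
      (\<Sum>(j, q)\<in>Sigma {..<J} ?B. ?f j q)"
    by (rule sum.cong) auto
  also have "\<dots> = (\<Sum>j<J. \<Sum>q\<in>?B j. ?f j q)" by (rule sum.Sigma[symmetric]) auto
  also have "\<dots> = (\<Sum>j<J. 2^(J-1-j) * (\<Sum>P<2^(J-1-j). \<Sum>y<2^j. \<Sum>y'<2^j. F (2*P * 2^j + y) ((2*P+1) * 2^j + y')))"
    by (intro sum.cong refl) (simp add: sum.cartesian_product' sum_distrib_left)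
  finally show ?thesis unfolding tree_pairs_def lo_type_def hi_type_def .
qed

lemma tree_pairs_types:
  assumes "x \<in> tree_pairs J" shows "lo_type x < hi_type x" "hi_type x < 2^J"
proof -
  obtain j P y y' r where x: "x = (j, P, y, y', r)" "j < J" "P < 2^(J-1-j)" "y < 2^j" "y' < 2^j"
    using assms unfolding tree_pairs_def by auto
  show "lo_type x < hi_type x" unfolding x lo_type_def hi_type_def using x by simp
  have "2*P+2 \<le> 2^Suc (J-1-j)" using x(3) by simp
  also have "Suc (J-1-j) = J - j" using x(2) by simp
  finally have "(2*P+2) * 2^j \<le> 2^(J-j) * 2^j" by (rule mult_right_mono) simp
  also have "\<dots> = 2^J" using x(2) by (simp add: power_add[symmetric])
  finally show "hi_type x < 2^J" unfolding x hi_type_def using x by simp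
qed

lemma pow_split: "j < J \<Longrightarrow> 2^(J-1-j) * (2^(J-1-j) * (2^j * 2^j)) = (2::real)^(2*J-2)"
  unfolding power_add[symmetric] by (rule arg_cong[where f = "(^) 2"]) linarith

lemma card_tree_pairs: "real (card (tree_pairs J)) = real J * 2^(2*J-2)"
proof -
  have "real (card (tree_pairs J)) = (\<Sum>x\<in>tree_pairs J. 1)" by simp
  also have "\<dots> = (\<Sum>j<J. 2^(J-1-j) * (2^(J-1-j) * (2^j * 2^j)))"
    using sum_tree_pairs[of "\<lambda>_ _. 1" J] by simp
  also have "\<dots> = (\<Sum>j<J. 2^(2*J-2))" by (intro sum.cong refl pow_split) auto
  finally show ?thesis by simp
qed

text \<open>The energy differences telescope to at most 1, so the penalty
  \<open>1 + 1/(4*\<eta>)\<close> is paid once for the whole tree and not once per level.\<close>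

lemma tree_pairs_cut:
  assumes a: "\<And>x. 0 \<le> a x \<and> a x \<le> (1::real)" and \<eta>: "0 < \<eta>"
  shows "(\<Sum>x\<in>tree_pairs J. a (lo_type x) * (1 - a (hi_type x))) \<le> 2^(2*J-2) * (real J * (1/4 + \<eta>) + (1 + 1/(4*\<eta>)))"
proof -
  let ?K = "1 + 1/(4*\<eta>)"
  have "(\<Sum>x\<in>tree_pairs J. a (lo_type x) * (1 - a (hi_type x))) =
      (\<Sum>j<J. 2^(J-1-j) * (\<Sum>P<2^(J-1-j). 2^j * 2^j * (bavg a j (2*P) * (1 - bavg a j (2*P+1)))))"
    unfolding sum_tree_pairs[of "\<lambda>x y. a x * (1 - a y)"]
  proof (intro sum.cong refl arg_cong2[where f = "(*)"])
    fix j P :: nat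
    have "(\<Sum>y'<2^j. 1 - a ((2*P+1) * 2^j + y')) = 2^j * (1 - bavg a j (2*P+1))"
      unfolding bavg_def by (simp add: sum_subtractf field_simps)
    moreover have "(\<Sum>y<2^j. a (2*P * 2^j + y)) = 2^j * bavg a j (2*P)" unfolding bavg_def by simp
    ultimately show "(\<Sum>y<2^j. \<Sum>y'<2^j. a (2*P * 2^j + y) * (1 - a ((2*P+1) * 2^j + y'))) =
        2^j * 2^j * (bavg a j (2*P) * (1 - bavg a j (2*P+1)))"
      unfolding sum_product[symmetric] by simp
  qed
  also have "\<dots> \<le> (\<Sum>j<J. 2^(2*J-2) * (1/4 + \<eta> + ?K * (benergy J a j - benergy J a (Suc j))))"
  proof (rule sum_mono)
    fix j assume "j \<in> {..<J}"
    then have j: "j < J" by simp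
    have "2^(J-1-j) * (\<Sum>P<2^(J-1-j). 2^j * 2^j * (bavg a j (2*P) * (1 - bavg a j (2*P+1)))) =
        2^(J-1-j) * (2^j * 2^j) * (\<Sum>P<2^(J-1-j). bavg a j (2*P) * (1 - bavg a j (2*P+1)))"
      by (simp add: sum_distrib_left mult.assoc)
    also have "\<dots> \<le> 2^(J-1-j) * (2^j * 2^j) * (2^(J-1-j) * (1/4 + \<eta> + ?K * (benergy J a j - benergy J a (Suc j))))"
      by (intro mult_left_mono level_bound[OF j \<eta>]) simp
    also have "\<dots> = 2^(2*J-2) * (1/4 + \<eta> + ?K * (benergy J a j - benergy J a (Suc j)))"
      unfolding pow_split[OF j, symmetric] by (simp only: mult_ac)
    finally show "2^(J-1-j) * (\<Sum>P<2^(J-1-j). 2^j * 2^j * (bavg a j (2*P) * (1 - bavg a j (2*P+1)))) \<le>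
        2^(2*J-2) * (1/4 + \<eta> + ?K * (benergy J a j - benergy J a (Suc j)))" .
  qed
  also have "\<dots> = 2^(2*J-2) * (real J * (1/4 + \<eta>) + ?K * (benergy J a 0 - benergy J a J))"
    unfolding sum_distrib_left[symmetric] sum.distrib
    using sum_lessThan_telescope'[of "benergy J a" J] by (simp add: distrib_left)
  also have "\<dots> \<le> 2^(2*J-2) * (real J * (1/4 + \<eta>) + ?K * 1)"
    using energy_bounds[OF a] \<eta> by (intro mult_left_mono add_left_mono) (auto simp: algebra_simps diff_le_eq intro: add_increasing2 order_trans)
  finally show ?thesis by simp
qed

text \<open>Controls the vertices that are priced on scales of a foreign type. Below a fixed node
  the lower types are distinct, so the row sum of \<open>b\<close> bounds their total by 1 in place
  of \<open>2 ^ j\<close>; the saving sums to a geometric series.\<close>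

lemma tree_pairs_collision:
  assumes b: "\<And>x y. 0 \<le> b x y" "\<And>x. (\<Sum>y<2^J. b x y) \<le> (1::real)"
  shows "(\<Sum>x\<in>tree_pairs J. b (hi_type x) (lo_type x)) \<le> 2^(2*J-2) * 2"
proof -
  have "(\<Sum>x\<in>tree_pairs J. b (hi_type x) (lo_type x)) =
      (\<Sum>j<J. 2^(J-1-j) * (\<Sum>P<2^(J-1-j). \<Sum>y<2^j. \<Sum>y'<2^j. b ((2*P+1) * 2^j + y') (2*P * 2^j + y)))"
    by (rule sum_tree_pairs)
  also have "\<dots> \<le> (\<Sum>j<J. 2^(2*J-2) * (1/2)^j)"
  proof (rule sum_mono)
    fix j assume "j \<in> {..<J}"
    then have j: "j < J" by simp
    have "(\<Sum>P<2^(J-1-j). \<Sum>y<2^j. \<Sum>y'<2^j. b ((2*P+1) * 2^j + y') (2*P * 2^j + y)) \<le> (\<Sum>P<(2::nat)^(J-1-j). \<Sum>y'<(2::nat)^j. 1)"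
    proof (rule sum_mono, subst sum.swap, rule sum_mono)
      fix P y' assume "P \<in> {..<(2::nat)^(J-1-j)}"
      then have "(2*P+1) * 2^j \<le> 2^Suc (J-1-j) * 2^j" by (intro mult_right_mono) auto
      also have "\<dots> = 2^J" using j by (simp only: power_add[symmetric]) (rule arg_cong[where f = "(^) 2"], linarith)
      finally have P: "(2*P+1) * 2^j \<le> 2^J" .
      have "(\<Sum>y<2^j. b ((2*P+1) * 2^j + y') (2*P * 2^j + y)) = sum (b ((2*P+1) * 2^j + y')) ((\<lambda>y. 2*P * 2^j + y) ` {..<2^j})"
        by (subst sum.reindex) (auto simp: inj_on_def)
      also have "\<dots> \<le> sum (b ((2*P+1) * 2^j + y')) {..<2^J}"
        using P by (intro sum_mono2 b) (auto simp: algebra_simps)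
      also have "\<dots> \<le> 1" by (rule b)
      finally show "(\<Sum>y<2^j. b ((2*P+1) * 2^j + y') (2*P * 2^j + y)) \<le> 1" .
    qed
    then have "2^(J-1-j) * (\<Sum>P<2^(J-1-j). \<Sum>y<2^j. \<Sum>y'<2^j. b ((2*P+1) * 2^j + y') (2*P * 2^j + y)) \<le>
        2^(J-1-j) * (2^(J-1-j) * 2^j)" by simp
    also have "\<dots> = 2^(2*J-2) * (1/2)^j"
      unfolding pow_split[OF j, symmetric] by (simp add: power_divide)
    finally show "2^(J-1-j) * (\<Sum>P<2^(J-1-j). \<Sum>y<2^j. \<Sum>y'<2^j. b ((2*P+1) * 2^j + y') (2*P * 2^j + y)) \<le> 2^(2*J-2) * (1/2)^j" .
  qed
  also have "\<dots> = 2^(2*J-2) * (\<Sum>j<J. (1/2)^j)" by (simp add: sum_distrib_left)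
  also have "\<dots> \<le> 2^(2*J-2) * 2" by (rule mult_left_mono) (simp_all add: sum_gp_strict)
  finally show ?thesis .
qed

lemma type_pairs_exist:
  assumes \<eta>: "0 < (\<eta>::real)"
  shows "\<exists>(C::nat) (X :: (nat \<times> nat \<times> nat \<times> nat \<times> nat) set) c c'. finite X \<and> X \<noteq> {} \<and>
    (\<forall>x\<in>X. c x < c' x \<and> c' x < C) \<and>
    (\<forall>a. (\<forall>t. 0 \<le> a t \<and> a t \<le> 1) \<longrightarrow> (\<Sum>x\<in>X. a (c x) * (1 - a (c' x))) \<le> (1/4 + \<eta>) * real (card X)) \<and>
    (\<forall>b. (\<forall>t t'. 0 \<le> b t t') \<and> (\<forall>t. (\<Sum>t'<C. b t t') \<le> 1) \<longrightarrow> (\<Sum>x\<in>X. b (c' x) (c x)) \<le> \<eta> * real (card X))"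
proof -
  define K where "K = 1 + 1/(4*(\<eta>/2))"
  \<comment> \<open>The errors \<open>K\<close> of the cut and 2 of the collisions do not grow with
    the depth, so a deep tree makes both negligible per pair.\<close>
  define J :: nat where "J = nat \<lceil>2 * (K + 2) / \<eta>\<rceil>"
  have K: "0 < K" using \<eta> by (simp add: K_def add_pos_pos)
  have "2 * (K + 2) / \<eta> \<le> real J" unfolding J_def by (rule real_nat_ceiling_ge)
  then have J: "K + 2 \<le> real J * (\<eta>/2)" using \<eta> by (simp add: field_simps)
  let ?p = "2^(2*J-2) :: real"
  have 1: "(\<Sum>x\<in>tree_pairs J. a (lo_type x) * (1 - a (hi_type x))) \<le> (1/4 + \<eta>) * real (card (tree_pairs J))"
    if a: "\<forall>t. 0 \<le> a t \<and> a t \<le> 1" for a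
  proof -
    have "(\<Sum>x\<in>tree_pairs J. a (lo_type x) * (1 - a (hi_type x))) \<le> ?p * (real J * (1/4 + \<eta>/2) + K)"
      unfolding K_def by (rule tree_pairs_cut) (use a \<eta> in auto)
    also have "\<dots> \<le> ?p * (real J * (1/4 + \<eta>))"
      using J K by (intro mult_left_mono) (auto simp: algebra_simps)
    finally show ?thesis unfolding card_tree_pairs by (simp add: mult_ac)
  qed
  have 2: "(\<Sum>x\<in>tree_pairs J. b (hi_type x) (lo_type x)) \<le> \<eta> * real (card (tree_pairs J))"
    if "(\<forall>t t'. 0 \<le> b t t') \<and> (\<forall>t. (\<Sum>t'<2^J. b t t') \<le> 1)" for b :: "nat \<Rightarrow> nat \<Rightarrow> real"
  proof -
    have "(\<Sum>x\<in>tree_pairs J. b (hi_type x) (lo_type x)) \<le> ?p * 2" by (rule tree_pairs_collision) (use that in auto)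
    also have "\<dots> \<le> ?p * (real J * \<eta>)" using J K \<eta> by (intro mult_left_mono) auto
    finally show ?thesis unfolding card_tree_pairs by (simp add: mult_ac)
  qed
  have "J \<noteq> 0" using J K by (intro notI) simp
  then have "0 < real (card (tree_pairs J))" unfolding card_tree_pairs by simp
  then have fin: "finite (tree_pairs J)" "tree_pairs J \<noteq> {}" by (auto simp: card_gt_0_iff)
  show ?thesis
    by (rule exI[of _ "2^J"], rule exI[of _ "tree_pairs J"], rule exI[of _ lo_type], rule exI[of _ hi_type],
        intro conjI ballI allI impI) (simp_all only: tree_pairs_types fin not_False_eq_True, erule 1, erule 2)
qed

section \<open>Random edges\<close>

text \<open>Exponential moments with parameter \<open>\<epsilon> / 2\<close> and the bound
  \<open>exp y \<le> 1 + y + y\<^sup>2\<close> on [0, 1]; that parameter minimises the resulting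
  exponent \<open>l\<^sup>2 - l * \<epsilon>\<close>.\<close>

lemma chernoff_count:
  fixes g :: "'o \<Rightarrow> real"
  assumes Z: "finite Z" and g: "\<And>x. 0 \<le> g x \<and> g x \<le> 1" and mean: "(\<Sum>x\<in>Z. g x) \<le> \<mu> * real (card Z)"
    and \<epsilon>: "0 < \<epsilon>" "\<epsilon> \<le> 2"
  shows "real (card {\<omega> \<in> {..<E} \<rightarrow>\<^sub>E Z. (\<mu> + \<epsilon>) * real E < (\<Sum>e<E. g (\<omega> e))}) \<le> real (card Z) ^ E * exp (- (\<epsilon>\<^sup>2 / 4) * real E)"
    (is "real (card ?B) \<le> _")
proof -
  let ?Z = "{..<E} \<rightarrow>\<^sub>E Z" and ?l = "\<epsilon> / 2"
  have fin: "finite ?Z" using Z by (intro finite_PiE) auto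
  have "(\<Sum>x\<in>Z. exp (?l * g x)) \<le> (\<Sum>x\<in>Z. 1 + ?l * g x + ?l\<^sup>2)"
  proof (rule sum_mono)
    fix x
    have lg: "0 \<le> ?l * g x" "?l * g x \<le> ?l" "?l \<le> 1" using g[of x] \<epsilon> by (auto intro: mult_left_le)
    then have "exp (?l * g x) \<le> 1 + ?l * g x + (?l * g x)\<^sup>2" by (intro exp_bound) auto
    also have "(?l * g x)\<^sup>2 \<le> ?l\<^sup>2" using lg by (intro power_mono) auto
    finally show "exp (?l * g x) \<le> 1 + ?l * g x + ?l\<^sup>2" by simp
  qed
  also have "\<dots> = real (card Z) * (1 + ?l\<^sup>2) + ?l * (\<Sum>x\<in>Z. g x)"
    by (simp add: sum.distrib sum_distrib_left algebra_simps)
  also have "\<dots> \<le> real (card Z) * (1 + ?l\<^sup>2) + ?l * (\<mu> * real (card Z))"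
    using mean \<epsilon> by (intro add_left_mono mult_left_mono) auto
  also have "\<dots> = real (card Z) * (1 + (?l * \<mu> + ?l\<^sup>2))" by (simp add: algebra_simps)
  also have "\<dots> \<le> real (card Z) * exp (?l * \<mu> + ?l\<^sup>2)" by (intro mult_left_mono exp_ge_add_one_self) auto
  finally have one: "(\<Sum>x\<in>Z. exp (?l * g x)) \<le> real (card Z) * exp (?l * \<mu> + ?l\<^sup>2)" .
  have "real (card ?B) * exp (?l * ((\<mu> + \<epsilon>) * real E)) = (\<Sum>\<omega>\<in>?B. exp (?l * ((\<mu> + \<epsilon>) * real E)))" by simp
  also have "\<dots> \<le> (\<Sum>\<omega>\<in>?B. exp (?l * (\<Sum>e<E. g (\<omega> e))))"
    using \<epsilon> by (intro sum_mono) (auto intro!: mult_left_mono less_imp_le)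
  also have "\<dots> \<le> (\<Sum>\<omega>\<in>?Z. exp (?l * (\<Sum>e<E. g (\<omega> e))))"
    using fin by (intro sum_mono2) auto
  also have "\<dots> = (\<Sum>\<omega>\<in>?Z. \<Prod>e<E. exp (?l * g (\<omega> e)))"
    by (simp only: sum_distrib_left exp_sum[OF finite_lessThan])
  also have "\<dots> = (\<Prod>e<E. \<Sum>x\<in>Z. exp (?l * g x))"
    using Z by (subst prod_sum_PiE) auto
  also have "\<dots> = (\<Sum>x\<in>Z. exp (?l * g x)) ^ E" by simp
  also have "\<dots> \<le> (real (card Z) * exp (?l * \<mu> + ?l\<^sup>2)) ^ E"
    using one by (intro power_mono) (auto intro: sum_nonneg)
  also have "\<dots> = real (card Z) ^ E * exp (real E * (?l * \<mu> + ?l\<^sup>2))"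
    by (simp add: power_mult_distrib exp_of_nat_mult)
  finally have "real (card ?B) \<le> real (card Z) ^ E * exp (real E * (?l * \<mu> + ?l\<^sup>2)) / exp (?l * ((\<mu> + \<epsilon>) * real E))"
    by (simp add: field_simps)
  also have "\<dots> = real (card Z) ^ E * exp (real E * (?l * \<mu> + ?l\<^sup>2) - ?l * ((\<mu> + \<epsilon>) * real E))"
    by (simp only: exp_diff times_divide_eq_right)
  also have "real E * (?l * \<mu> + ?l\<^sup>2) - ?l * ((\<mu> + \<epsilon>) * real E) = - (\<epsilon>\<^sup>2 / 4) * real E"
    by (simp add: power2_eq_square algebra_simps)
  finally show ?thesis .
qed

lemma power_self_le_exp_fact: "real k ^ k \<le> exp (real k) * fact k"
proof -
  have "real k ^ k / fact k \<le> exp (real k)"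
    using exp_lower_Taylor_quadratic[of 0] sum_le_suminf[OF summable_exp_generic[of "real k"], of "{k}"]
    by (simp add: exp_def scaleR_conv_of_real field_simps)
  then show ?thesis by (simp add: field_simps)
qed

lemma binomial_upper_bound:
  assumes "0 < k" shows "real (n choose k) \<le> (exp 1 * real n / real k) ^ k"
proof -
  have "(n choose k) * fact k \<le> n ^ k" by (rule binomial_fact_pow)
  then have "real (n choose k) * fact k \<le> real n ^ k"
    by (metis of_nat_fact of_nat_le_iff of_nat_mult of_nat_power)
  then have "real (n choose k) * (real k ^ k) \<le> real (n choose k) * (exp (real k) * fact k)"
    by (intro mult_left_mono power_self_le_exp_fact) auto
  also have "\<dots> = exp (real k) * (real (n choose k) * fact k)" by simp
  also have "\<dots> \<le> exp (real k) * real n ^ k" using \<open>real (n choose k) * fact k \<le> real n ^ k\<close> by simp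
  finally have "real (n choose k) * real k ^ k \<le> exp (real k) * real n ^ k" .
  moreover have "exp (real k) = exp 1 ^ k" by (simp add: exp_of_nat_mult[symmetric])
  ultimately show ?thesis using assms by (simp add: power_divide power_mult_distrib field_simps)
qed

text \<open>The edges are independent uniform outcomes in \<open>Z\<close>; probabilities are expressed by counting the maps
  from edge numbers to outcomes.\<close>

locale random_edges =
  fixes Z :: "'o set" and V :: "'v set" and hd_of tl_of :: "'o \<Rightarrow> 'v" and E :: nat and n0 C D :: real
  assumes finO: "finite Z" and finV: "finite V" and O_ne: "Z \<noteq> {}"
    and dens: "\<And>W. W \<subseteq> V \<Longrightarrow> real (card {x \<in> Z. hd_of x \<in> W \<and> tl_of x \<in> W}) \<le> real (card Z) * (real (card W) / n0)\<^sup>2"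
    and n0: "1 \<le> n0" and cV: "real (card V) \<le> C * n0" and cE: "real E \<le> D * n0"
    and C: "1 \<le> C" and D: "1 \<le> D"
begin

definition A :: real where "A = exp 2 * C * D"

definition \<Omega> :: "(nat \<Rightarrow> 'o) set" where "\<Omega> = {..<E} \<rightarrow>\<^sub>E Z"

lemma fin_\<Omega>: "finite \<Omega>" unfolding \<Omega>_def using finO by (intro finite_PiE) auto
lemma card_\<Omega>: "real (card \<Omega>) = real (card Z) ^ E" unfolding \<Omega>_def by (simp add: card_PiE)

definition inside :: "(nat \<Rightarrow> 'o) \<Rightarrow> nat \<Rightarrow> 'v set \<Rightarrow> bool" where
  "inside \<omega> e W \<longleftrightarrow> hd_of (\<omega> e) \<in> W \<and> tl_of (\<omega> e) \<in> W"

definition dense_pairs :: "nat \<Rightarrow> nat \<Rightarrow> (nat \<Rightarrow> 'o) \<Rightarrow> ('v set \<times> nat set) set" where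
  "dense_pairs w q \<omega> = {(W, F). W \<subseteq> V \<and> card W = w \<and> F \<subseteq> {..<E} \<and> card F = q \<and> (\<forall>e\<in>F. inside \<omega> e W)}"

lemma finite_dense_pairs: "finite (dense_pairs w q \<omega>)"
  by (rule finite_subset[of _ "Pow V \<times> Pow {..<E}"]) (use finV in \<open>auto simp: dense_pairs_def\<close>)

lemma count_inside:
  assumes "W \<subseteq> V" "F \<subseteq> {..<E}"
  shows "real (card {\<omega> \<in> \<Omega>. \<forall>e\<in>F. inside \<omega> e W}) \<le> real (card \<Omega>) * (real (card W) / n0) ^ (2 * card F)"
proof -
  let ?B = "{x \<in> Z. hd_of x \<in> W \<and> tl_of x \<in> W}"
  have "{\<omega> \<in> \<Omega>. \<forall>e\<in>F. inside \<omega> e W} = PiE {..<E} (\<lambda>e. if e \<in> F then ?B else Z)"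
    using assms(2) unfolding \<Omega>_def inside_def by (auto simp: PiE_def Pi_def split: if_splits)
  then have "real (card {\<omega> \<in> \<Omega>. \<forall>e\<in>F. inside \<omega> e W}) = (\<Prod>e<E. real (card (if e \<in> F then ?B else Z)))"
    by (simp add: card_PiE)
  also have "\<dots> \<le> (\<Prod>e<E. real (card Z) * (if e \<in> F then (real (card W) / n0)\<^sup>2 else 1))"
    using dens[OF assms(1)] by (intro prod_mono) auto
  also have "\<dots> = real (card Z) ^ E * (\<Prod>e<E. if e \<in> F then (real (card W) / n0)\<^sup>2 else 1)"
    by (simp add: prod.distrib)
  also have "(\<Prod>e<E. if e \<in> F then (real (card W) / n0)\<^sup>2 else 1) = (\<Prod>e\<in>F. (real (card W) / n0)\<^sup>2)"
    using assms(2) by (intro prod.mono_neutral_cong_right) auto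
  finally show ?thesis by (simp add: card_\<Omega> power_mult)
qed

text \<open>First moment: choose the vertices, choose the edges, and require each edge to fall
  inside. After the binomial bounds, each vertex together with one edge contributes the constant
  \<open>A\<close>, and each of the \<open>q - w\<close> surplus edges the small factor
  \<open>exp 1 * D * w / n0\<close>.\<close>

lemma sum_dense_pairs:
  assumes w: "0 < w" "w \<le> q"
  shows "(\<Sum>\<omega>\<in>\<Omega>. real (card (dense_pairs w q \<omega>))) \<le> real (card \<Omega>) * (A ^ w * (exp 1 * D * real w / n0) ^ (q - w))"
proof -
  let ?P = "{W. W \<subseteq> V \<and> card W = w} \<times> {F. F \<subseteq> {..<E} \<and> card F = q}"
  have finP: "finite ?P" using finV by (intro finite_cartesian_product) auto
  have "(\<Sum>\<omega>\<in>\<Omega>. real (card (dense_pairs w q \<omega>))) = (\<Sum>\<omega>\<in>\<Omega>. \<Sum>p\<in>?P. of_bool (\<forall>e\<in>snd p. inside \<omega> e (fst p)))"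
  proof (rule sum.cong[OF refl])
    fix \<omega>
    have "dense_pairs w q \<omega> = {p \<in> ?P. \<forall>e\<in>snd p. inside \<omega> e (fst p)}" unfolding dense_pairs_def by auto
    then show "real (card (dense_pairs w q \<omega>)) = (\<Sum>p\<in>?P. of_bool (\<forall>e\<in>snd p. inside \<omega> e (fst p)))"
      using finP by (simp add: of_bool_def sum.If_cases Int_def)
  qed
  also have "\<dots> = (\<Sum>p\<in>?P. real (card {\<omega> \<in> \<Omega>. \<forall>e\<in>snd p. inside \<omega> e (fst p)}))"
    using fin_\<Omega> by (subst sum.swap) (simp add: of_bool_def sum.If_cases Int_def)
  also have "\<dots> \<le> (\<Sum>p\<in>?P. real (card \<Omega>) * (real w / n0) ^ (2 * q))"
    using count_inside by (intro sum_mono) fastforce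
  also have "\<dots> = real (card \<Omega>) * (real (card V choose w) * real (E choose q) * (real w / n0) ^ (2 * q))"
    using finV by (simp add: card_cartesian_product n_subsets)
  also have "\<dots> \<le> real (card \<Omega>) * (A ^ w * (exp 1 * D * real w / n0) ^ (q - w))"
  proof (rule mult_left_mono)
    have wq: "0 < real w" "real w \<le> real q" using w by auto
    have "real (card V choose w) \<le> (exp 1 * real (card V) / real w) ^ w" using w by (intro binomial_upper_bound) auto
    also have "\<dots> \<le> (exp 1 * (C * n0) / real w) ^ w"
      using cV wq by (intro power_mono divide_right_mono mult_left_mono) auto
    finally have 1: "real (card V choose w) \<le> (exp 1 * (C * n0) / real w) ^ w" .
    have "real (E choose q) \<le> (exp 1 * real E / real q) ^ q" using w by (intro binomial_upper_bound) auto
    also have "\<dots> \<le> (exp 1 * (D * n0) / real w) ^ q"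
      using cE wq n0 D by (intro power_mono frac_le mult_left_mono) auto
    finally have 2: "real (E choose q) \<le> (exp 1 * (D * n0) / real w) ^ q" .
    obtain j where q: "q = w + j" using w by (metis le_add_diff_inverse)
    have "real (card V choose w) * real (E choose q) * (real w / n0) ^ (2 * q) \<le>
        (exp 1 * (C * n0) / real w) ^ w * (exp 1 * (D * n0) / real w) ^ q * (real w / n0) ^ (2 * q)"
      using 1 2 n0 C D wq by (intro mult_right_mono mult_mono) auto
    \<comment> \<open>Here \<open>w\<close> of the edges are paired with the vertices; all powers of
      \<open>n0\<close> and \<open>w\<close> cancel within such a pair.\<close>
    also have "\<dots> = ((exp 1 * (C * n0) / real w) * (exp 1 * (D * n0) / real w) * (real w / n0)\<^sup>2) ^ w *
        ((exp 1 * (D * n0) / real w) * (real w / n0)\<^sup>2) ^ j"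
    proof -
      have "a ^ w * b ^ (w + j) * y ^ (w + j) = (a * b * y) ^ w * (b * y) ^ j" for a b y :: real
        by (simp only: power_add power_mult_distrib mult_ac)
      then have "a ^ w * b ^ (w + j) * z ^ (2 * (w + j)) = (a * b * z\<^sup>2) ^ w * (b * z\<^sup>2) ^ j" for a b z :: real
        by (simp only: power_mult)
      then show ?thesis unfolding q by (simp only:)
    qed
    also have "(exp 1 * (C * n0) / real w) * (exp 1 * (D * n0) / real w) * (real w / n0)\<^sup>2 = A"
      using wq n0 unfolding A_def by (simp add: power2_eq_square exp_add[symmetric])
    also have "(exp 1 * (D * n0) / real w) * (real w / n0)\<^sup>2 = exp 1 * D * real w / n0"
      using wq n0 by (simp add: power2_eq_square)
    finally show "real (card V choose w) * real (E choose q) * (real w / n0) ^ (2 * q) \<le> A ^ w * (exp 1 * D * real w / n0) ^ (q - w)"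
      unfolding q by simp
  qed simp
  finally show ?thesis .
qed

lemma markov_count:
  fixes Y :: "(nat \<Rightarrow> 'o) \<Rightarrow> real"
  assumes "\<And>\<omega>. 0 \<le> Y \<omega>" "(\<Sum>\<omega>\<in>\<Omega>. Y \<omega>) \<le> real (card \<Omega>) * m" "0 < T"
  shows "real (card {\<omega> \<in> \<Omega>. T \<le> Y \<omega>}) \<le> real (card \<Omega>) * (m / T)"
proof -
  have "T * real (card {\<omega> \<in> \<Omega>. T \<le> Y \<omega>}) = (\<Sum>\<omega>\<in>{\<omega> \<in> \<Omega>. T \<le> Y \<omega>}. T)" by simp
  also have "\<dots> \<le> (\<Sum>\<omega>\<in>{\<omega> \<in> \<Omega>. T \<le> Y \<omega>}. Y \<omega>)" by (intro sum_mono) auto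
  also have "\<dots> \<le> (\<Sum>\<omega>\<in>\<Omega>. Y \<omega>)" using fin_\<Omega> assms(1) by (intro sum_mono2) auto
  finally show ?thesis using assms by (simp add: field_simps)
qed

text \<open>Three kinds of bad outcomes, each at most a third of all and two of them strictly less:
  some score exceeds its mean, some set of at most \<open>s\<close> vertices is too dense, or there
  are too many small sets with as many edges as vertices.\<close>

lemma good_outcome:
  fixes \<G> :: "('o \<Rightarrow> real) set" and \<mu> \<epsilon> \<kappa> :: real and s g :: nat
  assumes G: "finite \<G>" "\<And>f x. f \<in> \<G> \<Longrightarrow> 0 \<le> f x \<and> f x \<le> 1" "\<And>f. f \<in> \<G> \<Longrightarrow> (\<Sum>x\<in>Z. f x) \<le> \<mu> * real (card Z)"
    and \<epsilon>: "0 < \<epsilon>" "\<epsilon> \<le> 2" and \<kappa>: "0 < \<kappa>"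
    and h1: "real (card \<G>) * exp (- (\<epsilon>\<^sup>2 / 4) * real E) < 1/3"
    and h2: "(\<Sum>w=1..s. A ^ w * (exp 1 * D * real w / n0) ^ nat \<lceil>\<kappa> * real w\<rceil>) < 1/3"
    and h3: "0 < T" "3 * (\<Sum>w=1..g. A ^ w) \<le> T"
  shows "\<exists>\<omega>\<in>\<Omega>. (\<forall>f\<in>\<G>. (\<Sum>e<E. f (\<omega> e)) \<le> (\<mu> + \<epsilon>) * real E) \<and>
     (\<forall>w\<in>{1..s}. dense_pairs w (w + nat \<lceil>\<kappa> * real w\<rceil>) \<omega> = {}) \<and>
     (\<Sum>w=1..g. real (card (dense_pairs w w \<omega>))) < T"
proof -
  let ?q = "\<lambda>w. w + nat \<lceil>\<kappa> * real w\<rceil>"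
  let ?B1 = "\<Union>f\<in>\<G>. {\<omega> \<in> \<Omega>. (\<mu> + \<epsilon>) * real E < (\<Sum>e<E. f (\<omega> e))}"
  let ?B2 = "{\<omega> \<in> \<Omega>. 1 \<le> (\<Sum>w=1..s. real (card (dense_pairs w (?q w) \<omega>)))}"
  let ?B3 = "{\<omega> \<in> \<Omega>. T \<le> (\<Sum>w=1..g. real (card (dense_pairs w w \<omega>)))}"
  let ?N = "real (card \<Omega>)"
  have N: "0 < ?N" unfolding card_\<Omega> using O_ne finO by (simp add: card_gt_0_iff)
  have "real (card ?B1) \<le> (\<Sum>f\<in>\<G>. real (card {\<omega> \<in> \<Omega>. (\<mu> + \<epsilon>) * real E < (\<Sum>e<E. f (\<omega> e))}))"
    unfolding of_nat_sum[symmetric] of_nat_le_iff by (rule card_UN_le[OF G(1)])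
  also have "\<dots> \<le> (\<Sum>f\<in>\<G>. ?N * exp (- (\<epsilon>\<^sup>2 / 4) * real E))"
    unfolding card_\<Omega> unfolding \<Omega>_def by (intro sum_mono chernoff_count) (use finO G \<epsilon> in auto)
  also have "\<dots> = ?N * (real (card \<G>) * exp (- (\<epsilon>\<^sup>2 / 4) * real E))" by simp
  also have "\<dots> < ?N * (1/3)" using h1 N by (intro mult_strict_left_mono) auto
  finally have b1: "real (card ?B1) < ?N * (1/3)" .
  have "(\<Sum>\<omega>\<in>\<Omega>. \<Sum>w=1..s. real (card (dense_pairs w (?q w) \<omega>))) =
      (\<Sum>w=1..s. \<Sum>\<omega>\<in>\<Omega>. real (card (dense_pairs w (?q w) \<omega>)))" by (rule sum.swap)
  also have "\<dots> \<le> (\<Sum>w=1..s. ?N * (A ^ w * (exp 1 * D * real w / n0) ^ (?q w - w)))"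
    by (intro sum_mono sum_dense_pairs) auto
  also have "\<dots> = ?N * (\<Sum>w=1..s. A ^ w * (exp 1 * D * real w / n0) ^ nat \<lceil>\<kappa> * real w\<rceil>)"
    by (simp add: sum_distrib_left)
  finally have "real (card ?B2) \<le> ?N * ((\<Sum>w=1..s. A ^ w * (exp 1 * D * real w / n0) ^ nat \<lceil>\<kappa> * real w\<rceil>) / 1)"
    by (intro markov_count) (auto intro: sum_nonneg)
  also have "\<dots> < ?N * (1/3)" using h2 N by (intro mult_strict_left_mono) auto
  finally have b2: "real (card ?B2) < ?N * (1/3)" .
  have "(\<Sum>\<omega>\<in>\<Omega>. \<Sum>w=1..g. real (card (dense_pairs w w \<omega>))) =
      (\<Sum>w=1..g. \<Sum>\<omega>\<in>\<Omega>. real (card (dense_pairs w w \<omega>)))" by (rule sum.swap)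
  also have "\<dots> \<le> (\<Sum>w=1..g. ?N * (A ^ w * (exp 1 * D * real w / n0) ^ (w - w)))"
    by (intro sum_mono sum_dense_pairs) auto
  also have "\<dots> = ?N * (\<Sum>w=1..g. A ^ w)" by (simp add: sum_distrib_left)
  finally have "real (card ?B3) \<le> ?N * ((\<Sum>w=1..g. A ^ w) / T)"
    using h3 by (intro markov_count) (auto intro: sum_nonneg)
  also have "\<dots> \<le> ?N * (1/3)" using h3 by (intro mult_left_mono) (auto simp: field_simps)
  finally have b3: "real (card ?B3) \<le> ?N * (1/3)" .
  have "card (?B1 \<union> ?B2 \<union> ?B3) \<le> card ?B1 + card ?B2 + card ?B3"
    by (meson card_Un_le add_right_mono order_trans)
  then have "real (card (?B1 \<union> ?B2 \<union> ?B3)) < ?N" using b1 b2 b3 by linarith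
  then have "?B1 \<union> ?B2 \<union> ?B3 \<noteq> \<Omega>" by auto
  then obtain \<omega> where \<omega>: "\<omega> \<in> \<Omega>" "\<omega> \<notin> ?B1" "\<omega> \<notin> ?B2" "\<omega> \<notin> ?B3" by blast
  have "dense_pairs w (?q w) \<omega> = {}" if w: "w \<in> {1..s}" for w
  proof (rule ccontr)
    assume "dense_pairs w (?q w) \<omega> \<noteq> {}"
    then have "1 \<le> real (card (dense_pairs w (?q w) \<omega>))"
      using finite_dense_pairs by (simp add: Suc_le_eq card_gt_0_iff)
    also have "\<dots> \<le> (\<Sum>w=1..s. real (card (dense_pairs w (?q w) \<omega>)))" using w by (intro member_le_sum) auto
    finally show False using \<omega> by simp
  qed
  then show ?thesis using \<omega> by (intro bexI[of _ \<omega>]) (auto simp: not_less not_le)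
qed

definition ends :: "(nat \<Rightarrow> 'o) \<Rightarrow> nat \<Rightarrow> 'v set" where "ends \<omega> e = {hd_of (\<omega> e), tl_of (\<omega> e)}"

text \<open>The deleted set \<open>R\<close> consists of all edges on short cycles.\<close>

lemma prune:
  fixes \<kappa> :: real and s g :: nat
  assumes hdV: "\<And>e. e < E \<Longrightarrow> hd_of (\<omega> e) \<in> V \<and> tl_of (\<omega> e) \<in> V \<and> hd_of (\<omega> e) \<noteq> tl_of (\<omega> e)"
    and sparse: "\<forall>w\<in>{1..s}. dense_pairs w (w + nat \<lceil>\<kappa> * real w\<rceil>) \<omega> = {}"
    and few: "(\<Sum>w=1..g. real (card (dense_pairs w w \<omega>))) < T"
    and \<kappa>: "0 < \<kappa>" and g: "0 < g" and small: "2 * (\<kappa> + 1 / real g) < 1" and s: "2 \<le> s"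
  shows "\<exists>R\<subseteq>{..<E}. real (card R) \<le> real g * T \<and> inj_on (ends \<omega>) ({..<E} - R) \<and>
    sparse_upto s (\<kappa> + 1 / real g) (ends \<omega> ` ({..<E} - R))"
proof -
  let ?\<kappa> = "\<kappa> + 1 / real g"
  define DP where "DP = (SIGMA w:{1..g}. dense_pairs w w \<omega>)"
  define R where "R = (\<Union>p\<in>DP. snd (snd p))"
  have finDP: "finite DP" unfolding DP_def using finite_dense_pairs by auto
  have RE: "R \<subseteq> {..<E}" unfolding R_def DP_def dense_pairs_def by auto
  have "card R \<le> (\<Sum>p\<in>DP. card (snd (snd p)))" unfolding R_def by (rule card_UN_le[OF finDP])
  also have "\<dots> \<le> (\<Sum>p\<in>DP. g)" by (intro sum_mono) (auto simp: DP_def dense_pairs_def)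
  finally have "real (card R) \<le> real g * real (card DP)" by (metis mult.commute of_nat_le_iff of_nat_mult sum_constant of_nat_id)
  also have "real (card DP) = (\<Sum>w=1..g. real (card (dense_pairs w w \<omega>)))"
    unfolding DP_def using finite_dense_pairs by (subst card_SigmaI) auto
  finally have cR: "real (card R) \<le> real g * T" using few g by (meson less_imp_le mult_left_mono of_nat_0_le_iff order_trans)
  have main: "real (card F) - real (card (\<Union>e\<in>F. ends \<omega> e)) + 1 \<le> ?\<kappa> * real (card F)"
    if F: "F \<subseteq> {..<E} - R" "F \<noteq> {}" "card F \<le> s" for F
  proof -
    define W where "W = (\<Union>e\<in>F. ends \<omega> e)"
    define w where "w = card W"
    have finF: "finite F" using F finite_subset by blast
    have WV: "W \<subseteq> V" unfolding W_def ends_def using F hdV by fastforce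
    have finW: "finite W" using WV finV finite_subset by blast
    have "W \<noteq> {}" using F unfolding W_def ends_def by auto
    then have w1: "1 \<le> w" using finW unfolding w_def by (simp add: Suc_le_eq card_gt_0_iff)
    have ins: "inside \<omega> e W" if "e \<in> F" for e using that unfolding inside_def W_def ends_def by auto
    show ?thesis
    proof (cases "card F < w")
      case True
      then have "real (card F) + 1 \<le> real w" by linarith
      moreover have "0 \<le> ?\<kappa> * real (card F)" using \<kappa> by simp
      ultimately show ?thesis unfolding w_def W_def by linarith
    next
      case False
      then have wF: "w \<le> card F" by simp
      \<comment> \<open>Otherwise \<open>w\<close> edges of \<open>F\<close> inside the small set
        \<open>W\<close> form a pair recorded in \<open>DP\<close> and would have been
        deleted.\<close>
      have "g < w"
      proof (rule ccontr)
        assume "\<not> g < w"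
        obtain F' where F': "F' \<subseteq> F" "card F' = w" using obtain_subset_with_card_n[OF wF] by blast
        have "(w, W, F') \<in> DP" unfolding DP_def dense_pairs_def
          using WV w1 \<open>\<not> g < w\<close> F' F ins by (auto simp: w_def)
        then have "F' \<subseteq> R" unfolding R_def by force
        then show False using F' F w1 by (metis Diff_eq_empty_iff Diff_subset_conv Int_Diff Un_Diff_cancel2 card.empty disjoint_iff inf.absorb_iff1 not_one_le_zero subset_eq DiffD2 equals0I)
      qed
      moreover have "card F < w + nat \<lceil>\<kappa> * real w\<rceil>"
      proof (rule ccontr)
        assume "\<not> card F < w + nat \<lceil>\<kappa> * real w\<rceil>"
        then obtain F' where F': "F' \<subseteq> F" "card F' = w + nat \<lceil>\<kappa> * real w\<rceil>" using obtain_subset_with_card_n[of "w + nat \<lceil>\<kappa> * real w\<rceil>" F] by auto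
        have "(W, F') \<in> dense_pairs w (w + nat \<lceil>\<kappa> * real w\<rceil>) \<omega>" unfolding dense_pairs_def
          using WV F' F ins by (auto simp: w_def)
        then show False using sparse w1 wF F(3) by auto
      qed
      \<comment> \<open>Rounding up costs less than one edge; as \<open>w\<close> exceeds
        \<open>g\<close>, this unit is paid for by \<open>w / g\<close>, which is where the summand
        \<open>1 / g\<close> comes from.\<close>
      moreover have "real (nat \<lceil>\<kappa> * real w\<rceil>) < \<kappa> * real w + 1" using \<kappa> by (simp add: of_nat_nat) linarith
      ultimately have "real (card F) - real w + 1 \<le> \<kappa> * real w + 1" "real g \<le> real w" by linarith+
      moreover have "1 \<le> real w / real g" using \<open>g < w\<close> g by simp
      moreover have "?\<kappa> * real w \<le> ?\<kappa> * real (card F)" using wF \<kappa> by (intro mult_left_mono) auto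
      ultimately show ?thesis unfolding w_def[symmetric, unfolded W_def] by (simp add: distrib_right)
    qed
  qed
  \<comment> \<open>Two parallel edges span two vertices and have excess 1, more than sparsity
    allows two edges. So the surviving graph is simple.\<close>
  have inj: "inj_on (ends \<omega>) ({..<E} - R)"
  proof (rule inj_onI, rule ccontr)
    fix e e' assume e: "e \<in> {..<E} - R" "e' \<in> {..<E} - R" "ends \<omega> e = ends \<omega> e'" "e \<noteq> e'"
    have "real (card {e, e'}) - real (card (\<Union>x\<in>{e, e'}. ends \<omega> x)) + 1 \<le> ?\<kappa> * real (card {e, e'})"
      by (rule main) (use e s in auto)
    moreover have "(\<Union>x\<in>{e, e'}. ends \<omega> x) = ends \<omega> e" using e by auto
    moreover have "card (ends \<omega> e) = 2" unfolding ends_def using hdV[of e] e by simp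
    ultimately show False using e small by (simp add: algebra_simps)
  qed
  have "sparse_upto s ?\<kappa> (ends \<omega> ` ({..<E} - R))"
    unfolding sparse_upto_def
  proof (intro allI impI)
    fix F assume F: "F \<subseteq> ends \<omega> ` ({..<E} - R)" "F \<noteq> {} \<and> finite F \<and> card F \<le> s"
    then obtain F' where F': "F' \<subseteq> {..<E} - R" "F = ends \<omega> ` F'" by (auto simp: subset_image_iff)
    have "card F = card F'" unfolding F'(2) by (rule card_image) (use inj F' inj_on_subset in blast)
    then show "real (card F) - real (card (\<Union>F)) + 1 \<le> ?\<kappa> * real (card F)"
      using main[of F'] F F' by auto
  qed
  then show ?thesis using RE cR inj by blast
qed

end

section \<open>Instances and integral pricings\<close>

text \<open>Vertex \<open>t * n0 + u\<close> has type \<open>t\<close>. An outcome \<open>(x, u, v, i)\<close> is an edge from the higher type \<open>c' x\<close>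
  to the lower type \<open>c x\<close>, whose budget \<open>M ^ (c x * m + i)\<close> is on the price scale of the lower endpoint.\<close>

locale gadget =
  fixes C m M n0 :: nat and X :: "'x set" and c c' :: "'x \<Rightarrow> nat"
  assumes finX: "finite X" and X_ne: "X \<noteq> {}" and cc: "\<And>x. x \<in> X \<Longrightarrow> c x < c' x \<and> c' x < C"
    and m: "2 \<le> m" and M: "2 \<le> M" and n0: "1 \<le> n0"
begin

text \<open>The label \<open>i\<close> starts at 1 because label 0 is reserved for the price
  0.\<close>

definition Z :: "('x \<times> nat \<times> nat \<times> nat) set" where "Z = X \<times> {..<n0} \<times> {..<n0} \<times> {1..<m}"

definition tl_of :: "'x \<times> nat \<times> nat \<times> nat \<Rightarrow> nat" where "tl_of = (\<lambda>(x, u, v, i). c' x * n0 + u)"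
definition hd_of :: "'x \<times> nat \<times> nat \<times> nat \<Rightarrow> nat" where "hd_of = (\<lambda>(x, u, v, i). c x * n0 + v)"
definition lev_of :: "'x \<times> nat \<times> nat \<times> nat \<Rightarrow> nat" where "lev_of = (\<lambda>(x, u, v, i). c x * m + i)"
definition lab_of :: "'x \<times> nat \<times> nat \<times> nat \<Rightarrow> nat" where "lab_of = (\<lambda>(x, u, v, i). i)"

definition V :: "nat set" where "V = {..<C * n0}"

lemma block_less: "t < C \<Longrightarrow> u < n0 \<Longrightarrow> t * n0 + u < C * n0"
proof -
  assume "t < C" "u < n0"
  then have "t * n0 + u < (t + 1) * n0" by simp
  also have "\<dots> \<le> C * n0" using \<open>t < C\<close> by (intro mult_right_mono) auto
  finally show ?thesis .
qed

lemma Z_props: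
  assumes "z \<in> Z"
  shows "tl_of z \<in> V" "hd_of z \<in> V" "tl_of z \<noteq> hd_of z" "1 \<le> lev_of z" "lev_of z < C * m"
    "1 \<le> lab_of z" "lab_of z < m" "lev_of z = (hd_of z div n0) * m + lab_of z"
proof -
  obtain x u v i where z: "z = (x, u, v, i)" "x \<in> X" "u < n0" "v < n0" "1 \<le> i" "i < m" using assms unfolding Z_def by auto
  note t = cc[OF z(2)]
  show "tl_of z \<in> V" "hd_of z \<in> V" using block_less t z unfolding V_def tl_of_def hd_of_def by auto
  have "c x * n0 + v < (c x + 1) * n0" using z by simp
  also have "\<dots> \<le> c' x * n0" using t by (intro mult_right_mono) auto
  finally show "tl_of z \<noteq> hd_of z" unfolding z tl_of_def hd_of_def by simp
  have "c x * m + i < (c x + 1) * m" using z by simp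
  also have "\<dots> \<le> C * m" using t by (intro mult_right_mono) auto
  finally show "lev_of z < C * m" unfolding z lev_of_def by simp
  show "1 \<le> lev_of z" "1 \<le> lab_of z" "lab_of z < m" "lev_of z = (hd_of z div n0) * m + lab_of z"
    using z unfolding lev_of_def lab_of_def hd_of_def by auto
qed

lemma finite_Z: "finite Z" unfolding Z_def using finX by auto
lemma Z_ne: "Z \<noteq> {}" unfolding Z_def using X_ne n0 m by (auto simp: lessThan_empty_iff)

lemma card_Z: "real (card Z) = real (card X) * (real n0)\<^sup>2 * (real m - 1)"
  unfolding Z_def using m by (simp add: card_cartesian_product power2_eq_square of_nat_diff)

lemma sum_Z: "(\<Sum>z\<in>Z. F z) = (\<Sum>x\<in>X. \<Sum>u<n0. \<Sum>v<n0. \<Sum>i\<in>{1..<m}. F (x, u, v, i))" for F :: "_ \<Rightarrow> real"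
  unfolding Z_def by (simp add: sum.cartesian_product')

text \<open>Given the pair of types, the endpoints are independent and uniform in two blocks of
  \<open>n0\<close> vertices, and \<open>W\<close> meets each block in at most \<open>card W\<close>
  points.\<close>

lemma density:
  assumes "W \<subseteq> V"
  shows "real (card {z \<in> Z. hd_of z \<in> W \<and> tl_of z \<in> W}) \<le> real (card Z) * (real (card W) / real n0)\<^sup>2"
proof -
  have finW: "finite W" using assms finite_subset unfolding V_def by blast
  have one: "(\<Sum>u<n0. of_bool (t * n0 + u \<in> W)) \<le> real (card W)" for t
  proof -
    have "(\<Sum>u<n0. of_bool (t * n0 + u \<in> W)) = real (card {u \<in> {..<n0}. t * n0 + u \<in> W})"
      by (simp add: of_bool_def sum.If_cases Int_def)
    also have "\<dots> \<le> real (card W)"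
      unfolding of_nat_le_iff by (rule card_inj_on_le[of "\<lambda>u. t * n0 + u"]) (use finW in \<open>auto simp: inj_on_def\<close>)
    finally show ?thesis .
  qed
  have "real (card {z \<in> Z. hd_of z \<in> W \<and> tl_of z \<in> W}) = (\<Sum>z\<in>Z. of_bool (hd_of z \<in> W \<and> tl_of z \<in> W))"
    using finite_Z by (simp add: of_bool_def sum.If_cases Int_def)
  also have "\<dots> = (\<Sum>x\<in>X. \<Sum>u<n0. \<Sum>v<n0. \<Sum>i\<in>{1..<m}. of_bool (c' x * n0 + u \<in> W) * of_bool (c x * n0 + v \<in> W))"
    unfolding sum_Z hd_of_def tl_of_def by (intro sum.cong refl) auto
  also have "\<dots> = (\<Sum>x\<in>X. (real m - 1) * ((\<Sum>u<n0. of_bool (c' x * n0 + u \<in> W)) * (\<Sum>v<n0. of_bool (c x * n0 + v \<in> W))))"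
  proof -
    have "(\<Sum>u<n0. \<Sum>v<n0. \<Sum>i\<in>{1..<m}. P u * Q v) = (real m - 1) * ((\<Sum>u<n0. P u) * (\<Sum>v<n0. Q v))" for P Q :: "nat \<Rightarrow> real"
    proof -
      have "(real m - 1) * ((\<Sum>u<n0. P u) * (\<Sum>v<n0. Q v)) = (\<Sum>u<n0. \<Sum>v<n0. (real m - 1) * (P u * Q v))"
        unfolding sum_product unfolding sum_distrib_left ..
      then show ?thesis using m by (simp add: of_nat_diff)
    qed
    then show ?thesis by (simp only:)
  qed
  also have "\<dots> \<le> (\<Sum>x\<in>X. (real m - 1) * (real (card W) * real (card W)))"
    using m by (intro sum_mono mult_left_mono mult_mono one) (auto intro: sum_nonneg)
  also have "\<dots> = real (card Z) * (real (card W) / real n0)\<^sup>2"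
    unfolding card_Z using n0 by (simp add: power2_eq_square)
  finally show ?thesis .
qed

text \<open>A combinatorial stand-in for the revenue of an edge. It depends on a pricing only
  through its levels, of which there are finitely many, so that a union bound over pricings becomes
  possible.\<close>

definition score :: "(nat \<Rightarrow> nat) \<Rightarrow> 'x \<times> nat \<times> nat \<times> nat \<Rightarrow> real" where
  "score f z = of_bool (max (f (tl_of z)) (f (hd_of z)) = lev_of z)"

definition block :: "nat \<Rightarrow> nat set" where "block t = {t * m + 1..<t * m + m}"

lemma block_less_block: "t < t' \<Longrightarrow> j \<in> block t \<Longrightarrow> j' \<in> block t' \<Longrightarrow> j < j'"
proof -
  assume a: "t < t'" "j \<in> block t" "j' \<in> block t'"
  have "(t + 1) * m \<le> t' * m" using a by (intro mult_right_mono) auto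
  then show ?thesis using a unfolding block_def by simp
qed

definition block_frac :: "(nat \<Rightarrow> nat) \<Rightarrow> nat \<Rightarrow> nat \<Rightarrow> real" where
  "block_frac f t t' = (\<Sum>u<n0. of_bool (f (t * n0 + u) \<in> block t')) / real n0"

lemma block_frac_bounds: "0 \<le> block_frac f t t'" "(\<Sum>t'\<in>S. block_frac f t t') \<le> 1" if "finite S"
proof -
  show "0 \<le> block_frac f t t'" unfolding block_frac_def by (simp add: sum_nonneg)
  have d: "(\<Sum>t'\<in>S. of_bool (j \<in> block t')) \<le> (1::real)" for j
  proof (cases "\<exists>t0\<in>S. j \<in> block t0")
    case True
    then obtain t0 where t0: "t0 \<in> S" "j \<in> block t0" by blast
    have "(\<Sum>t'\<in>S. of_bool (j \<in> block t')) = (\<Sum>t'\<in>{t0}. of_bool (j \<in> block t') :: real)"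
      using that t0 block_less_block by (intro sum.mono_neutral_right) (auto, metis less_irrefl linorder_neqE_nat)
    also have "\<dots> \<le> (\<Sum>t'\<in>{t0}. 1)" by (intro sum_mono) auto
    finally show ?thesis by simp
  next
    case False
    then have "(\<Sum>t'\<in>S. of_bool (j \<in> block t')) = (0::real)" by (intro sum.neutral) auto
    then show ?thesis by simp
  qed
  have "(\<Sum>t'\<in>S. block_frac f t t') = (\<Sum>u<n0. \<Sum>t'\<in>S. of_bool (f (t * n0 + u) \<in> block t')) / real n0"
    unfolding block_frac_def sum_divide_distrib[symmetric] by (subst sum.swap) simp
  also have "\<dots> \<le> (\<Sum>u<n0. 1) / real n0" by (intro divide_right_mono sum_mono d) auto
  also have "\<dots> \<le> 1" by simp
  finally show "(\<Sum>t'\<in>S. block_frac f t t') \<le> 1" .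
qed

text \<open>For given endpoints at most one of the \<open>m - 1\<close> budgets scores. If the
  higher type attains it, that vertex sits on the scales of the lower type: a collision, bounded by
  \<open>col\<close>. Otherwise the lower vertex is on its own scales and the higher one, being no
  more expensive than the budget, lies below its own: the cut, bounded by
  \<open>cut\<close>.\<close>

lemma score_mean:
  assumes cut: "\<And>a. (\<forall>t. 0 \<le> a t \<and> a t \<le> 1) \<Longrightarrow> (\<Sum>x\<in>X. a (c x) * (1 - a (c' x))) \<le> (1/4 + \<eta>) * real (card X)"
    and col: "\<And>b. (\<forall>t t'. 0 \<le> b t t') \<and> (\<forall>t. (\<Sum>t'<C. b t t') \<le> 1) \<Longrightarrow> (\<Sum>x\<in>X. b (c' x) (c x)) \<le> \<eta> * real (card X)"
  shows "(\<Sum>z\<in>Z. score f z) \<le> (1/4 + 2 * \<eta>) / (real m - 1) * real (card Z)"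
proof -
  define a where "a = (\<lambda>t. block_frac f t t)"
  have a: "0 \<le> a t \<and> a t \<le> 1" for t
    using block_frac_bounds(1)[of "{t}" f t t] block_frac_bounds(2)[of "{t}" f t] by (simp add: a_def)
  have n: "0 < real n0" using n0 by simp
  have an: "(\<Sum>v<n0. of_bool (f (t * n0 + v) \<in> block t)) = real n0 * a t" for t unfolding a_def block_frac_def using n by simp
  have bn: "(\<Sum>v<n0. of_bool (f (t * n0 + v) \<in> block t')) = real n0 * block_frac f t t'" for t t' unfolding block_frac_def using n by simp
  have "(\<Sum>z\<in>Z. score f z) \<le> (\<Sum>x\<in>X. (real n0)\<^sup>2 * (a (c x) * (1 - a (c' x)) + block_frac f (c' x) (c x)))"
    unfolding sum_Z
  proof (rule sum_mono)
    fix x assume x: "x \<in> X"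
    note t = cc[OF x]
    have pt: "(\<Sum>i\<in>{1..<m}. score f (x, u, v, i)) \<le>
        of_bool (f (c x * n0 + v) \<in> block (c x)) * (1 - of_bool (f (c' x * n0 + u) \<in> block (c' x))) + of_bool (f (c' x * n0 + u) \<in> block (c x))" for u v
    proof (cases "\<exists>i\<in>{1..<m}. max (f (c' x * n0 + u)) (f (c x * n0 + v)) = c x * m + i")
      case True
      then obtain i where i: "i \<in> {1..<m}" "max (f (c' x * n0 + u)) (f (c x * n0 + v)) = c x * m + i" by blast
      have "(\<Sum>i\<in>{1..<m}. score f (x, u, v, i)) = (\<Sum>i'\<in>{i}. score f (x, u, v, i'))"
        using i by (intro sum.mono_neutral_right) (auto simp: score_def tl_of_def hd_of_def lev_of_def)
      also have "\<dots> = 1" using i by (simp add: score_def tl_of_def hd_of_def lev_of_def)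
      finally have one: "(\<Sum>i\<in>{1..<m}. score f (x, u, v, i)) = 1" .
      have lb: "c x * m + i \<in> block (c x)" using i unfolding block_def by auto
      show ?thesis
      proof (cases "f (c' x * n0 + u) = c x * m + i")
        case True
        then show ?thesis using lb one by (auto simp: of_bool_def)
      next
        case False
        then have e: "f (c x * n0 + v) = c x * m + i" "f (c' x * n0 + u) \<le> c x * m + i" using i by (auto simp: max_def split: if_splits)
        then have "f (c' x * n0 + u) \<notin> block (c' x)" using block_less_block[OF _ lb] t by (meson not_le)
        then show ?thesis using lb one e by simp
      qed
    next
      case False
      then have "(\<Sum>i\<in>{1..<m}. score f (x, u, v, i)) = 0"
        by (intro sum.neutral) (auto simp: score_def tl_of_def hd_of_def lev_of_def)
      then show ?thesis by (simp add: of_bool_def)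
    qed
    have "(\<Sum>u<n0. \<Sum>v<n0. \<Sum>i\<in>{1..<m}. score f (x, u, v, i)) \<le>
       (\<Sum>u<n0. \<Sum>v<n0. of_bool (f (c x * n0 + v) \<in> block (c x)) * (1 - of_bool (f (c' x * n0 + u) \<in> block (c' x))) + of_bool (f (c' x * n0 + u) \<in> block (c x)))"
      by (intro sum_mono pt)
    also have "\<dots> = (\<Sum>v<n0. of_bool (f (c x * n0 + v) \<in> block (c x))) * (real n0 - (\<Sum>u<n0. of_bool (f (c' x * n0 + u) \<in> block (c' x)))) +
       real n0 * (\<Sum>u<n0. of_bool (f (c' x * n0 + u) \<in> block (c x)))"
    proof -
      have "(\<Sum>u<n0. \<Sum>v<n0. p v * (1 - q u) + r u) = (\<Sum>v<n0. p v) * (real n0 - (\<Sum>u<n0. q u)) + real n0 * (\<Sum>u<n0. r u)" for p q r :: "nat \<Rightarrow> real"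
      proof -
        have "(\<Sum>u<n0. \<Sum>v<n0. p v * (1 - q u) + r u) = (\<Sum>u<n0. (\<Sum>v<n0. p v) * (1 - q u) + real n0 * r u)"
          by (simp add: sum.distrib sum_distrib_right)
        also have "\<dots> = (\<Sum>v<n0. p v) * (\<Sum>u<n0. 1 - q u) + real n0 * (\<Sum>u<n0. r u)"
          by (simp only: sum.distrib sum_distrib_left[symmetric])
        finally show ?thesis by (simp add: sum_subtractf)
      qed
      then show ?thesis .
    qed
    also have "\<dots> = (real n0)\<^sup>2 * (a (c x) * (1 - a (c' x)) + block_frac f (c' x) (c x))"
      unfolding an unfolding bn by (simp add: power2_eq_square algebra_simps)
    finally show "(\<Sum>u<n0. \<Sum>v<n0. \<Sum>i\<in>{1..<m}. score f (x, u, v, i)) \<le> (real n0)\<^sup>2 * (a (c x) * (1 - a (c' x)) + block_frac f (c' x) (c x))" .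
  qed
  also have "\<dots> = (real n0)\<^sup>2 * ((\<Sum>x\<in>X. a (c x) * (1 - a (c' x))) + (\<Sum>x\<in>X. block_frac f (c' x) (c x)))"
    by (simp only: sum_distrib_left[symmetric] sum.distrib)
  also have "\<dots> \<le> (real n0)\<^sup>2 * ((1/4 + \<eta>) * real (card X) + \<eta> * real (card X))"
  proof (intro mult_left_mono add_mono)
    show "(\<Sum>x\<in>X. a (c x) * (1 - a (c' x))) \<le> (1/4 + \<eta>) * real (card X)" using cut a by blast
    show "(\<Sum>x\<in>X. block_frac f (c' x) (c x)) \<le> \<eta> * real (card X)"
      by (rule col) (auto intro: block_frac_bounds(1)[of "{}"] block_frac_bounds(2))
  qed simp
  also have "\<dots> = (1/4 + 2 * \<eta>) / (real m - 1) * real (card Z)"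
    unfolding card_Z using m by (simp add: field_simps)
  finally show ?thesis .
qed

text \<open>The cap makes the set of level functions finite and is invisible in comparisons with
  budget levels, all of which are below \<open>C * m\<close>.\<close>

definition level :: "real \<Rightarrow> nat" where "level p = min (LEAST j. p \<le> real M ^ j) (C * m)"

lemma level_props:
  assumes "0 \<le> p" "l < C * m"
  shows "p \<le> real M ^ l \<longleftrightarrow> level p \<le> l" 
proof -
  obtain n where "p < real M ^ n" using real_arch_pow[of "real M" p] M by auto
  then have ex: "p \<le> real M ^ (LEAST j. p \<le> real M ^ j)"
    using LeastI[of "\<lambda>j. p \<le> real M ^ j" n] by simp
  show ?thesis
  proof
    assume "p \<le> real M ^ l"
    then have "(LEAST j. p \<le> real M ^ j) \<le> l" by (rule Least_le)
    then show "level p \<le> l" unfolding level_def by (rule min.coboundedI1)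
  next
    assume "level p \<le> l"
    then have "(LEAST j. p \<le> real M ^ j) \<le> l" unfolding level_def using assms by auto
    then have "real M ^ (LEAST j. p \<le> real M ^ j) \<le> real M ^ l" using M by (intro power_increasing) auto
    then show "p \<le> real M ^ l" using ex by linarith
  qed
qed

text \<open>If both prices lie below the budget scale, they are at most \<open>M ^ (l - 1)\<close>
  each and earn at most \<open>2 / M\<close> after weighting; in every other case the edge earns at
  most 1.\<close>

lemma edge_value:
  assumes p: "0 \<le> p" "0 \<le> q" and l: "1 \<le> l" "l < C * m"
  shows "1 / real M ^ l * (p + q) * of_bool (p + q \<le> real M ^ l) \<le> of_bool (max (level p) (level q) = l) + 2 / real M"
proof (cases "p + q \<le> real M ^ l")
  case True
  have Ml: "0 < real M ^ l" using M by simp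
  have le: "level p \<le> l" "level q \<le> l" using True p level_props[OF p(1) l(2)] level_props[OF p(2) l(2)] by linarith+
  show ?thesis
  proof (cases "max (level p) (level q) = l")
    case True2: True
    have "1 / real M ^ l * (p + q) \<le> 1" using True Ml by simp
    moreover have "0 \<le> 2 / real M" by simp
    ultimately have "1 / real M ^ l * (p + q) \<le> 1 + 2 / real M" by linarith
    then show ?thesis by (simp only: True True2 of_bool_eq mult_1_right simp_thms)
  next
    case False
    then have "level p \<le> l - 1" "level q \<le> l - 1" using le by (auto simp: max_def split: if_splits)
    then have "p \<le> real M ^ (l - 1)" "q \<le> real M ^ (l - 1)"
      using level_props[OF p(1), of "l - 1"] level_props[OF p(2), of "l - 1"] l by auto
    moreover have "real M ^ l = real M * real M ^ (l - 1)" using l by (simp add: power_eq_if)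
    moreover from calculation have "(p + q) * real M \<le> (2 * real M ^ (l - 1)) * real M" by (intro mult_right_mono) auto
    ultimately have "1 / real M ^ l * (p + q) \<le> 2 / real M" using M by (simp add: field_simps)
    then show ?thesis using True False by simp
  qed
next
  case False
  then show ?thesis by simp
qed

definition scores :: "('x \<times> nat \<times> nat \<times> nat \<Rightarrow> real) set" where
  "scores = score ` (V \<rightarrow>\<^sub>E {..C * m})"

lemma finite_scores: "finite scores" unfolding scores_def V_def by (intro finite_imageI finite_PiE) auto

lemma card_scores: "card scores \<le> (C * m + 1) ^ (C * n0)"
proof -
  have "card scores \<le> card (V \<rightarrow>\<^sub>E {..C * m})" unfolding scores_def V_def by (intro card_image_le finite_PiE) auto
  also have "\<dots> = (C * m + 1) ^ (C * n0)" unfolding V_def by (simp add: card_PiE)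
  finally show ?thesis .
qed

definition inst :: "nat set \<Rightarrow> (nat \<Rightarrow> 'x \<times> nat \<times> nat \<times> nat) \<Rightarrow> (nat, nat) pricing_instance" where
  "inst Es \<omega> = \<lparr>verts = V, edges = Es, end1 = (\<lambda>e. tl_of (\<omega> e)), end2 = (\<lambda>e. hd_of (\<omega> e)),
     budget = (\<lambda>e. real M ^ lev_of (\<omega> e)), weight = (\<lambda>e. 1 / real M ^ lev_of (\<omega> e))\<rparr>"

lemma inst_valid:
  assumes "Es \<subseteq> {..<E}" "Es \<noteq> {}" "\<And>e. e < E \<Longrightarrow> \<omega> e \<in> Z"
  shows "graph_pricing_instance (inst Es \<omega>)"
proof -
  have "tl_of (\<omega> e) \<in> V \<and> hd_of (\<omega> e) \<in> V \<and> tl_of (\<omega> e) \<noteq> hd_of (\<omega> e)" if "e \<in> Es" for e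
    using Z_props(1-3)[of "\<omega> e"] assms that by auto
  moreover have "finite Es" using assms(1) finite_subset by blast
  moreover have "finite V" unfolding V_def by simp
  ultimately show ?thesis using assms(2) M unfolding graph_pricing_instance_def inst_def by simp
qed

text \<open>Rounding to levels reduces an arbitrary pricing to one of finitely many scores. The
  deleted edges may be put back into the sum because every score is nonnegative.\<close>

lemma inst_opt:
  assumes Es: "Es \<subseteq> {..<E}" and \<omega>: "\<And>e. e < E \<Longrightarrow> \<omega> e \<in> Z"
    and sc: "\<forall>f\<in>scores. (\<Sum>e<E. f (\<omega> e)) \<le> b * real E"
  shows "pricing_opt (inst Es \<omega>) \<le> (b + 2 / real M) * real E"
  unfolding pricing_opt_def
proof (rule cSUP_least)
  show "pricings (inst Es \<omega>) \<noteq> {}" unfolding pricings_def by (auto intro!: exI[of _ "\<lambda>_. 0"])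
next
  fix p assume "p \<in> pricings (inst Es \<omega>)"
  then have p: "0 \<le> p v" if "v \<in> V" for v using that unfolding pricings_def inst_def by simp
  define f where "f = restrict (\<lambda>v. level (p v)) V"
  have fE: "score f \<in> scores" unfolding scores_def f_def by (auto simp: level_def)
  have bd: "1 / real M ^ lev_of z * (p (tl_of z) + p (hd_of z)) * of_bool (p (tl_of z) + p (hd_of z) \<le> real M ^ lev_of z) \<le>
      score f z + 2 / real M" if "z \<in> Z" for z
    using edge_value[OF p[OF Z_props(1)[OF that]] p[OF Z_props(2)[OF that]] Z_props(4,5)[OF that]] Z_props(1,2)[OF that]
    unfolding score_def f_def by simp
  have "pricing_val (inst Es \<omega>) p \<le> (\<Sum>e\<in>Es. score f (\<omega> e) + 2 / real M)"
    unfolding pricing_val_def inst_def pricing_instance.simps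
  proof (rule sum_mono)
    fix e assume "e \<in> Es"
    then have "\<omega> e \<in> Z" using Es \<omega> by auto
    then show "1 / real M ^ lev_of (\<omega> e) * (p (tl_of (\<omega> e)) + p (hd_of (\<omega> e))) *
        of_bool (p (tl_of (\<omega> e)) + p (hd_of (\<omega> e)) \<le> real M ^ lev_of (\<omega> e)) \<le> score f (\<omega> e) + 2 / real M" by (rule bd)
  qed
  also have "\<dots> \<le> (\<Sum>e<E. score f (\<omega> e) + 2 / real M)"
    using Es by (intro sum_mono2) (auto simp: score_def)
  also have "\<dots> = (\<Sum>e<E. score f (\<omega> e)) + real E * (2 / real M)" by (simp add: sum.distrib)
  also have "\<dots> \<le> b * real E + real E * (2 / real M)" using sc fE by auto
  finally show "pricing_val (inst Es \<omega>) p \<le> (b + 2 / real M) * real E" by (simp add: algebra_simps)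
qed

end

section \<open>Choice of parameters\<close>

lemma nat_floor_bounds:
  fixes x :: real
  assumes "0 \<le> x" shows "real (nat \<lfloor>x\<rfloor>) \<le> x" "x - 1 \<le> real (nat \<lfloor>x\<rfloor>)"
proof -
  have "real (nat \<lfloor>x\<rfloor>) = of_int \<lfloor>x\<rfloor>" using assms by simp
  then show "real (nat \<lfloor>x\<rfloor>) \<le> x" "x - 1 \<le> real (nat \<lfloor>x\<rfloor>)"
    using of_int_floor_le[of x] real_of_int_floor_add_one_gt[of x] by linarith+
qed

text \<open>\<open>admissible A D \<mu> e n r\<close> collects what the construction needs for \<open>r\<close> rounds on blocks of \<open>n\<close> vertices:
  kernel range \<open>L\<close>, sparsity \<open>\<kappa>'\<close> of edge sets of size up to \<open>s\<close>, and deletion of the cycles of length up to \<open>g\<close>.\<close>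

definition admissible :: "real \<Rightarrow> real \<Rightarrow> real \<Rightarrow> real \<Rightarrow> nat \<Rightarrow> nat \<Rightarrow> bool" where
  "admissible A D \<mu> e n r \<longleftrightarrow> (\<exists>L s g \<kappa> \<kappa>'.
     0 < \<kappa> \<and> 0 < g \<and> 2 \<le> s \<and> 2 \<le> L \<and> 2 * L + 1 \<le> s \<and> \<kappa> + 1 / real g \<le> \<kappa>' \<and> 0 < \<kappa>' \<and> 3 * real L * \<kappa>' < 1 \<and> 2 * \<kappa>' < 1 \<and>
     (\<Sum>w=1..s. A ^ w * (exp 1 * D * real w / real n) ^ nat \<lceil>\<kappa> * real w\<rceil>) < 1/3 \<and>
     real g * (3 * (\<Sum>w=1..g. A ^ w) + 1) \<le> e * real n \<and>
     2 \<le> r \<and>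
     r * r * L \<le> s \<and>
     4 * (1 - \<mu>) ^ L / (1 - (1 - \<mu>)\<^sup>2) *
       real (r * r * L) * real (r) \<le> \<mu>)"

text \<open>\<open>L\<close>, \<open>g\<close> and \<open>1 / \<kappa>\<close> are of order
  \<open>ln n\<close> and \<open>s\<close> of order \<open>n powr (1/4)\<close>. Only the kernel
  error of order \<open>(1 - \<mu>) ^ L\<close> and the size \<open>r * r * L\<close> of the local
  subgraphs restrict the number of rounds.\<close>

lemma parameters_exist:
  fixes A C D \<mu> e :: real
  assumes A: "exp 2 \<le> A" and C: "1 \<le> C" and D: "1 \<le> D" and \<mu>: "0 < \<mu>" "\<mu> < 1" and e: "0 < e"
  shows "\<exists>\<delta>>0. \<forall>\<^sub>F n in sequentially. admissible A D \<mu> e n (nat \<lfloor>(C * real n) powr \<delta>\<rfloor>)"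
proof -
  define \<Lambda> where "\<Lambda> = ln (8 * A)"
  have A0: "0 < A" "1 \<le> A" using A exp_ge_add_one_self[of "2::real"] by linarith+
  have lnA: "2 \<le> ln A" using A A0 by (simp add: ln_ge_iff)
  have \<Lambda>: "ln A \<le> \<Lambda>" "2 \<le> \<Lambda>" "0 < \<Lambda>" using lnA A0 unfolding \<Lambda>_def by (simp_all add: ln_mult)
      (smt (verit) ln_ge_zero)+
  define q where "q = - ln (1 - \<mu>)"
  have q: "0 < q" using \<mu> unfolding q_def by (simp add: ln_less_zero)
  \<comment> \<open>Chosen such that \<open>L\<close> close to
    \<open>ln n / (40 * \<Lambda>)\<close> gives \<open>(1 - \<mu>) ^ L\<close> of order
    \<open>n powr (- \<beta>)\<close>.\<close>
  define \<beta> where "\<beta> = q / (40 * \<Lambda>)"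
  have \<beta>: "0 < \<beta>" using q \<Lambda> by (simp add: \<beta>_def)
  \<comment> \<open>The first bound lets the decay \<open>n powr (- \<beta>)\<close> beat
    \<open>r ^ 3 * L\<close>; the second keeps \<open>r * r * L\<close> below
    \<open>s\<close>.\<close>
  define \<delta> where "\<delta> = min (\<beta> / 8) (1/32)"
  have \<delta>: "0 < \<delta>" "\<delta> \<le> \<beta> / 8" "\<delta> \<le> 1/32" using \<beta> by (auto simp: \<delta>_def)
  define K where "K = 4 / (1 - (1 - \<mu>)\<^sup>2) / (1 - \<mu>)"
  have K1: "0 < 1 - (1 - \<mu>)\<^sup>2" using \<mu> by (simp add: abs_square_less_1)
  then have K: "0 < K" using \<mu> by (simp add: K_def)
  have ev1: "\<forall>\<^sub>F n in sequentially. 120 * \<Lambda> \<le> ln (real n)" by real_asymp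
  have ev2: "\<forall>\<^sub>F n in sequentially. exp 1 * D \<le> real n powr (1/4)" by real_asymp
  have ev3: "\<forall>\<^sub>F n in sequentially. 4 * (ln (real n))\<^sup>2 * real n powr (1/4) \<le> e * real n" using e by real_asymp
  have ev4: "\<forall>\<^sub>F n in sequentially. (C * real n) powr (1/16) * ln (real n) \<le> real n powr (1/4) - 1" using C by real_asymp
  have ev5: "\<forall>\<^sub>F n in sequentially. 2 * ln (real n) + 1 \<le> real n powr (1/4) - 1" by real_asymp
  have ev6: "\<forall>\<^sub>F n in sequentially. K * ((C * real n) powr (3 * (\<beta> / 8)) * ln (real n) * real n powr (- \<beta>)) \<le> \<mu>"
  proof -
    have "((\<lambda>n. K * ((C * real n) powr (3 * (\<beta> / 8)) * ln (real n) * real n powr (- \<beta>))) \<longlongrightarrow> 0) sequentially"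
      using C \<beta> by real_asymp
    then show ?thesis using \<mu> by (auto dest!: order_tendstoD(2)[of _ _ _ \<mu>] elim: eventually_mono)
  qed
  have ev7: "\<forall>\<^sub>F n in sequentially. 2 \<le> (C * real n) powr \<delta>" using C \<delta> by real_asymp
  show ?thesis
  proof (intro exI[of _ \<delta>] conjI \<delta>(1))
    show "\<forall>\<^sub>F n in sequentially. admissible A D \<mu> e n (nat \<lfloor>(C * real n) powr \<delta>\<rfloor>)"
      using ev1 ev2 ev3 ev4 ev5 ev6 ev7
    proof eventually_elim
      case (elim n)
      define l where "l = ln (real n)"
      define y where "y = real n powr (1/4)"
      define r where "r = nat \<lfloor>(C * real n) powr \<delta>\<rfloor>"
      define L where "L = nat \<lfloor>l / (40 * \<Lambda>)\<rfloor>"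
      define g where "g = nat \<lfloor>l / (4 * ln A)\<rfloor>"
      define s where "s = nat \<lfloor>y\<rfloor>"
      \<comment> \<open>With a surplus of \<open>\<kappa> * w\<close> edges, each costing
        \<open>n powr (- (1/2))\<close>, the total factor is
        \<open>exp (- \<Lambda>) ^ w = (1 / (8 * A)) ^ w\<close>, which leaves
        \<open>(1/8) ^ w\<close> against \<open>A ^ w\<close>. The next constant adds
        \<open>8 * \<Lambda> / l\<close> as a bound for \<open>1 / g\<close>, and the 40 in
        \<open>L\<close> keeps \<open>3 * L * \<kappa>'\<close> at most 3/4.\<close>
      define \<kappa> where "\<kappa> = 2 * \<Lambda> / l"
      define \<kappa>' where "\<kappa>' = 10 * \<Lambda> / l"
      have l: "120 * \<Lambda> \<le> l" "0 < l" using elim(1) \<Lambda> unfolding l_def by linarith+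
      then have n1: "1 < real n" unfolding l_def by (smt (verit) ln_le_zero_iff ln_0 of_nat_0_le_iff)
      have nl: "real n = exp l" unfolding l_def using n1 by simp
      have y1: "1 \<le> y" unfolding y_def using n1 by (simp add: ge_one_powr_ge_zero)
      have L_le: "real L \<le> l / (40 * \<Lambda>)" "l / (40 * \<Lambda>) - 1 \<le> real L"
        unfolding L_def using l \<Lambda> by (intro nat_floor_bounds; simp)+
      have "3 \<le> l / (40 * \<Lambda>)" using l \<Lambda> by (simp add: field_simps)
      then have L2: "2 \<le> L" using L_le(2) by linarith
      have L_l: "real L \<le> l" using L_le(1) l \<Lambda> by (smt (verit) divide_le_eq_1 frac_le mult_le_cancel_left1 div_by_1)
      have g_le: "real g \<le> l / (4 * ln A)" "l / (4 * ln A) - 1 \<le> real g"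
        unfolding g_def using l lnA by (intro nat_floor_bounds; simp)+
      have "2 \<le> l / (4 * ln A)" using l \<Lambda> lnA by (simp add: field_simps)
      then have g1: "l / (8 * ln A) \<le> real g" using g_le(2) by (simp add: field_simps)
      have g0: "0 < real g" using g1 l lnA by (smt (verit) divide_pos_pos)
      have s_le: "y - 1 \<le> real s" "real s \<le> y" unfolding s_def using y1 by (intro nat_floor_bounds; simp)+
      have r_le: "real r \<le> (C * real n) powr \<delta>" unfolding r_def by (rule nat_floor_bounds) simp
      have C1: "1 \<le> C * real n" using C n1 by (metis less_imp_le mult_le_one mult_mono mult_1 zero_le_one order_trans of_nat_0_le_iff)
      have k: "0 < \<kappa>" "0 < \<kappa>'" unfolding \<kappa>_def \<kappa>'_def using l \<Lambda> by simp_all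
      have "1 / real g \<le> 1 / (l / (8 * ln A))" using g0 g1 l lnA by (intro divide_left_mono mult_pos_pos divide_pos_pos) auto
      also have "\<dots> \<le> 8 * \<Lambda> / l" using l \<Lambda> by (simp add: divide_right_mono)
      finally have "1 / real g \<le> 8 * \<Lambda> / l" .
      then have k': "\<kappa> + 1 / real g \<le> \<kappa>'"
      proof -
        have "\<kappa>' = \<kappa> + 8 * \<Lambda> / l" unfolding \<kappa>_def \<kappa>'_def by (simp add: add_divide_distrib[symmetric])
        then show ?thesis using \<open>1 / real g \<le> 8 * \<Lambda> / l\<close> by linarith
      qed
      have "3 * real L * \<kappa>' \<le> 3 * (l / (40 * \<Lambda>)) * \<kappa>'" using L_le k by (intro mult_right_mono mult_left_mono) auto
      also have "\<dots> < 1" unfolding \<kappa>'_def using l \<Lambda> by simp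
      finally have kL: "3 * real L * \<kappa>' < 1" .
      have k2: "2 * \<kappa>' < 1" unfolding \<kappa>'_def using l \<Lambda> by (simp add: field_simps)
      have Ls: "2 * L + 1 \<le> s"
      proof -
        have "2 * real L + 1 \<le> y - 1" using L_l elim(5) unfolding l_def[symmetric] y_def[symmetric] by linarith
        then have "real (2 * L + 1) \<le> real s" using s_le by simp
        then show ?thesis by (simp only: of_nat_le_iff)
      qed
      have "(\<Sum>w=1..s. A ^ w * (exp 1 * D * real w / real n) ^ nat \<lceil>\<kappa> * real w\<rceil>) \<le> (\<Sum>w=1..s. (1/8) ^ w)"
      proof (rule sum_mono)
        fix w assume w: "w \<in> {1..s}"
        have "exp 1 * D * real w \<le> y * y" using w elim(2) s_le D unfolding y_def[symmetric] by (intro mult_mono) auto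
        also have "\<dots> = real n * real n powr (- (1/2))"
          unfolding y_def using n1 by (simp add: powr_add[symmetric] powr_mult_base[symmetric] powr_mult_base)
        finally have b: "exp 1 * D * real w / real n \<le> real n powr (- (1/2))" using n1 by (simp add: field_simps)
        have p1: "real n powr (- (1/2)) \<le> 1" using n1 by (simp add: powr_le_one_le powr_minus_divide ge_one_powr_ge_zero)
        have "(exp 1 * D * real w / real n) ^ nat \<lceil>\<kappa> * real w\<rceil> \<le> (real n powr (- (1/2))) ^ nat \<lceil>\<kappa> * real w\<rceil>"
          using b D by (intro power_mono) auto
        also have "\<dots> = exp (- (l / 2) * real (nat \<lceil>\<kappa> * real w\<rceil>))"
          using n1 by (simp add: powr_def l_def exp_of_nat_mult[symmetric] mult_ac)
        also have "\<dots> \<le> exp (- (l / 2) * (\<kappa> * real w))"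
        proof -
          have "\<kappa> * real w \<le> real (nat \<lceil>\<kappa> * real w\<rceil>)" by (rule real_nat_ceiling_ge)
          then have "l / 2 * (\<kappa> * real w) \<le> l / 2 * real (nat \<lceil>\<kappa> * real w\<rceil>)" using l by (intro mult_left_mono) auto
          then show ?thesis by simp
        qed
        also have "\<dots> = exp (- \<Lambda>) ^ w" unfolding \<kappa>_def using l by (simp add: exp_of_nat_mult[symmetric] mult_ac)
        also have "exp (- \<Lambda>) = 1 / (8 * A)" unfolding \<Lambda>_def using A0 by (simp add: exp_minus inverse_eq_divide)
        finally have "A ^ w * (exp 1 * D * real w / real n) ^ nat \<lceil>\<kappa> * real w\<rceil> \<le> A ^ w * (1 / (8 * A)) ^ w"
          using A0 by (intro mult_left_mono) auto
        also have "\<dots> = (1/8) ^ w" using A0 by (simp add: power_mult_distrib[symmetric])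
        finally show "A ^ w * (exp 1 * D * real w / real n) ^ nat \<lceil>\<kappa> * real w\<rceil> \<le> (1/8) ^ w" .
      qed
      also have "\<dots> = (1/8) * (\<Sum>w<s. (1/8) ^ w)"
        unfolding sum_distrib_left by (rule sum.reindex_bij_witness[of _ Suc "\<lambda>w. w - 1"]) (auto simp: power_eq_if)
      also have "\<dots> < 1/3"
      proof -
        have "(\<Sum>w<s. (1/8) ^ w) = (1 - (1/8::real) ^ s) / (1 - 1/8)" by (simp add: sum_gp_strict)
        also have "\<dots> \<le> 1 / (1 - 1/8)" by (intro divide_right_mono) auto
        finally show ?thesis by simp
      qed
      finally have h2: "(\<Sum>w=1..s. A ^ w * (exp 1 * D * real w / real n) ^ nat \<lceil>\<kappa> * real w\<rceil>) < 1/3" .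
      have h3: "real g * (3 * (\<Sum>w=1..g. A ^ w) + 1) \<le> e * real n"
      proof -
        have "A ^ g = exp (real g * ln A)" using A0 by (simp add: exp_of_nat_mult)
        also have "\<dots> \<le> exp (l / 4)" using g_le(1) lnA by (simp add: field_simps)
        also have "\<dots> = y" unfolding y_def powr_def l_def using n1 by simp
        finally have Ag: "A ^ g \<le> y" .
        have "(\<Sum>w=1..g. A ^ w) \<le> (\<Sum>w=1..g. y)"
        proof (rule sum_mono)
          fix w assume "w \<in> {1..g}"
          then have "A ^ w \<le> A ^ g" using A0 by (intro power_increasing) auto
          then show "A ^ w \<le> y" using Ag by linarith
        qed
        then have S: "(\<Sum>w=1..g. A ^ w) \<le> real g * y" by simp
        have "1 \<le> real g" using g0 by simp
        then have "1 * 1 \<le> real g * y" using y1 by (intro mult_mono) auto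
        then have "3 * (\<Sum>w=1..g. A ^ w) + 1 \<le> 4 * (real g * y)" using S by linarith
        then have "real g * (3 * (\<Sum>w=1..g. A ^ w) + 1) \<le> real g * (4 * (real g * y))" using g0 by (intro mult_left_mono) auto
        also have "\<dots> = 4 * (real g)\<^sup>2 * y" by (simp add: power2_eq_square)
        also have "\<dots> \<le> 4 * l\<^sup>2 * y"
        proof -
          have "l / (4 * ln A) \<le> l / 1" using l lnA by (intro divide_left_mono) auto
          then have "real g \<le> l" using g_le by simp
          then have "(real g)\<^sup>2 \<le> l\<^sup>2" by (intro power_mono) auto
          then show ?thesis using y1 by (intro mult_right_mono) auto
        qed
        also have "\<dots> \<le> e * real n" using elim(3) unfolding l_def[symmetric] y_def[symmetric] .
        finally show ?thesis .
      qed
      have r2: "2 \<le> r" unfolding r_def using elim(7) by (simp add: le_nat_floor le_floor_iff nat_le_eq_zle le_nat_iff)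
      have rL: "r * r * L \<le> s"
      proof -
        have "real r * real r \<le> (C * real n) powr \<delta> * (C * real n) powr \<delta>" using r_le by (intro mult_mono) auto
        also have "\<dots> = (C * real n) powr (2 * \<delta>)" by (simp add: powr_add[symmetric])
        also have "\<dots> \<le> (C * real n) powr (1/16)" using \<delta> C1 by (intro powr_mono) auto
        finally have "real r * real r * real L \<le> (C * real n) powr (1/16) * l" using L_l by (intro mult_mono) auto
        also have "\<dots> \<le> real s" using elim(4) s_le unfolding l_def[symmetric] y_def[symmetric] by linarith
        finally have "real (r * r * L) \<le> real s" by simp
        then show ?thesis by (simp only: of_nat_le_iff)
      qed
      have sm: "4 * (1 - \<mu>) ^ L / (1 - (1 - \<mu>)\<^sup>2) * real (r * r * L) * real r \<le> \<mu>"
      proof -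
        have "(1 - \<mu>) ^ L = exp (- q * real L)" unfolding q_def using \<mu> by (simp add: exp_of_nat_mult mult.commute)
        also have "\<dots> \<le> exp (- q * (l / (40 * \<Lambda>) - 1))" using L_le q by simp
        also have "\<dots> = exp (- \<beta> * l) * exp q" unfolding \<beta>_def by (simp add: exp_add[symmetric] algebra_simps)
        also have "exp q = 1 / (1 - \<mu>)" unfolding q_def using \<mu> by (simp add: exp_minus inverse_eq_divide)
        also have "exp (- \<beta> * l) = real n powr (- \<beta>)" unfolding powr_def l_def using n1 by simp
        finally have p: "(1 - \<mu>) ^ L \<le> real n powr (- \<beta>) * (1 / (1 - \<mu>))" .
        have "real r * real r * real r \<le> (C * real n) powr \<delta> * (C * real n) powr \<delta> * (C * real n) powr \<delta>"
          using r_le by (intro mult_mono) auto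
        also have "\<dots> = (C * real n) powr (3 * \<delta>)" by (simp add: powr_add[symmetric])
        also have "\<dots> \<le> (C * real n) powr (3 * (\<beta> / 8))" using \<delta> C1 by (intro powr_mono) auto
        finally have rr: "real r * real r * real r * real L \<le> (C * real n) powr (3 * (\<beta> / 8)) * l"
          using L_l by (intro mult_mono) auto
        have "4 * (1 - \<mu>) ^ L / (1 - (1 - \<mu>)\<^sup>2) * real (r * r * L) * real r =
            4 / (1 - (1 - \<mu>)\<^sup>2) * ((1 - \<mu>) ^ L * (real r * real r * real r * real L))" by simp
        also have "\<dots> \<le> 4 / (1 - (1 - \<mu>)\<^sup>2) * ((real n powr (- \<beta>) * (1 / (1 - \<mu>))) * ((C * real n) powr (3 * (\<beta> / 8)) * l))"
          using K1 \<mu> by (intro mult_left_mono mult_mono[OF p rr]) auto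
        also have "\<dots> = K * ((C * real n) powr (3 * (\<beta> / 8)) * l * real n powr (- \<beta>))" unfolding K_def by simp
        also have "\<dots> \<le> \<mu>" using elim(6) unfolding l_def .
        finally show ?thesis .
      qed
      have s2: "2 \<le> s" using Ls L2 by linarith
      have g0': "0 < g" using g0 by simp
      show ?case
        unfolding admissible_def r_def[symmetric]
        by (intro exI[of _ L] exI[of _ s] exI[of _ g] exI[of _ \<kappa>] exI[of _ \<kappa>'] conjI k g0' s2 L2 Ls k' kL k2 h2 h3 r2 rL sm)
    qed
  qed
qed

section \<open>The integrality gap\<close>

text \<open>Of all price pairs only \<open>(0, budget)\<close> is kept: there the edge earns its
  full budget, which the weight normalises to 1.\<close>

lemma sa_value_lower_bound:
  assumes I: "graph_pricing_instance I" and feas: "sa_feasible I Q r x" and r: "2 \<le> r" and Q: "finite Q" "\<And>q. q \<in> Q \<Longrightarrow> 0 \<le> q"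
    and w: "\<And>e. e \<in> edges I \<Longrightarrow> weight I e = 1 / budget I e"
    and Q0: "0 \<in> Q" "\<And>e. e \<in> edges I \<Longrightarrow> budget I e \<in> Q"
    and lb: "\<And>e. e \<in> edges I \<Longrightarrow> a \<le> x {end1 I e, end2 I e} (pair_assignment (end1 I e) (end2 I e) 0 (budget I e))"
  shows "real (card (edges I)) * a \<le> sa_value I Q x"
proof -
  have "(\<Sum>e\<in>edges I. a) \<le> sa_value I Q x"
    unfolding sa_value_def
  proof (rule sum_mono)
    fix e assume e: "e \<in> edges I"
    define u v b where "u = end1 I e" and "v = end2 I e" and "b = budget I e"
    have uv: "u \<in> verts I" "v \<in> verts I" "u \<noteq> v" "0 < b"
      using I e unfolding graph_pricing_instance_def u_def v_def b_def by auto
    have S: "{u, v} \<subseteq> verts I" "card {u, v} \<le> r" using uv r by auto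
    have nn: "0 \<le> x {u, v} (pair_assignment u v i j)" if "i \<in> Q" "j \<in> Q" for i j
    proof -
      have "pair_assignment u v i j \<in> {u, v} \<rightarrow>\<^sub>E Q"
        using that by (auto simp: pair_assignment_def PiE_def extensional_def)
      then show ?thesis using feas S unfolding sa_feasible_def by blast
    qed
    let ?P = "{(i, j). i \<in> Q \<and> j \<in> Q \<and> i + j \<le> b}"
    let ?f = "\<lambda>(i, j). (i + j) * x {u, v} (pair_assignment u v i j)"
    have finP: "finite ?P" by (rule finite_subset[of _ "Q \<times> Q"]) (use Q in auto)
    have "b * a \<le> b * x {u, v} (pair_assignment u v 0 b)"
      using lb[OF e] uv unfolding u_def v_def b_def by (intro mult_left_mono) auto
    also have "\<dots> = ?f (0, b)" by simp
    also have "\<dots> \<le> sum ?f ?P"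
      using Q0 e Q(2) nn by (intro member_le_sum[OF _ _ finP]) (auto simp: b_def)
    finally have "a \<le> 1 / b * sum ?f ?P" using uv by (simp add: field_simps)
    then show "a \<le> weight I e * (\<Sum>(i, j)\<in>{(i, j). i \<in> Q \<and> j \<in> Q \<and> i + j \<le> budget I e}.
        (i + j) * x {end1 I e, end2 I e} (pair_assignment (end1 I e) (end2 I e) i j))"
      unfolding w[OF e] u_def v_def b_def .
  qed
  then show ?thesis by simp
qed

context gadget
begin

text \<open>The signs of the kernel on an edge are the bits of its label \<open>i\<close>, so the
  labels of its endpoints tend to differ by \<open>i\<close>. The event that the higher endpoint has
  label 0 and the lower one label \<open>i\<close> has probability close to \<open>1 / m\<close>,
  and it means price 0 and price equal to the budget. The loss \<open>2 * k * \<beta>\<close> is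
  \<open>k / 2\<close> times the four errors of \<open>sa_sol_pair\<close>.\<close>

lemma sa_side:
  fixes k nh :: nat and \<beta> \<sigma> \<mu> :: real
  assumes mk: "m = 2 ^ k"
    and Es: "Es \<subseteq> {..<E}" "Es \<noteq> {}" and \<omega>: "\<And>e. e < E \<Longrightarrow> \<omega> e \<in> Z"
    and inj: "inj_on (\<lambda>e. {hd_of (\<omega> e), tl_of (\<omega> e)}) Es"
    and sp: "sparse_upto s \<kappa> ((\<lambda>e. {hd_of (\<omega> e), tl_of (\<omega> e)}) ` Es)"
    and \<kappa>: "0 < \<kappa>" "3 * real L * \<kappa> < 1" and L: "2 \<le> L" "2 * L + 1 \<le> s" "r * r * L \<le> s" and r: "2 \<le> r"
    and \<mu>: "0 < \<mu>" "\<mu> < 1" and small: "4 * (1 - \<mu>) ^ L / (1 - (1 - \<mu>)\<^sup>2) * real (r * r * L) * real r \<le> \<mu>"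
    and \<beta>: "0 < \<beta>" "real ((2 * 2 ^ nh) choose (2 ^ nh)) / 4 ^ (2 ^ nh) \<le> \<beta>" "exp (- 2 * \<sigma>) \<le> \<beta>"
      "((3/2)^nh)\<^sup>2 / (2 * \<beta>) * (1 - exp (- 2 * \<sigma> * \<mu>)) \<le> \<beta>" and \<sigma>: "0 \<le> \<sigma>"
  shows "\<exists>x. sa_feasible (inst Es \<omega>) (price_grid (inst Es \<omega>)) r x \<and>
    real (card Es) * (1 / real m - 2 * real k * \<beta>) \<le> sa_value (inst Es \<omega>) (price_grid (inst Es \<omega>)) x"
proof -
  let ?I = "inst Es \<omega>" and ?Q = "price_grid (inst Es \<omega>)"
  let ?ends = "\<lambda>e. {hd_of (\<omega> e), tl_of (\<omega> e)}"
  define EG where "EG = ?ends ` Es"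
  \<comment> \<open>The kernel lives on vertex pairs, so the label of an edge is recovered from its
    endpoints; this is where the absence of parallel edges among \<open>Es\<close> enters.\<close>
  define sg :: "nat \<Rightarrow> nat set \<Rightarrow> real" where "sg = (\<lambda>t e. bit_sign (bit (lab_of (\<omega> (the_inv_into Es ?ends e))) t))"
  have sg1: "sg t e = 1 \<or> sg t e = -1" for t e unfolding sg_def bit_sign_def by auto
  have sgE: "sg t (?ends e) = bit_sign (bit (lab_of (\<omega> e)) t)" if "e \<in> Es" for t e
    unfolding sg_def using the_inv_into_f_f[OF inj that] by simp
  have ZE: "\<omega> e \<in> Z" if "e \<in> Es" for e using that Es \<omega> by auto
  have I: "graph_pricing_instance ?I" by (rule inst_valid[OF Es \<omega>])
  have finEs: "finite Es" using Es finite_subset by blast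
  have fQ: "finite ?Q" by (rule finite_price_grid)
  have Qnn: "0 \<le> q" if "q \<in> ?Q" for q using that unfolding price_grid_def by (auto elim: Nats_cases)
  have bud: "budget ?I e = real M ^ lev_of (\<omega> e)" "weight ?I e = 1 / budget ?I e" "end1 ?I e = tl_of (\<omega> e)" "end2 ?I e = hd_of (\<omega> e)"
    "edges ?I = Es" "verts ?I = V" for e
    unfolding inst_def by simp_all
  have budQ: "budget ?I e \<in> ?Q" if "e \<in> Es" for e
  proof -
    have "budget ?I e \<le> Max (budget ?I ` edges ?I)" using that finEs unfolding bud(5) by (intro Max_ge) auto
    moreover have "budget ?I e \<in> \<nat>" unfolding bud by (metis of_nat_in_Nats of_nat_power)
    ultimately show ?thesis unfolding price_grid_def by simp
  qed
  have Q0: "0 \<in> ?Q"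
  proof -
    obtain e where "e \<in> Es" using Es by auto
    then have "0 \<le> budget ?I e" "budget ?I e \<le> Max (budget ?I ` edges ?I)"
      using budQ[of e] unfolding price_grid_def bud(1) by auto
    then show ?thesis unfolding price_grid_def by auto
  qed
  \<comment> \<open>Scales above the largest surviving budget are not in the grid and are replaced
    by 0. The labels of actual edges are unaffected, since their prices are budgets.\<close>
  define price :: "nat \<Rightarrow> nat \<Rightarrow> real" where
    "price = (\<lambda>u a. if a = 0 \<or> real M ^ ((u div n0) * m + a) \<notin> ?Q then 0 else real M ^ ((u div n0) * m + a))"
  have priceQ: "price u a \<in> ?Q" for u a unfolding price_def using Q0 by auto
  have price_e: "price (hd_of (\<omega> e)) (lab_of (\<omega> e)) = budget ?I e" if "e \<in> Es" for e
    using Z_props[OF ZE[OF that]] budQ[OF that] unfolding price_def bud by auto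
  obtain N cf \<nu> where rnd: "\<And>k. rounding N cf \<nu> (swave nh)" using rounding_swave[of nh] by blast
  interpret rounding k N cf \<nu> "swave nh" by (rule rnd)
  have EG2: "card e = 2" if "e \<in> EG" for e
    using that Z_props(3)[OF ZE] unfolding EG_def by (fastforce simp: card_2_iff)
  let ?B = "label_cov EG L \<sigma> \<mu> sg"
  have psd: "0 \<le> qf (S \<times> {..<k}) ?B f" if "S \<subseteq> V" "card S \<le> r" for S f
    by (rule label_cov_psd[where m = s and \<kappa> = \<kappa> and r = r])
      (use EG2 sp[folded EG_def] \<kappa> L \<mu> sg1 that small \<sigma> finite_subset[OF that(1)] in \<open>auto simp: V_def\<close>)
  define x where "x = (\<lambda>S \<alpha>. Re (sa_sol price ?B S \<alpha>))"
  have feas: "sa_feasible ?I ?Q r x"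
    unfolding x_def by (rule sa_sol_feasible) (use fQ priceQ label_cov_sym psd in \<open>auto simp: bud(6) V_def\<close>)
  have fo: "forest_upto (2 * L + 1) EG"
  proof (rule sparse_upto_forest[OF sp[folded EG_def] L(2) _ \<kappa>(1)])
    have "real (2 * L + 1) \<le> 3 * real L" using L by linarith
    then have "\<kappa> * real (2 * L + 1) \<le> \<kappa> * (3 * real L)" using \<kappa>(1) by (intro mult_left_mono) auto
    then show "\<kappa> * real (2 * L + 1) < 1" using \<kappa>(2) by (simp add: mult_ac)
  qed
  have nb: "nbgraph EG L (1 - \<mu>) (sg t)" for t
    by unfold_locales (use EG2 fo L \<mu> sg1 in auto)
  have lb: "1 / real m - 2 * real k * \<beta> \<le> x {tl_of (\<omega> e), hd_of (\<omega> e)} (pair_assignment (tl_of (\<omega> e)) (hd_of (\<omega> e)) 0 (budget ?I e))"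
    if e: "e \<in> Es" for e
  proof -
    note zp = Z_props[OF ZE[OF e]]
    let ?u = "tl_of (\<omega> e)" and ?v = "hd_of (\<omega> e)" and ?i = "lab_of (\<omega> e)"
    have ed: "{?u, ?v} = ?ends e" by auto
    then have edE: "{?u, ?v} \<in> EG" unfolding EG_def using e by auto
    have "1 / 2 ^ k - real k / 2 * (real ((2 * 2 ^ nh) choose (2 ^ nh)) / 4 ^ (2 ^ nh) + exp (- 2 * \<sigma>) + \<beta> +
        ((3/2)^nh)\<^sup>2 / (2 * \<beta>) * (1 - exp (- 2 * \<sigma> * \<mu>))) \<le>
      Re (sa_sol price ?B {?u, ?v} (pair_assignment ?u ?v (price ?u 0) (price ?v ?i)))"
    proof (rule sa_sol_pair[where s = "\<lambda>t. sg t {?u, ?v}"])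
      show "?i < 2 ^ k" using zp(7) mk by simp
      show "sg t {?u, ?v} = bit_sign (bit ?i t)" for t unfolding ed by (rule sgE[OF e])
      show "0 \<le> qf ({?u, ?v} \<times> {..<k}) ?B t" for t by (rule psd) (use zp r in auto)
      show "?B (y, t) (y, t') = (if t = t' then \<sigma> * (1 + \<mu>) else 0)" for y t t'
        unfolding label_cov_def using nbgraph.K_refl[OF nb] by simp
      show "?B (?u, t) (?v, t') = (if t = t' then \<sigma> * sg t {?u, ?v} * (1 - \<mu>) else 0)" for t t'
        unfolding label_cov_def using nbgraph.K_edge[OF nb edE] zp(3) by simp
    qed (use rnd \<beta> \<mu> \<sigma> zp label_cov_sym in auto)
    moreover have "real k / 2 * (real ((2 * 2 ^ nh) choose (2 ^ nh)) / 4 ^ (2 ^ nh) + exp (- 2 * \<sigma>) + \<beta> +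
        ((3/2)^nh)\<^sup>2 / (2 * \<beta>) * (1 - exp (- 2 * \<sigma> * \<mu>))) \<le> real k / 2 * (\<beta> + \<beta> + \<beta> + \<beta>)"
      using \<beta> by (intro mult_left_mono add_mono) auto
    moreover have "real k / 2 * (\<beta> + \<beta> + \<beta> + \<beta>) = 2 * real k * \<beta>" by simp
    ultimately have "1 / 2 ^ k - 2 * real k * \<beta> \<le> Re (sa_sol price ?B {?u, ?v} (pair_assignment ?u ?v (price ?u 0) (price ?v ?i)))"
      by linarith
    moreover have "price ?u 0 = 0" by (simp add: price_def)
    moreover have "real m = 2 ^ k" using mk by simp
    ultimately show ?thesis unfolding x_def price_e[OF e] by (simp only:)
  qed
  have "real (card (edges ?I)) * (1 / real m - 2 * real k * \<beta>) \<le> sa_value ?I ?Q x"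
    by (rule sa_value_lower_bound[OF I feas r fQ Qnn]) (use budQ Q0 lb in \<open>auto simp: bud\<close>)
  then show ?thesis using feas unfolding bud(5) by blast
qed

end

text \<open>On the left stand the mean score, the deviation allowed to the random instance and the
  loss \<open>2 / M\<close> from coarse scales. On the right, one factor \<open>1 - e/16\<close>
  accounts for deleted edges and the other for imperfect rounding.\<close>

lemma gap_arithmetic:
  fixes e m M :: real
  assumes e: "0 < e" "e \<le> 1" and m: "1 + 16 / e < m" and M: "32 * m / e \<le> M"
  shows "(1/4 + 2 * (e/16)) / (m - 1) + e / (16 * m) + 2 / M \<le> (1/4 + e) * ((1 - e/16) * ((1 - e/16) / m))"
proof -
  have m1: "16 / e < m - 1" "0 < 16 / e" using m e by auto
  then have m0: "0 < m" "0 < m - 1" by linarith+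
  have "1 / (m - 1) \<le> 1 / (16 / e)" using m1 m0 by (intro divide_left_mono) auto
  then have "1 / (m - 1) \<le> e / 16" by simp
  moreover have "m / (m - 1) = 1 + 1 / (m - 1)" using m0 by (simp add: field_simps)
  ultimately have a: "m / (m - 1) \<le> 1 + e / 16" by simp
  have "0 < 32 * m / e" using m0 e by simp
  then have "2 / M \<le> 2 / (32 * m / e)" using M by (intro divide_left_mono mult_pos_pos) auto
  then have b: "2 / M \<le> e / 16 / m" using m0 e by simp
  have "(1/4 + 2 * (e/16)) / (m - 1) = (1/4 + e/8) * (m / (m - 1)) / m" using m0 by simp
  also have "\<dots> \<le> (1/4 + e/8) * (1 + e/16) / m" using a e m0 by (intro divide_right_mono mult_left_mono) auto
  finally have "(1/4 + 2 * (e/16)) / (m - 1) + e / (16 * m) + 2 / M \<le> (1/4 + e/8) * (1 + e/16) / m + e / 16 / m + e / 16 / m"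
    using b by simp
  also have "\<dots> = ((1/4 + e/8) * (1 + e/16) + e/16 + e/16) / m" by (simp add: add_divide_distrib)
  \<comment> \<open>Everything is now over the common denominator \<open>m\<close>; the linear
    coefficient 31/32 on the right exceeds 17/64 on the left by enough to cover the quadratic terms
    for \<open>e \<le> 1\<close>.\<close>
  also have "\<dots> \<le> ((1/4 + e) * ((1 - e/16) * (1 - e/16))) / m"
  proof (intro divide_right_mono)
    have ee: "e * e \<le> e" "0 \<le> e * e" "0 \<le> e * e * e" using e by (simp_all add: mult_left_le)
    have 1: "(1/4 + e/8) * (1 + e/16) + e/16 + e/16 = 1/4 + e * (17/64) + e * e / 128" by (simp add: algebra_simps)
    have 2: "(1/4 + e) * ((1 - e/16) * (1 - e/16)) = 1/4 + e * (31/32) - e * e * (127/1024) + e * e * e / 256" by (simp add: algebra_simps)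
    have "1/4 + e * (17/64) + p / 128 \<le> 1/4 + e * (31/32) - p * (127/1024) + q / 256" if "p \<le> e" "0 \<le> q" for p q
      using that e by linarith
    from this[OF ee(1,3)]
    have "1/4 + e * (17/64) + e * e / 128 \<le> 1/4 + e * (31/32) - e * e * (127/1024) + e * e * e / 256" .
    then show "(1/4 + e/8) * (1 + e/16) + e/16 + e/16 \<le> (1/4 + e) * ((1 - e/16) * (1 - e/16))" unfolding 1 2 .
  qed (use m0 in simp)
  finally show ?thesis by simp
qed

theorem theorem2:
  fixes \<epsilon> :: real
  assumes "0 < \<epsilon>"
  shows "\<exists>\<delta>::real. 0 < \<delta> \<and>
    (\<forall>N::nat. \<exists>n\<ge>N. \<exists>I :: (nat, nat) pricing_instance.
       graph_pricing_instance I \<and> card (verts I) = n \<and>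
       (\<forall>e\<in>edges I. budget I e \<in> \<nat>) \<and>
       integrality_gap I (price_grid I) (nat \<lfloor>real n powr \<delta>\<rfloor>) \<le> 1 / 4 + \<epsilon> \<and>
       (\<exists>x. sa_feasible I (price_grid I) (nat \<lfloor>real n powr \<delta>\<rfloor>) x \<and>
            pricing_opt I \<le> (1 / 4 + \<epsilon>) * sa_value I (price_grid I) x))"
proof -
  define e where "e = min \<epsilon> 1"
  have e: "0 < e" "e \<le> 1" "e \<le> \<epsilon>" using assms by (auto simp: e_def)
  obtain k :: nat where k: "1 + 16 / e < 2 ^ k" using real_arch_pow[of 2 "1 + 16 / e"] by auto
  define m :: nat where "m = 2 ^ k"
  have m_gt: "1 + 16 / e < real m" using k by (simp add: m_def)
  have "16 \<le> 16 / e" using e by (simp add: field_simps)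
  then have m17: "17 < real m" using m_gt by linarith
  then have m2: "2 \<le> m" by simp
  have k0: "0 < k" using m17 by (cases k) (auto simp: m_def)
  have e16: "0 < e / 16" using e by simp
  obtain C :: nat and X :: "(nat \<times> nat \<times> nat \<times> nat \<times> nat) set" and c c' where
    X: "finite X" "X \<noteq> {}" "\<forall>x\<in>X. c x < c' x \<and> c' x < C" and
    cut: "\<forall>a. (\<forall>t. 0 \<le> a t \<and> a t \<le> 1) \<longrightarrow> (\<Sum>x\<in>X. a (c x) * (1 - a (c' x))) \<le> (1/4 + e/16) * real (card X)" and
    col: "\<forall>b. (\<forall>t t'. 0 \<le> b t t') \<and> (\<forall>t. (\<Sum>t'<C. b t t') \<le> 1) \<longrightarrow> (\<Sum>x\<in>X. b (c' x) (c x)) \<le> e/16 * real (card X)"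
    using type_pairs_exist[OF e16] by blast
  have C1: "1 \<le> C" using X by fastforce
  define M :: nat where "M = nat \<lceil>32 * real m / e\<rceil>"
  have M_ge: "32 * real m / e \<le> real M" unfolding M_def by (rule real_nat_ceiling_ge)
  have "32 * real m / 1 \<le> 32 * real m / e" using e by (intro divide_left_mono) auto
  then have M2: "2 \<le> M" using M_ge m17 by linarith
  define ec where "ec = e / (16 * real m)"
  have ec: "0 < ec" "ec \<le> 2" using e m17 by (auto simp: ec_def field_simps)
  \<comment> \<open>Makes the loss \<open>2 * k * \<beta>\<close> equal to \<open>e / 16\<close> of
    the ideal edge value \<open>1 / m\<close>.\<close>
  define \<beta> where "\<beta> = e / (32 * real m * real k)"
  have \<beta>: "0 < \<beta>" using e m17 k0 by (simp add: \<beta>_def)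
  obtain nh where nh: "real ((2 * 2 ^ nh) choose (2 ^ nh)) / 4 ^ (2 ^ nh) \<le> \<beta>" using central_binomial_small[OF \<beta>] by blast
  \<comment> \<open>Large enough to damp all nonzero frequencies:
    \<open>exp (2 * \<sigma>) \<ge> \<sigma> = 1 / \<beta>\<close>.\<close>
  define \<sigma> where "\<sigma> = 1 / \<beta>"
  have \<sigma>: "0 < \<sigma>" using \<beta> by (simp add: \<sigma>_def)
  have e\<sigma>: "exp (- 2 * \<sigma>) \<le> \<beta>"
  proof -
    have "\<sigma> \<le> exp (2 * \<sigma>)" using exp_ge_add_one_self[of "2 * \<sigma>"] \<sigma> by linarith
    then have "1 / exp (2 * \<sigma>) \<le> 1 / \<sigma>" using \<sigma> by (intro divide_left_mono mult_pos_pos) auto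
    then show ?thesis by (simp add: exp_minus inverse_eq_divide \<sigma>_def)
  qed
  define Ch where "Ch = ((3/2::real)^nh)\<^sup>2 / (2 * \<beta>)"
  have Ch: "0 < Ch" using \<beta> by (simp add: Ch_def)
  \<comment> \<open>By \<open>1 - exp (- y) \<le> y\<close> the disagreement term is at most
    \<open>Ch * 2 * \<sigma> * \<mu>\<close>, which this choice bounds by \<beta>.\<close>
  define \<mu> where "\<mu> = min (1/2) (\<beta> / (2 * \<sigma> * Ch))"
  have \<mu>: "0 < \<mu>" "\<mu> < 1" "\<mu> \<le> \<beta> / (2 * \<sigma> * Ch)" using \<beta> \<sigma> Ch by (auto simp: \<mu>_def)
  have Ch\<mu>: "((3/2)^nh)\<^sup>2 / (2 * \<beta>) * (1 - exp (- 2 * \<sigma> * \<mu>)) \<le> \<beta>"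
  proof -
    have "1 - exp (- 2 * \<sigma> * \<mu>) \<le> 2 * \<sigma> * \<mu>" using exp_ge_add_one_self[of "- 2 * \<sigma> * \<mu>"] by simp
    then have "Ch * (1 - exp (- 2 * \<sigma> * \<mu>)) \<le> Ch * (2 * \<sigma> * \<mu>)" using Ch by (intro mult_left_mono) auto
    also have "\<dots> = (2 * \<sigma> * Ch) * \<mu>" by simp
    also have "\<dots> \<le> (2 * \<sigma> * Ch) * (\<beta> / (2 * \<sigma> * Ch))" using \<mu>(3) \<sigma> Ch by (intro mult_left_mono) auto
    also have "\<dots> = \<beta>" using \<sigma> Ch by simp
    finally show ?thesis unfolding Ch_def .
  qed
  \<comment> \<open>\<open>G * n0\<close> bounds the logarithm of the number of level functions. The
    edge density \<open>D\<close> is then taken so large that the Chernoff exponent beats this union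
    bound by \<open>2 * n0\<close>.\<close>
  define G where "G = real C * ln (real (C * m + 1))"
  obtain D0 :: nat where D0: "(G + 2) / (ec\<^sup>2 / 4) < real D0" using reals_Archimedean2 by blast
  define D where "D = D0 + 1"
  have D1: "1 \<le> D" by (simp add: D_def)
  have DG: "G + 2 \<le> ec\<^sup>2 / 4 * real D"
  proof -
    have "G + 2 < ec\<^sup>2 / 4 * real D0" using D0 ec by (simp add: pos_divide_less_eq mult.commute)
    also have "\<dots> \<le> ec\<^sup>2 / 4 * real D" by (intro mult_left_mono) (auto simp: D_def)
    finally show ?thesis by simp
  qed
  define A where "A = exp 2 * real C * real D"
  have CD: "1 \<le> real C" "1 \<le> real D" using C1 D1 by auto
  then have "exp 2 * 1 * 1 \<le> A" unfolding A_def by (intro mult_mono) auto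
  then have A: "exp 2 \<le> A" by simp
  have eD: "0 < e * real D / 16" using e CD by simp
  obtain \<delta> where \<delta>: "0 < \<delta>" and ev: "\<forall>\<^sub>F n in sequentially. admissible A (real D) \<mu> (e * real D / 16) n (nat \<lfloor>(real C * real n) powr \<delta>\<rfloor>)"
    using parameters_exist[OF A CD \<mu>(1,2) eD] by blast
  then obtain N' where N': "\<And>n. N' \<le> n \<Longrightarrow> admissible A (real D) \<mu> (e * real D / 16) n (nat \<lfloor>(real C * real n) powr \<delta>\<rfloor>)"
    unfolding eventually_sequentially by blast
  show ?thesis
  proof (intro exI[of _ \<delta>] conjI allI \<delta>)
    fix N :: nat
    \<comment> \<open>The number of rounds is measured in all \<open>n = C * n0\<close> vertices and
      not in the block size \<open>n0\<close>, as in \<open>parameters_exist\<close>.\<close>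
    define n0 where "n0 = max N' (max N 1)"
    have n0: "N' \<le> n0" "N \<le> n0" "1 \<le> n0" by (auto simp: n0_def)
    define n where "n = C * n0"
    define r where "r = nat \<lfloor>real n powr \<delta>\<rfloor>"
    have nC: "real C * real n0 = real n" by (simp add: n_def)
    have "n0 \<le> C * n0" using C1 by simp
    then have nN: "N \<le> n" using n0(2) unfolding n_def by (rule order_trans[rotated])
    obtain L s g \<kappa> \<kappa>' where p: "0 < \<kappa>" "0 < g" "2 \<le> s" "2 \<le> L" "2 * L + 1 \<le> s" "\<kappa> + 1 / real g \<le> \<kappa>'" "0 < \<kappa>'"
      "3 * real L * \<kappa>' < 1" "2 * \<kappa>' < 1" and
      h2: "(\<Sum>w=1..s. A ^ w * (exp 1 * real D * real w / real n0) ^ nat \<lceil>\<kappa> * real w\<rceil>) < 1/3" and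
      h3: "real g * (3 * (\<Sum>w=1..g. A ^ w) + 1) \<le> e * real D / 16 * real n0" and
      r: "2 \<le> r" "r * r * L \<le> s" and
      small: "4 * (1 - \<mu>) ^ L / (1 - (1 - \<mu>)\<^sup>2) * real (r * r * L) * real r \<le> \<mu>"
      using N'[OF n0(1)] unfolding nC r_def[symmetric] admissible_def by blast
    interpret gadget C m M n0 X c c'
      by unfold_locales (use X m2 M2 n0 in auto)
    define E where "E = D * n0"
    have cV: "card V = n" unfolding V_def n_def by simp
    interpret R: random_edges Z V hd_of tl_of E "real n0" "real C" "real D"
      by unfold_locales (use finite_Z Z_ne density n0 cV CD in \<open>auto simp: V_def E_def n_def\<close>)
    have RA: "R.A = A" unfolding R.A_def A_def ..
    have A0: "0 < A" using A exp_gt_zero[of "2::real"] by linarith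
    define T where "T = 3 * (\<Sum>w=1..g. A ^ w) + 1"
    have T: "0 < T" "3 * (\<Sum>w=1..g. A ^ w) \<le> T" unfolding T_def using A0 by (auto intro!: add_nonneg_pos sum_nonneg)
    define b where "b = (1/4 + 2 * (e/16)) / (real m - 1)"
    have h1: "real (card scores) * exp (- (ec\<^sup>2 / 4) * real E) < 1/3"
    proof -
      have "real (card scores) \<le> real ((C * m + 1) ^ (C * n0))" using card_scores by (simp only: of_nat_le_iff)
      also have "\<dots> = real (C * m + 1) ^ (C * n0)" by (rule of_nat_power)
      also have "\<dots> = exp (ln (real (C * m + 1))) ^ (C * n0)"
      proof -
        have "0 < real (C * m + 1)" by (subst of_nat_0_less_iff) simp
        then show ?thesis by (simp only: exp_ln)
      qed
      also have "\<dots> = exp (real n0 * G)" unfolding G_def exp_of_nat_mult[symmetric] by (simp add: mult_ac)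
      finally have "real (card scores) * exp (- (ec\<^sup>2 / 4) * real E) \<le> exp (real n0 * G) * exp (- (ec\<^sup>2 / 4) * real E)"
        by (rule mult_right_mono) simp
      also have "\<dots> = exp (real n0 * (G - ec\<^sup>2 / 4 * real D))" unfolding exp_add[symmetric] E_def by (simp add: algebra_simps)
      also have "\<dots> \<le> exp (real n0 * (-2))"
      proof -
        have "G - ec\<^sup>2 / 4 * real D \<le> -2" using DG by linarith
        then have "real n0 * (G - ec\<^sup>2 / 4 * real D) \<le> real n0 * (-2)" by (rule mult_left_mono) simp
        then show ?thesis by (simp only: exp_le_cancel_iff)
      qed
      also have "\<dots> \<le> exp (1 * (-2))" using n0 by simp
      also have "\<dots> < 1/3"
      proof -
        have "5 \<le> exp (2::real)" using exp_lower_Taylor_quadratic[of "2::real"] by simp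
        then show ?thesis by (simp add: exp_minus field_simps)
      qed
      finally show ?thesis .
    qed
    obtain \<omega> where \<omega>: "\<omega> \<in> R.\<Omega>" and sc: "\<forall>f\<in>scores. (\<Sum>e<E. f (\<omega> e)) \<le> (b + ec) * real E" and
      sparse: "\<forall>w\<in>{1..s}. R.dense_pairs w (w + nat \<lceil>\<kappa> * real w\<rceil>) \<omega> = {}" and
      few: "(\<Sum>w=1..g. real (card (R.dense_pairs w w \<omega>))) < T"
    proof -
      have "(\<Sum>x\<in>Z. f x) \<le> b * real (card Z)" if f: "f \<in> scores" for f
      proof -
        obtain f' where f': "f = score f'" using f unfolding scores_def by auto
        show ?thesis unfolding f' b_def by (rule score_mean) (use cut col in blast)+
      qed
      moreover have "0 \<le> f x \<and> f x \<le> 1" if "f \<in> scores" for f x using that unfolding scores_def score_def by auto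
      ultimately have "\<exists>\<omega>\<in>R.\<Omega>. (\<forall>f\<in>scores. (\<Sum>e<E. f (\<omega> e)) \<le> (b + ec) * real E) \<and>
         (\<forall>w\<in>{1..s}. R.dense_pairs w (w + nat \<lceil>\<kappa> * real w\<rceil>) \<omega> = {}) \<and>
         (\<Sum>w=1..g. real (card (R.dense_pairs w w \<omega>))) < T"
        by (intro R.good_outcome finite_scores ec p(1) h1 h2[folded RA] T[unfolded RA[symmetric]]) auto
      then show ?thesis using that by blast
    qed
    have \<omega>Z: "\<omega> e \<in> Z" if "e < E" for e using \<omega> that unfolding R.\<Omega>_def by auto
    have small': "2 * (\<kappa> + 1 / real g) < 1" by (rule le_less_trans[OF mult_left_mono[OF p(6)] p(9)]) simp
    obtain R where R: "R \<subseteq> {..<E}" "real (card R) \<le> real g * T" "inj_on (R.ends \<omega>) ({..<E} - R)"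
      "sparse_upto s (\<kappa> + 1 / real g) (R.ends \<omega> ` ({..<E} - R))"
      using R.prune[OF _ sparse few p(1,2) small' p(3)] Z_props(1-3)[OF \<omega>Z] by metis
    define Es where "Es = {..<E} - R"
    have ends: "R.ends \<omega> = (\<lambda>e. {hd_of (\<omega> e), tl_of (\<omega> e)})" unfolding R.ends_def ..
    have sp: "sparse_upto s \<kappa>' ((\<lambda>e. {hd_of (\<omega> e), tl_of (\<omega> e)}) ` Es)"
      unfolding sparse_upto_def
    proof (intro allI impI)
      fix F assume "F \<subseteq> (\<lambda>e. {hd_of (\<omega> e), tl_of (\<omega> e)}) ` Es" "F \<noteq> {} \<and> finite F \<and> card F \<le> s"
      then have "real (card F) - real (card (\<Union>F)) + 1 \<le> (\<kappa> + 1 / real g) * real (card F)"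
        using R(4) unfolding sparse_upto_def Es_def ends by blast
      also have "\<dots> \<le> \<kappa>' * real (card F)" using p(6) by (rule mult_right_mono) simp
      finally show "real (card F) - real (card (\<Union>F)) + 1 \<le> \<kappa>' * real (card F)" .
    qed
    have E0: "0 < real E" using D1 n0 by (simp add: E_def)
    have "real (card R) \<le> e / 16 * real E"
    proof -
      have "real g * T \<le> e * real D / 16 * real n0" unfolding T_def by (rule h3)
      then show ?thesis using R(2) by (simp add: E_def)
    qed
    moreover have "real (card Es) = real E - real (card R)"
    proof -
      have "card Es = E - card R" unfolding Es_def using R(1) by (simp add: card_Diff_subset finite_subset)
      moreover have "card R \<le> E" using card_mono[OF _ R(1)] by simp
      ultimately show ?thesis by (simp add: of_nat_diff)
    qed
    ultimately have cEs: "(1 - e / 16) * real E \<le> real (card Es)" by (simp add: left_diff_distrib)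
    have "0 < (1 - e / 16) * real E" using E0 e by simp
    then have "0 < real (card Es)" using cEs by linarith
    then have Es: "Es \<subseteq> {..<E}" "Es \<noteq> {}" unfolding Es_def by (auto simp: card_gt_0_iff)
    let ?I = "inst Es \<omega>"
    let ?Q = "price_grid ?I"
    have I: "graph_pricing_instance ?I" by (rule inst_valid[OF Es \<omega>Z])
    obtain x where x: "sa_feasible ?I ?Q r x" and val: "real (card Es) * (1 / real m - 2 * real k * \<beta>) \<le> sa_value ?I ?Q x"
      using sa_side[OF m_def Es \<omega>Z R(3)[folded Es_def, unfolded ends] sp p(7,8) p(4,5) r(2,1) \<mu>(1,2) small \<beta> nh e\<sigma> Ch\<mu> less_imp_le[OF \<sigma>]]
      by blast
    have "1 / real m - 2 * real k * \<beta> = (1 - e / 16) / real m"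
      unfolding \<beta>_def using k0 m17 by (simp add: field_simps)
    then have "(1 - e / 16) * real E * ((1 - e / 16) / real m) \<le> real (card Es) * (1 / real m - 2 * real k * \<beta>)"
      using cEs e by (simp only:) (intro mult_right_mono, auto)
    then have val2: "real E * ((1 - e / 16) * ((1 - e / 16) / real m)) \<le> sa_value ?I ?Q x"
      using val by (simp add: mult_ac)
    have "0 < (1 - e / 16) * ((1 - e / 16) / real m)" using e m17 by simp
    then have vpos: "0 < sa_value ?I ?Q x" using val2 E0 by (smt (verit) mult_pos_pos)
    have "pricing_opt ?I \<le> (b + ec + 2 / real M) * real E" by (rule inst_opt[OF Es(1) \<omega>Z sc])
    also have "\<dots> \<le> ((1/4 + e) * ((1 - e/16) * ((1 - e/16) / real m))) * real E"
      unfolding b_def ec_def by (intro mult_right_mono gap_arithmetic e m_gt M_ge) auto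
    also have "\<dots> = (1/4 + e) * (real E * ((1 - e / 16) * ((1 - e / 16) / real m)))" by simp
    also have "\<dots> \<le> (1/4 + e) * sa_value ?I ?Q x" using val2 e by (intro mult_left_mono) auto
    also have "\<dots> \<le> (1/4 + \<epsilon>) * sa_value ?I ?Q x" using vpos e by (intro mult_right_mono) auto
    finally have gap: "pricing_opt ?I \<le> (1/4 + \<epsilon>) * sa_value ?I ?Q x" .
    have up: "sa_value ?I ?Q x \<le> sa_opt ?I ?Q r"
      unfolding sa_opt_def using x bdd_above_sa_value[OF I finite_price_grid r(1)] by (intro cSUP_upper) auto
    have "pricing_opt ?I \<le> (1/4 + \<epsilon>) * sa_opt ?I ?Q r"
      using gap mult_left_mono[OF up, of "1/4 + \<epsilon>"] assms by linarith
    then have ig: "integrality_gap ?I ?Q r \<le> 1/4 + \<epsilon>"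
      unfolding integrality_gap_def using vpos up by (simp add: divide_le_eq)
    have "verts ?I = V" unfolding inst_def by simp
    moreover have "\<forall>e\<in>edges ?I. budget ?I e \<in> \<nat>"
      unfolding inst_def by (auto simp flip: of_nat_power)
    ultimately show "\<exists>n\<ge>N. \<exists>I :: (nat, nat) pricing_instance.
       graph_pricing_instance I \<and> card (verts I) = n \<and>
       (\<forall>e\<in>edges I. budget I e \<in> \<nat>) \<and>
       integrality_gap I (price_grid I) (nat \<lfloor>real n powr \<delta>\<rfloor>) \<le> 1 / 4 + \<epsilon> \<and>
       (\<exists>x. sa_feasible I (price_grid I) (nat \<lfloor>real n powr \<delta>\<rfloor>) x \<and>
            pricing_opt I \<le> (1 / 4 + \<epsilon>) * sa_value I (price_grid I) x)"
      using nN I cV ig x gap unfolding r_def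
      by (intro exI[of _ n] conjI exI[of _ ?I] exI[of _ x]) auto
  qed
qed

end
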